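(* Let $H$ be a cocommutative quantum groupoid and $F$ a weak invertible unit 2-cocycle for $H$. Equip $C_H(H_s)$ with the action $\mathrm{Ad}_h(a)=h_1aS(h_2)$, multiplication $a\cdot_F b=\mathrm{Ad}_{F^{(1)}}(a)\mathrm{Ad}_{F^{(2)}}(b)$, unit $\eta_F:H_t\to C_H(H_s)$, $\eta_F(x)=x$, comultiplication $\Delta_F(a)=\mathrm{Ad}_{F^{-(1)}}(a_1)\otimes_t\mathrm{Ad}_{F^{-(2)}}(a_2)$ and counit $\varepsilon_F:C_H(H_s)\to H_t$, $\varepsilon_F(a)=\varepsilon_t(a)$. Then $C_H(H_s)$ is a Hopf algebra in ${}_H\mathcal{M}_F$, whose antipode $S_F:C_H(H_s)\to C_H(H_s)$ is given by $S_F(a)=S(a)$ for all $a\in C_H(H_s)$.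
   Context: Let $k$ be a field; Sweedler notation $\Delta(c)=c_1\otimes c_2$ is used, and $\Delta(1)=1_1\otimes 1_2=1'_1\otimes 1'_2$. Quantum groupoids (weak Hopf algebras). A weak bialgebra $H$ is a $k$-algebra and a $k$-coalgebra $(H,\Delta,\varepsilon)$ with $\Delta(hl)=\Delta(h)\Delta(l)$, $\Delta^2(1)=1_1\otimes 1_2 1'_1\otimes 1'_2=1_1\otimes 1'_1 1_2\otimes 1'_2$, and $\varepsilon(hgl)=\varepsilon(hg_1)\varepsilon(g_2l)=\varepsilon(hg_2)\varepsilon(g_1l)$. Put $\varepsilon_t(h)=\varepsilon(1_1h)1_2$ and $\varepsilon_s(h)=1_1\varepsilon(h1_2)$. $H$ is a quantum groupoid if there is a linear map $S:H\to H$ (the antipode) with $S*\mathrm{id}=\varepsilon_s$, $\mathrm{id}*S=\varepsilon_t$, $S*\mathrm{id}*S=S$ ($*$ = convolution). The antipode is always assumed bijective. $H_t=\varepsilon_t(H)$, $H_s=\varepsilon_s(H)$. Cocommutative means $\Delta=\Delta^{cop}$. $C_H(H_s)=\{g\in H\mid gx=xg\ \forall x\in H_s\}$. In the formula for $\Delta_F$, $a_1\otimes a_2$ is the comultiplication of $H$ and $\mathrm{Ad}_h(a)=h_1aS(h_2)$ is applied by the same formula to arbitrary elements of $H$. A weak invertible unit 2-cocycle is $F=F^{(1)}\otimes F^{(2)}\in\Delta(1)(H\otimes H)\Delta^{cop}(1)$ such that: (1) there is $F^{-1}=F^{-(1)}\otimes F^{-(2)}\in\Delta^{cop}(1)(H\otimes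 H)\Delta(1)$ with $FF^{-1}=\Delta(1)$, $F^{-1}F=\Delta^{cop}(1)$; (2) $((\Delta\otimes\mathrm{id})F)(F\otimes 1)=((\mathrm{id}\otimes\Delta)F)(1\otimes F)$; (3) for all $y\in H_s$, $z\in H_t$: $(1\otimes y)F=F(y\otimes 1)$, $(z\otimes 1)F=F(1\otimes z)$, $F^{-1}(1\otimes y)=(y\otimes 1)F^{-1}$, $F^{-1}(z\otimes 1)=(1\otimes z)F^{-1}$, $(1\otimes y)F^{-1}=(S^{-1}(y)\otimes 1)F^{-1}$, $F(z\otimes 1)=F(1\otimes S^{-1}(z))$. For $H$ cocommutative, ${}_H\mathcal{M}_F$ is the category of left $H$-modules (action of $h$ on $m$ written $\mathrm{Ad}_h(m)$) with tensor product $M\otimes_t N=\Delta(1)\cdot(M\otimes_k N)$, $m\otimes_t n=\mathrm{Ad}_{1_1}(m)\otimes\mathrm{Ad}_{1_2}(n)$, on which $H$ acts by $\mathrm{Ad}_h(m\otimes_t n)=\mathrm{Ad}_{F^{-(1)}h_1F^{(1)}}(m)\otimes_t\mathrm{Ad}_{F^{-(2)}h_2F^{(2)}}(n)$, and braiding $\Phi(m\otimes_t n)=\mathrm{Ad}_{F^{-(1)}F^{(2)}}(n)\otimes_t\mathrm{Ad}_{F^{-(2)}F^{(1)}}(m)$. The unit object is $H_t$ with $h$ acting by $z\mapsto\varepsilon_t(hz)$, the associator is trivial, and the unit constraints are $z\otimes_t m\mapsto\mathrm{Ad}_z(m)$ and $m\otimes_t z\mapsto\mathrm{Ad}_{S^{-1}(z)}(m)$.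 A bialgebra in a braided monoidal category with braiding $\Psi$ is an object with an algebra structure $(\mu,\eta)$ and a coalgebra structure $(\Delta,\varepsilon)$ in the category (all structure maps being morphisms) such that $\Delta\circ\mu=(\mu\otimes\mu)\circ(\mathrm{id}\otimes\Psi\otimes\mathrm{id})\circ(\Delta\otimes\Delta)$, $\varepsilon\circ\mu=\varepsilon\otimes\varepsilon$ and $\Delta\circ\eta=\eta\otimes\eta$ (i.e. $\Delta(1)=1\otimes 1$), identifying $I\otimes I$ with the unit object $I$. It is a Hopf algebra if there is a morphism $S$ in the category (antipode) with $\mu\circ(S\otimes\mathrm{id})\circ\Delta=\eta\circ\varepsilon=\mu\circ(\mathrm{id}\otimes S)\circ\Delta$.
   Formalization: The cocycle F is additionally assumed normalised, (ε⊗id)F = 1; without this the unit law fails, e.g. for H = k and F = c(1⊗1) with c not 0 or 1, and the condition is necessary for the conclusion. *)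

theory Defs
  imports Complex_Main
begin

section \<open>Tensor products of vector spaces\<close>

text \<open>
  Vector spaces over a field \<open>'k\<close> are subspaces of ambient types \<open>'a\<close> with an explicit scalar
  multiplication \<open>'k \<Rightarrow> 'a \<Rightarrow> 'a\<close>.  The tensor \<open>a \<otimes> b\<close> is modelled as evaluation at \<open>(a, b)\<close> on the
  bilinear forms, and the tensor product of two subspaces as the span of these.  Over a field this is
  the usual tensor product; its universal property is lemma \<open>lift_along_tens\<close> below.
\<close>

typedef ('a, 'b, 'k) tensor = "UNIV :: (('a \<Rightarrow> 'b \<Rightarrow> 'k) \<Rightarrow> 'k) set"
  by simp

setup_lifting type_definition_tensor

instantiation tensor :: (type, type, ab_group_add) ab_group_add
begin

lift_definition zero_tensor :: "('a, 'b, 'c) tensor" is "\<lambda>_. 0" .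
lift_definition plus_tensor :: "('a, 'b, 'c) tensor \<Rightarrow> ('a, 'b, 'c) tensor \<Rightarrow> ('a, 'b, 'c) tensor"
  is "\<lambda>s t \<beta>. s \<beta> + t \<beta>" .
lift_definition minus_tensor :: "('a, 'b, 'c) tensor \<Rightarrow> ('a, 'b, 'c) tensor \<Rightarrow> ('a, 'b, 'c) tensor"
  is "\<lambda>s t \<beta>. s \<beta> - t \<beta>" .
lift_definition uminus_tensor :: "('a, 'b, 'c) tensor \<Rightarrow> ('a, 'b, 'c) tensor"
  is "\<lambda>t \<beta>. - t \<beta>" .

instance
  by standard (transfer; simp add: fun_eq_iff)+

end

lift_definition tscale :: "'k::field \<Rightarrow> ('a, 'b, 'k) tensor \<Rightarrow> ('a, 'b, 'k) tensor"
  is "\<lambda>c t \<beta>. c * t \<beta>" .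

definition bilinear_form ::
  "('k::field \<Rightarrow> 'a::ab_group_add \<Rightarrow> 'a) \<Rightarrow> ('k \<Rightarrow> 'b::ab_group_add \<Rightarrow> 'b) \<Rightarrow> ('a \<Rightarrow> 'b \<Rightarrow> 'k) \<Rightarrow> bool"
  where "bilinear_form sA sB \<beta> \<longleftrightarrow>
    (\<forall>b. Vector_Spaces.linear sA (*) (\<lambda>a. \<beta> a b)) \<and> (\<forall>a. Vector_Spaces.linear sB (*) (\<beta> a))"

lift_definition tens ::
  "('k::field \<Rightarrow> 'a::ab_group_add \<Rightarrow> 'a) \<Rightarrow> ('k \<Rightarrow> 'b::ab_group_add \<Rightarrow> 'b) \<Rightarrow> 'a \<Rightarrow> 'b \<Rightarrow> ('a, 'b, 'k) tensor"
  is "\<lambda>sA sB a b \<beta>. if bilinear_form sA sB \<beta> then \<beta> a b else 0" .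

definition tensor_space ::
  "('k::field \<Rightarrow> 'a::ab_group_add \<Rightarrow> 'a) \<Rightarrow> ('k \<Rightarrow> 'b::ab_group_add \<Rightarrow> 'b) \<Rightarrow> 'a set \<Rightarrow> 'b set
    \<Rightarrow> ('a, 'b, 'k) tensor set"
  where "tensor_space sA sB A B = module.span tscale {tens sA sB a b |a b. a \<in> A \<and> b \<in> B}"

text \<open>
  \<open>lift_along p A B f\<close> is the map \<open>p a b \<mapsto> f a b\<close> (\<open>a \<in> A\<close>, \<open>b \<in> B\<close>), extended additively: write
  the argument as a finite sum of elements \<open>p a b\<close> and apply \<open>f\<close> to the summands.  It is meaningful
  when the result does not depend on the chosen expression.  With \<open>p = tens sA sB\<close> and \<open>f\<close> bilinear
  on \<open>A \<times> B\<close> it is the induced linear map on the tensor product; it also renders Sweedler notation.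
\<close>

definition lift_along ::
  "('a \<Rightarrow> 'b \<Rightarrow> 't::comm_monoid_add) \<Rightarrow> 'a set \<Rightarrow> 'b set \<Rightarrow> ('a \<Rightarrow> 'b \<Rightarrow> 'c::comm_monoid_add) \<Rightarrow> 't \<Rightarrow> 'c"
  where "lift_along p A B f t =
    (SOME y. \<exists>(n::nat) a b. (\<forall>i<n. a i \<in> A \<and> b i \<in> B) \<and>
       t = (\<Sum>i<n. p (a i) (b i)) \<and> y = (\<Sum>i<n. f (a i) (b i)))"

lemma tscale_vector_space: "vector_space (tscale :: 'k::field \<Rightarrow> ('a,'b,'k) tensor \<Rightarrow> _)"
  by unfold_locales (transfer; simp add: fun_eq_iff algebra_simps)+

lemma Rep_sum: "Rep_tensor (\<Sum>i\<in>I. t i) \<beta> = (\<Sum>i\<in>I. Rep_tensor (t i) \<beta>)"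
  by (induction I rule: infinite_finite_induct) (auto simp: zero_tensor.rep_eq plus_tensor.rep_eq)

lemma bilinear_form_mult:
  assumes "Vector_Spaces.linear sA (*) \<psi>" "Vector_Spaces.linear sB (*) \<phi>"
  shows "bilinear_form sA sB (\<lambda>x y. \<psi> x * \<phi> y)"
  using assms by (simp add: bilinear_form_def Vector_Spaces.linear_iff algebra_simps)

lemma tens_sum_zero:
  fixes f :: "'a::ab_group_add \<Rightarrow> 'b::ab_group_add \<Rightarrow> 'c::ab_group_add"
  assumes vA: "vector_space (sA :: 'k::field \<Rightarrow> 'a \<Rightarrow> 'a)" and vB: "vector_space sB"
    and A: "module.subspace sA A" and B: "module.subspace sB B"
    and fl: "\<And>x y b. x \<in> A \<Longrightarrow> y \<in> A \<Longrightarrow> b \<in> B \<Longrightarrow> f (x + y) b = f x b + f y b"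
    and fr: "\<And>a x y. a \<in> A \<Longrightarrow> x \<in> B \<Longrightarrow> y \<in> B \<Longrightarrow> f a (x + y) = f a x + f a y"
    and fc: "\<And>c a b. a \<in> A \<Longrightarrow> b \<in> B \<Longrightarrow> f (sA c a) b = f a (sB c b)"
    and I: "finite I" and ab: "\<And>i. i \<in> I \<Longrightarrow> a i \<in> A \<and> b i \<in> B"
    and z: "(\<Sum>i\<in>I. tens sA sB (a i) (b i)) = 0"
  shows "(\<Sum>i\<in>I. f (a i) (b i)) = 0"
proof -
  interpret A: vector_space sA by fact
  interpret B: vector_space sB by fact
  have vk: "vector_space ((*) :: 'k \<Rightarrow> 'k \<Rightarrow> 'k)" by unfold_locales (auto simp: algebra_simps)
  interpret pA: vector_space_pair sA "(*) :: 'k \<Rightarrow> 'k \<Rightarrow> 'k" using vA vk by (simp add: vector_space_pair_def)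
  interpret pB: vector_space_pair sB "(*) :: 'k \<Rightarrow> 'k \<Rightarrow> 'k" using vB vk by (simp add: vector_space_pair_def)
  obtain E where E: "E \<subseteq> a ` I" "A.independent E" "a ` I \<subseteq> A.span E"
    using A.maximal_independent_subset[of "a ` I"] by blast
  have finE: "finite E" using E(1) I by (meson finite_imageI finite_subset)
  have EA: "E \<subseteq> A" using E(1) ab by auto
  define r where "r i e = A.representation E (a i) e" for i e
  have ai: "a i = (\<Sum>e\<in>E. sA (r i e) e)" if "i \<in> I" for i
  proof -
    have "a i \<in> A.span E" using E(3) that by blast
    then show ?thesis
      unfolding r_def by (rule A.sum_representation_eq[symmetric, OF E(2) _ finE order_refl])
  qed
  define b' where "b' e = (\<Sum>i\<in>I. sB (r i e) (b i))" for e
  have sumB: "(\<Sum>i\<in>J. g i) \<in> B" if "\<And>i. i \<in> J \<Longrightarrow> g i \<in> B" for J and g :: "'i \<Rightarrow> 'b"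
    using B that by (simp add: B.subspace_sum)
  have b'0: "b' e = 0" if e: "e \<in> E" for e
  proof (rule ccontr)
    assume ne: "b' e \<noteq> 0"
    obtain \<phi> where \<phi>: "Vector_Spaces.linear sB (*) \<phi>" "\<phi> (b' e) = 1"
      using pB.linear_independent_extend[of "{b' e}" "\<lambda>_. 1"] ne by auto
    obtain \<psi> where \<psi>: "Vector_Spaces.linear sA (*) \<psi>" "\<forall>x\<in>E. \<psi> x = (if x = e then 1 else 0)"
      using pA.linear_independent_extend[of E "\<lambda>x. if x = e then 1 else 0"] E by auto
    interpret phi: Vector_Spaces.linear sB "(*)" \<phi> by (fact \<phi>)
    interpret psi: Vector_Spaces.linear sA "(*)" \<psi> by (fact \<psi>)
    have bil: "bilinear_form sA sB (\<lambda>x y. \<psi> x * \<phi> y)"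
      using \<psi>(1) \<phi>(1) by (rule bilinear_form_mult)
    have psia: "\<psi> (a i) = r i e" if "i \<in> I" for i
    proof -
      have "\<psi> (a i) = (\<Sum>x\<in>E. r i x * \<psi> x)"
        using ai[OF that] by (simp add: psi.sum psi.scale)
      also have "\<dots> = (\<Sum>x\<in>E. if x = e then r i x else 0)"
        by (rule sum.cong) (use \<psi>(2) in auto)
      finally show ?thesis using e finE by simp
    qed
    have "0 = Rep_tensor (\<Sum>i\<in>I. tens sA sB (a i) (b i)) (\<lambda>x y. \<psi> x * \<phi> y)"
      by (simp add: z zero_tensor.rep_eq)
    also have "\<dots> = (\<Sum>i\<in>I. \<psi> (a i) * \<phi> (b i))"
      by (simp add: Rep_sum tens.rep_eq bil)
    also have "\<dots> = \<phi> (b' e)"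
      unfolding b'_def by (simp add: phi.sum phi.scale psia)
    finally show False using \<phi>(2) by simp
  qed
  have f0l: "f 0 y = 0" if "y \<in> B" for y
    using fl[of 0 0 y] that A.subspace_0[OF A] by simp
  have f0r: "f x 0 = 0" if "x \<in> A" for x
    using fr[of x 0 0] that B.subspace_0[OF B] by simp
  have fsl: "f (\<Sum>j\<in>J. g j) y = (\<Sum>j\<in>J. f (g j) y)" if "finite J" "\<And>j. j \<in> J \<Longrightarrow> g j \<in> A" "y \<in> B"
    for J and g :: "'a \<Rightarrow> 'a" and y
    using that by (induction J rule: finite_induct) (auto simp: f0l fl A.subspace_sum[OF A])
  have fsr: "f x (\<Sum>j\<in>J. g j) = (\<Sum>j\<in>J. f x (g j))" if "finite J" "\<And>j. j \<in> J \<Longrightarrow> g j \<in> B" "x \<in> A"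
    for J and g :: "'d \<Rightarrow> 'b" and x
    using that by (induction J rule: finite_induct) (auto simp: f0r fr B.subspace_sum[OF B])
  have "(\<Sum>i\<in>I. f (a i) (b i)) = (\<Sum>i\<in>I. \<Sum>e\<in>E. f e (sB (r i e) (b i)))"
  proof (rule sum.cong)
    fix i assume i: "i \<in> I"
    have "f (a i) (b i) = (\<Sum>e\<in>E. f (sA (r i e) e) (b i))"
      by (subst ai[OF i], rule fsl) (use finE EA ab[OF i] A.subspace_scale[OF A] in auto)
    also have "\<dots> = (\<Sum>e\<in>E. f e (sB (r i e) (b i)))"
      by (rule sum.cong) (use fc EA ab[OF i] in auto)
    finally show "f (a i) (b i) = \<dots>" .
  qed simp
  also have "\<dots> = (\<Sum>e\<in>E. \<Sum>i\<in>I. f e (sB (r i e) (b i)))" by (rule sum.swap)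
  also have "\<dots> = (\<Sum>e\<in>E. f e (b' e))"
    unfolding b'_def
    by (rule sum.cong, simp, rule fsr[symmetric]) (use I ab EA B.subspace_scale[OF B] in auto)
  also have "\<dots> = 0" by (rule sum.neutral) (use b'0 f0r EA in auto)
  finally show ?thesis .
qed

lemma tens_uminus:
  assumes "vector_space (sA :: 'k::field \<Rightarrow> 'a::ab_group_add \<Rightarrow> 'a)"
  shows "tens sA sB (- x) y = - tens sA sB x y"
proof -
  have "\<beta> (-x) y = - \<beta> x y" if "bilinear_form sA sB \<beta>" for \<beta>
  proof -
    interpret l: Vector_Spaces.linear sA "(*)" "\<lambda>a. \<beta> a y" using that by (simp add: bilinear_form_def)
    show ?thesis by (rule l.neg)
  qed
  then show ?thesis by transfer auto
qed

lemma lift_along_tens: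
  fixes f :: "'a::ab_group_add \<Rightarrow> 'b::ab_group_add \<Rightarrow> 'c::ab_group_add" and n :: nat
  assumes vA: "vector_space (sA :: 'k::field \<Rightarrow> 'a \<Rightarrow> 'a)" and vB: "vector_space sB"
    and A: "module.subspace sA A" and B: "module.subspace sB B"
    and fl: "\<And>x y b. x \<in> A \<Longrightarrow> y \<in> A \<Longrightarrow> b \<in> B \<Longrightarrow> f (x + y) b = f x b + f y b"
    and fr: "\<And>a x y. a \<in> A \<Longrightarrow> x \<in> B \<Longrightarrow> y \<in> B \<Longrightarrow> f a (x + y) = f a x + f a y"
    and fc: "\<And>c a b. a \<in> A \<Longrightarrow> b \<in> B \<Longrightarrow> f (sA c a) b = f a (sB c b)"
    and ab: "\<And>i. i < n \<Longrightarrow> a i \<in> A \<and> b i \<in> B"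
  shows "lift_along (tens sA sB) A B f (\<Sum>i<n. tens sA sB (a i) (b i)) = (\<Sum>i<n. f (a i) (b i))"
  unfolding lift_along_def
proof (rule some_equality)
  show "\<exists>(m::nat) a' b'. (\<forall>i<m. a' i \<in> A \<and> b' i \<in> B) \<and>
      (\<Sum>i<n. tens sA sB (a i) (b i)) = (\<Sum>i<m. tens sA sB (a' i) (b' i)) \<and>
      (\<Sum>i<n. f (a i) (b i)) = (\<Sum>i<m. f (a' i) (b' i))"
    by (rule exI[of _ n], rule exI[of _ a], rule exI[of _ b]) (use ab in simp)
next
  interpret A: vector_space sA by fact
  interpret B: vector_space sB by fact
  fix y
  assume "\<exists>(m::nat) a' b'. (\<forall>i<m. a' i \<in> A \<and> b' i \<in> B) \<and>
      (\<Sum>i<n. tens sA sB (a i) (b i)) = (\<Sum>i<m. tens sA sB (a' i) (b' i)) \<and>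
      y = (\<Sum>i<m. f (a' i) (b' i))"
  then obtain m :: nat and a' b' where ab': "\<And>i. i < m \<Longrightarrow> a' i \<in> A \<and> b' i \<in> B"
    and eq: "(\<Sum>i<n. tens sA sB (a i) (b i)) = (\<Sum>i<m. tens sA sB (a' i) (b' i))"
    and y: "y = (\<Sum>i<m. f (a' i) (b' i))" by blast
  define u where "u j = (case j of Inl i \<Rightarrow> a i | Inr i \<Rightarrow> - a' i)" for j
  define v where "v j = (case j of Inl i \<Rightarrow> b i | Inr i \<Rightarrow> b' i)" for j
  have f0: "f 0 y = 0" if "y \<in> B" for y
    using fl[of 0 0 y] that A.subspace_0[OF A] by simp
  have fneg: "f (- x) y = - f x y" if "x \<in> A" "y \<in> B" for x y
  proof -
    have "f x y + f (- x) y = 0"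
      using fl[of x "- x" y] f0[of y] that A.subspace_neg[OF A] by simp
    then show ?thesis by (rule minus_unique[symmetric])
  qed
  have uv: "u j \<in> A \<and> v j \<in> B" if "j \<in> {..<n} <+> {..<m}" for j
    using that ab ab' A.subspace_neg[OF A] by (auto simp: u_def v_def)
  have "(\<Sum>j\<in>{..<n} <+> {..<m}. tens sA sB (u j) (v j)) =
      (\<Sum>i<n. tens sA sB (a i) (b i)) - (\<Sum>i<m. tens sA sB (a' i) (b' i))"
    by (simp add: sum.Plus u_def v_def tens_uminus[OF vA] sum_negf)
  then have "(\<Sum>j\<in>{..<n} <+> {..<m}. tens sA sB (u j) (v j)) = 0"
    unfolding eq by simp
  have "(\<Sum>j\<in>{..<n} <+> {..<m}. f (u j) (v j)) = 0"
  proof (rule tens_sum_zero[where f = f and a = u and b = v, OF vA vB A B])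
    show "finite ({..<n} <+> {..<m})" by simp
    show "(\<Sum>j\<in>{..<n} <+> {..<m}. tens sA sB (u j) (v j)) = 0" by fact
  qed (rule fl fr fc uv; assumption)+
  also have "(\<Sum>j\<in>{..<n} <+> {..<m}. f (u j) (v j)) =
      (\<Sum>i<n. f (a i) (b i)) + (\<Sum>i<m. f (- a' i) (b' i))"
    by (simp add: sum.Plus u_def v_def)
  also have "(\<Sum>i<m. f (- a' i) (b' i)) = - y"
    unfolding y sum_negf[symmetric] by (rule sum.cong) (use fneg ab' in auto)
  finally show "y = (\<Sum>i<n. f (a i) (b i))" by simp
qed


section \<open>Quantum groupoids\<close>

text \<open>
  The ring structure of \<open>H\<close> is that of the type \<open>'h :: {ring, monoid_mult}\<close>; unlike \<open>ring_1\<close> this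
  sort admits the zero algebra.
\<close>

record ('k, 'h) qgroupoid =
  smult :: "'k \<Rightarrow> 'h \<Rightarrow> 'h"
  comult :: "'h \<Rightarrow> ('h, 'h, 'k) tensor"
  counit :: "'h \<Rightarrow> 'k"
  antipode :: "'h \<Rightarrow> 'h"

definition tensH :: "('k::field, 'h::ab_group_add) qgroupoid \<Rightarrow> 'h \<Rightarrow> 'h \<Rightarrow> ('h, 'h, 'k) tensor"
    (infixl "\<otimes>\<index>" 70)
  where "a \<otimes>\<^bsub>H\<^esub> b = tens (smult H) (smult H) a b"

definition HH :: "('k::field, 'h::ab_group_add) qgroupoid \<Rightarrow> ('h, 'h, 'k) tensor set"
  where "HH H = tensor_space (smult H) (smult H) UNIV UNIV"

text \<open>Sweedler notation: \<open>sw H f t\<close> is \<open>f t\<^sub>1 t\<^sub>2\<close> for \<open>t = t\<^sub>1 \<otimes> t\<^sub>2\<close> in \<open>H \<otimes> H\<close>.\<close>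

definition sw :: "('k::field, 'h::ab_group_add) qgroupoid \<Rightarrow> ('h \<Rightarrow> 'h \<Rightarrow> 'c::comm_monoid_add)
    \<Rightarrow> ('h, 'h, 'k) tensor \<Rightarrow> 'c"
  where "sw H f t = lift_along (tensH H) UNIV UNIV f t"

definition mult2 :: "('k::field, 'h::{ring,monoid_mult}) qgroupoid
    \<Rightarrow> ('h, 'h, 'k) tensor \<Rightarrow> ('h, 'h, 'k) tensor \<Rightarrow> ('h, 'h, 'k) tensor" (infixl "\<bullet>\<index>" 70)
  where "s \<bullet>\<^bsub>H\<^esub> t = sw H (\<lambda>a b. sw H (\<lambda>c d. (a * c) \<otimes>\<^bsub>H\<^esub> (b * d)) t) s"

definition comult_cop :: "('k::field, 'h::ab_group_add) qgroupoid \<Rightarrow> 'h \<Rightarrow> ('h, 'h, 'k) tensor"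
  where "comult_cop H h = sw H (\<lambda>a b. b \<otimes>\<^bsub>H\<^esub> a) (comult H h)"

text \<open>\<open>H \<otimes> H \<otimes> H\<close> is realised as \<open>H \<otimes> (H \<otimes> H)\<close>.\<close>

definition tensHHH :: "('k::field, 'h::ab_group_add) qgroupoid \<Rightarrow> 'h \<Rightarrow> ('h, 'h, 'k) tensor
    \<Rightarrow> ('h, ('h, 'h, 'k) tensor, 'k) tensor"
  where "tensHHH H a u = tens (smult H) tscale a u"

definition mult3 :: "('k::field, 'h::{ring,monoid_mult}) qgroupoid \<Rightarrow> ('h, ('h, 'h, 'k) tensor, 'k) tensor
    \<Rightarrow> ('h, ('h, 'h, 'k) tensor, 'k) tensor \<Rightarrow> ('h, ('h, 'h, 'k) tensor, 'k) tensor"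
  where "mult3 H s t =
    lift_along (tensHHH H) UNIV (HH H) (\<lambda>a u.
      lift_along (tensHHH H) UNIV (HH H) (\<lambda>c v. tensHHH H (a * c) (u \<bullet>\<^bsub>H\<^esub> v)) t) s"

definition comult_id :: "('k::field, 'h::ab_group_add) qgroupoid \<Rightarrow> ('h, 'h, 'k) tensor
    \<Rightarrow> ('h, ('h, 'h, 'k) tensor, 'k) tensor"
  where "comult_id H t =
    sw H (\<lambda>a b. sw H (\<lambda>a\<^sub>1 a\<^sub>2. tensHHH H a\<^sub>1 (a\<^sub>2 \<otimes>\<^bsub>H\<^esub> b)) (comult H a)) t"

definition id_comult :: "('k::field, 'h::ab_group_add) qgroupoid \<Rightarrow> ('h, 'h, 'k) tensor
    \<Rightarrow> ('h, ('h, 'h, 'k) tensor, 'k) tensor"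
  where "id_comult H t = sw H (\<lambda>a b. tensHHH H a (comult H b)) t"

locale weak_bialgebra =
  fixes H :: "('k::field, 'h::{ring,monoid_mult}) qgroupoid" (structure)
  assumes vector_space: "vector_space (smult H)"
    and smult_mult_left: "smult H c (g * h) = smult H c g * h"
    and smult_mult_right: "smult H c (g * h) = g * smult H c h"
    and comult_in: "comult H h \<in> HH H"
    and comult_linear: "Vector_Spaces.linear (smult H) tscale (comult H)"
    and counit_linear: "Vector_Spaces.linear (smult H) (*) (counit H)"
    and coassoc: "comult_id H (comult H h) = id_comult H (comult H h)"
    and counit_left: "sw H (\<lambda>h\<^sub>1 h\<^sub>2. smult H (counit H h\<^sub>1) h\<^sub>2) (comult H h) = h"
    and counit_right: "sw H (\<lambda>h\<^sub>1 h\<^sub>2. smult H (counit H h\<^sub>2) h\<^sub>1) (comult H h) = h"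
    and comult_mult: "comult H (h * l) = comult H h \<bullet> comult H l"
    and comult_one_left: "id_comult H (comult H 1) =
      sw H (\<lambda>a b. sw H (\<lambda>c d. tensHHH H a ((b * c) \<otimes> d)) (comult H 1)) (comult H 1)"
    and comult_one_right: "id_comult H (comult H 1) =
      sw H (\<lambda>a b. sw H (\<lambda>c d. tensHHH H a ((c * b) \<otimes> d)) (comult H 1)) (comult H 1)"
    and counit_mult_left: "counit H (h * g * l) =
      sw H (\<lambda>g\<^sub>1 g\<^sub>2. counit H (h * g\<^sub>1) * counit H (g\<^sub>2 * l)) (comult H g)"
    and counit_mult_right: "counit H (h * g * l) =
      sw H (\<lambda>g\<^sub>1 g\<^sub>2. counit H (h * g\<^sub>2) * counit H (g\<^sub>1 * l)) (comult H g)"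

definition eps_t :: "('k::field, 'h::{ring,monoid_mult}) qgroupoid \<Rightarrow> 'h \<Rightarrow> 'h"
  where "eps_t H h = sw H (\<lambda>a b. smult H (counit H (a * h)) b) (comult H 1)"

definition eps_s :: "('k::field, 'h::{ring,monoid_mult}) qgroupoid \<Rightarrow> 'h \<Rightarrow> 'h"
  where "eps_s H h = sw H (\<lambda>a b. smult H (counit H (h * b)) a) (comult H 1)"

definition H_t :: "('k::field, 'h::{ring,monoid_mult}) qgroupoid \<Rightarrow> 'h set"
  where "H_t H = range (eps_t H)"

definition H_s :: "('k::field, 'h::{ring,monoid_mult}) qgroupoid \<Rightarrow> 'h set"
  where "H_s H = range (eps_s H)"

definition conv :: "('k::field, 'h::{ring,monoid_mult}) qgroupoid \<Rightarrow> ('h \<Rightarrow> 'h) \<Rightarrow> ('h \<Rightarrow> 'h) \<Rightarrow> 'h \<Rightarrow> 'h"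
  where "conv H f g h = sw H (\<lambda>h\<^sub>1 h\<^sub>2. f h\<^sub>1 * g h\<^sub>2) (comult H h)"

locale quantum_groupoid = weak_bialgebra +
  assumes antipode_linear: "Vector_Spaces.linear (smult H) (smult H) (antipode H)"
    and antipode_left: "conv H (antipode H) id = eps_s H"
    and antipode_right: "conv H id (antipode H) = eps_t H"
    and antipode_antipode: "conv H (conv H (antipode H) id) (antipode H) = antipode H"
    and antipode_bij: "bij (antipode H)"

definition cocommutative :: "('k::field, 'h::ab_group_add) qgroupoid \<Rightarrow> bool"
  where "cocommutative H \<longleftrightarrow> comult H = comult_cop H"

definition C_H :: "('k::field, 'h::{ring,monoid_mult}) qgroupoid \<Rightarrow> 'h set"
  where "C_H H = {g. \<forall>x\<in>H_s H. g * x = x * g}"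

definition Ad :: "('k::field, 'h::{ring,monoid_mult}) qgroupoid \<Rightarrow> 'h \<Rightarrow> 'h \<Rightarrow> 'h"
  where "Ad H h a = sw H (\<lambda>h\<^sub>1 h\<^sub>2. h\<^sub>1 * a * antipode H h\<^sub>2) (comult H h)"

text \<open>
  In the following locale \<open>G\<close> is the inverse \<open>F\<^sup>-\<^sup>1\<close>, which is uniquely determined by \<open>F\<close>.
\<close>

locale weak_invertible_unit_2_cocycle =
  fixes H :: "('k::field, 'h::{ring,monoid_mult}) qgroupoid" (structure)
    and F G :: "('h, 'h, 'k) tensor"
  assumes cocycle_in: "\<exists>t\<in>HH H. F = comult H 1 \<bullet> t \<bullet> comult_cop H 1"
    and inverse_in: "\<exists>t\<in>HH H. G = comult_cop H 1 \<bullet> t \<bullet> comult H 1"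
    and inverse_right: "F \<bullet> G = comult H 1"
    and inverse_left: "G \<bullet> F = comult_cop H 1"
    and cocycle: "mult3 H (comult_id H F) (sw H (\<lambda>a b. tensHHH H a (b \<otimes> 1)) F) =
      mult3 H (id_comult H F) (tensHHH H 1 F)"
    and cocycle_s: "y \<in> H_s H \<Longrightarrow> (1 \<otimes> y) \<bullet> F = F \<bullet> (y \<otimes> 1)"
    and cocycle_t: "z \<in> H_t H \<Longrightarrow> (z \<otimes> 1) \<bullet> F = F \<bullet> (1 \<otimes> z)"
    and inverse_s: "y \<in> H_s H \<Longrightarrow> G \<bullet> (1 \<otimes> y) = (y \<otimes> 1) \<bullet> G"
    and inverse_t: "z \<in> H_t H \<Longrightarrow> G \<bullet> (z \<otimes> 1) = (1 \<otimes> z) \<bullet> G"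
    and inverse_s': "y \<in> H_s H \<Longrightarrow> (1 \<otimes> y) \<bullet> G = (inv (antipode H) y \<otimes> 1) \<bullet> G"
    and cocycle_t': "z \<in> H_t H \<Longrightarrow> F \<bullet> (z \<otimes> 1) = F \<bullet> (1 \<otimes> inv (antipode H) z)"

text \<open>
  The locale does not imply the normalisation \<open>(\<epsilon> \<otimes> id) F = 1\<close>: for \<open>H = k\<close> every nonzero scalar
  satisfies it, but only for \<open>F = 1\<close> is \<open>1 \<in> H\<close> a unit of the product twisted by \<open>F\<close>.  Statements
  about that product need the normalisation as a separate assumption, as the meaning of ``unit''.
\<close>


section \<open>The category of modules twisted by \<open>F\<close>\<close>

record ('k, 'h, 'm) hmod =
  carr :: "'m set"
  msc :: "'k \<Rightarrow> 'm \<Rightarrow> 'm"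
  act :: "'h \<Rightarrow> 'm \<Rightarrow> 'm"

definition is_hmod :: "('k::field, 'h::{ring,monoid_mult}) qgroupoid
    \<Rightarrow> ('k, 'h, 'm::ab_group_add) hmod \<Rightarrow> bool"
  where "is_hmod H M \<longleftrightarrow>
    vector_space (msc M) \<and> module.subspace (msc M) (carr M) \<and>
    (\<forall>h. \<forall>m\<in>carr M. act M h m \<in> carr M) \<and>
    (\<forall>h. \<forall>m\<in>carr M. \<forall>n\<in>carr M. act M h (m + n) = act M h m + act M h n) \<and>
    (\<forall>h c. \<forall>m\<in>carr M. act M h (msc M c m) = msc M c (act M h m)) \<and>
    (\<forall>g h. \<forall>m\<in>carr M. act M (g + h) m = act M g m + act M h m) \<and>
    (\<forall>c h. \<forall>m\<in>carr M. act M (smult H c h) m = msc M c (act M h m)) \<and>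
    (\<forall>g h. \<forall>m\<in>carr M. act M (g * h) m = act M g (act M h m)) \<and>
    (\<forall>m\<in>carr M. act M 1 m = m)"

definition is_hom :: "('k::field, 'h, 'm::ab_group_add) hmod \<Rightarrow> ('k, 'h, 'n::ab_group_add) hmod
    \<Rightarrow> ('m \<Rightarrow> 'n) \<Rightarrow> bool"
  where "is_hom M N f \<longleftrightarrow>
    f ` carr M \<subseteq> carr N \<and>
    (\<forall>m\<in>carr M. \<forall>n\<in>carr M. f (m + n) = f m + f n) \<and>
    (\<forall>c. \<forall>m\<in>carr M. f (msc M c m) = msc N c (f m)) \<and>
    (\<forall>h. \<forall>m\<in>carr M. f (act M h m) = act N h (f m))"

text \<open>\<open>tens_t H M N m n\<close> is \<open>m \<otimes>\<^sub>t n\<close>; maps out of \<open>M \<otimes>\<^sub>t N\<close> are given on these elements by \<open>lift_t\<close>.\<close>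

definition tens_t :: "('k::field, 'h::{ring,monoid_mult}) qgroupoid
    \<Rightarrow> ('k, 'h, 'm::ab_group_add) hmod \<Rightarrow> ('k, 'h, 'n::ab_group_add) hmod \<Rightarrow> 'm \<Rightarrow> 'n \<Rightarrow> ('m, 'n, 'k) tensor"
  where "tens_t H M N m n = sw H (\<lambda>a b. tens (msc M) (msc N) (act M a m) (act N b n)) (comult H 1)"

definition carr_t :: "('k::field, 'h::{ring,monoid_mult}) qgroupoid
    \<Rightarrow> ('k, 'h, 'm::ab_group_add) hmod \<Rightarrow> ('k, 'h, 'n::ab_group_add) hmod \<Rightarrow> ('m, 'n, 'k) tensor set"
  where "carr_t H M N =
    lift_along (tens (msc M) (msc N)) (carr M) (carr N) (tens_t H M N)
      ` tensor_space (msc M) (msc N) (carr M) (carr N)"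

definition lift_t :: "('k::field, 'h::{ring,monoid_mult}) qgroupoid
    \<Rightarrow> ('k, 'h, 'm::ab_group_add) hmod \<Rightarrow> ('k, 'h, 'n::ab_group_add) hmod
    \<Rightarrow> ('m \<Rightarrow> 'n \<Rightarrow> 'c::comm_monoid_add) \<Rightarrow> ('m, 'n, 'k) tensor \<Rightarrow> 'c"
  where "lift_t H M N f = lift_along (tens_t H M N) (carr M) (carr N) f"

definition map_t :: "('k::field, 'h::{ring,monoid_mult}) qgroupoid
    \<Rightarrow> ('k, 'h, 'm::ab_group_add) hmod \<Rightarrow> ('k, 'h, 'n::ab_group_add) hmod
    \<Rightarrow> ('k, 'h, 'p::ab_group_add) hmod \<Rightarrow> ('k, 'h, 'q::ab_group_add) hmod
    \<Rightarrow> ('m \<Rightarrow> 'p) \<Rightarrow> ('n \<Rightarrow> 'q) \<Rightarrow> ('m, 'n, 'k) tensor \<Rightarrow> ('p, 'q, 'k) tensor"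
  where "map_t H M N P Q f g = lift_t H M N (\<lambda>m n. tens_t H P Q (f m) (g n))"

definition unit_obj :: "('k::field, 'h::{ring,monoid_mult}) qgroupoid \<Rightarrow> ('k, 'h, 'h) hmod"
  where "unit_obj H = \<lparr>carr = H_t H, msc = smult H, act = (\<lambda>h z. eps_t H (h * z))\<rparr>"

definition lunit :: "('k::field, 'h::{ring,monoid_mult}) qgroupoid
    \<Rightarrow> ('k, 'h, 'm::ab_group_add) hmod \<Rightarrow> ('h, 'm, 'k) tensor \<Rightarrow> 'm"
  where "lunit H M = lift_t H (unit_obj H) M (\<lambda>z m. act M z m)"

definition runit :: "('k::field, 'h::{ring,monoid_mult}) qgroupoid
    \<Rightarrow> ('k, 'h, 'm::ab_group_add) hmod \<Rightarrow> ('m, 'h, 'k) tensor \<Rightarrow> 'm"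
  where "runit H M = lift_t H M (unit_obj H) (\<lambda>m z. act M (inv (antipode H) z) m)"

locale twisted_modules =
  fixes H :: "('k::field, 'h::{ring,monoid_mult}) qgroupoid"
    and F G :: "('h, 'h, 'k) tensor"
begin

definition tensor_obj :: "('k, 'h, 'm::ab_group_add) hmod \<Rightarrow> ('k, 'h, 'n::ab_group_add) hmod
    \<Rightarrow> ('k, 'h, ('m, 'n, 'k) tensor) hmod" (infixr "\<boxtimes>" 75)
  where "M \<boxtimes> N =
    \<lparr>carr = carr_t H M N, msc = tscale,
     act = (\<lambda>h. lift_t H M N (\<lambda>m n.
       sw H (\<lambda>a b. tens_t H M N (act M a m) (act N b n)) (G \<bullet>\<^bsub>H\<^esub> comult H h \<bullet>\<^bsub>H\<^esub> F)))\<rparr>"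

definition braid :: "('k, 'h, 'm::ab_group_add) hmod \<Rightarrow> ('k, 'h, 'n::ab_group_add) hmod
    \<Rightarrow> ('m, 'n, 'k) tensor \<Rightarrow> ('n, 'm, 'k) tensor"
  where "braid M N = lift_t H M N (\<lambda>m n.
     sw H (\<lambda>f f'. sw H (\<lambda>g g'. tens_t H N M (act N (g * f') n) (act M (g' * f) m)) G) F)"

definition assoc :: "('k, 'h, 'm::ab_group_add) hmod \<Rightarrow> ('k, 'h, 'n::ab_group_add) hmod
    \<Rightarrow> ('k, 'h, 'p::ab_group_add) hmod
    \<Rightarrow> (('m, 'n, 'k) tensor, 'p, 'k) tensor \<Rightarrow> ('m, ('n, 'p, 'k) tensor, 'k) tensor"
  where "assoc M N P = lift_t H (M \<boxtimes> N) P (\<lambda>u p.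
     lift_t H M N (\<lambda>m n. tens_t H M (N \<boxtimes> P) m (tens_t H N P n p)) u)"

definition assoc_inv :: "('k, 'h, 'm::ab_group_add) hmod \<Rightarrow> ('k, 'h, 'n::ab_group_add) hmod
    \<Rightarrow> ('k, 'h, 'p::ab_group_add) hmod
    \<Rightarrow> ('m, ('n, 'p, 'k) tensor, 'k) tensor \<Rightarrow> (('m, 'n, 'k) tensor, 'p, 'k) tensor"
  where "assoc_inv M N P = lift_t H M (N \<boxtimes> P) (\<lambda>m u.
     lift_t H N P (\<lambda>n p. tens_t H (M \<boxtimes> N) P (tens_t H M N m n) p) u)"

text \<open>\<open>id \<otimes> \<Phi> \<otimes> id\<close> on \<open>(A \<otimes> A) \<otimes> (A \<otimes> A)\<close>.\<close>

definition middle_braid :: "('k, 'h, 'm::ab_group_add) hmod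
    \<Rightarrow> (('m, 'm, 'k) tensor, ('m, 'm, 'k) tensor, 'k) tensor
    \<Rightarrow> (('m, 'm, 'k) tensor, ('m, 'm, 'k) tensor, 'k) tensor"
  where "middle_braid A =
    assoc_inv A A (A \<boxtimes> A) \<circ>
    map_t H A (A \<boxtimes> A \<boxtimes> A) A (A \<boxtimes> A \<boxtimes> A) id
      (assoc A A A \<circ> map_t H (A \<boxtimes> A) A (A \<boxtimes> A) A (braid A A) id \<circ> assoc_inv A A A) \<circ>
    assoc A A (A \<boxtimes> A)"

definition algebra_in where
  "algebra_in (A :: ('k, 'h, 'm::ab_group_add) hmod) \<mu> \<eta> \<longleftrightarrow>
    is_hmod H A \<and> is_hom (A \<boxtimes> A) A \<mu> \<and> is_hom (unit_obj H) A \<eta> \<and>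
    (\<forall>t\<in>carr ((A \<boxtimes> A) \<boxtimes> A).
       \<mu> (map_t H (A \<boxtimes> A) A A A \<mu> id t) = \<mu> (map_t H A (A \<boxtimes> A) A A id \<mu> (assoc A A A t))) \<and>
    (\<forall>t\<in>carr (unit_obj H \<boxtimes> A). \<mu> (map_t H (unit_obj H) A A A \<eta> id t) = lunit H A t) \<and>
    (\<forall>t\<in>carr (A \<boxtimes> unit_obj H). \<mu> (map_t H A (unit_obj H) A A id \<eta> t) = runit H A t)"

definition coalgebra_in where
  "coalgebra_in (A :: ('k, 'h, 'm::ab_group_add) hmod) \<delta> e \<longleftrightarrow>
    is_hmod H A \<and> is_hom A (A \<boxtimes> A) \<delta> \<and> is_hom A (unit_obj H) e \<and>
    (\<forall>a\<in>carr A.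
       assoc A A A (map_t H A A (A \<boxtimes> A) A \<delta> id (\<delta> a)) = map_t H A A A (A \<boxtimes> A) id \<delta> (\<delta> a)) \<and>
    (\<forall>a\<in>carr A. lunit H A (map_t H A A (unit_obj H) A e id (\<delta> a)) = a) \<and>
    (\<forall>a\<in>carr A. runit H A (map_t H A A A (unit_obj H) id e (\<delta> a)) = a)"

text \<open>\<open>I \<otimes> I\<close> is identified with the unit object \<open>I\<close> by the unit constraint.\<close>

definition bialgebra_in where
  "bialgebra_in (A :: ('k, 'h, 'm::ab_group_add) hmod) \<mu> \<eta> \<delta> e \<longleftrightarrow>
    algebra_in A \<mu> \<eta> \<and> coalgebra_in A \<delta> e \<and>
    (\<forall>t\<in>carr (A \<boxtimes> A).
       \<delta> (\<mu> t) = map_t H (A \<boxtimes> A) (A \<boxtimes> A) A A \<mu> \<mu>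
         (middle_braid A (map_t H A A (A \<boxtimes> A) (A \<boxtimes> A) \<delta> \<delta> t))) \<and>
    (\<forall>t\<in>carr (A \<boxtimes> A).
       e (\<mu> t) = lunit H (unit_obj H) (map_t H A A (unit_obj H) (unit_obj H) e e t)) \<and>
    (\<forall>t\<in>carr (unit_obj H \<boxtimes> unit_obj H).
       \<delta> (\<eta> (lunit H (unit_obj H) t)) = map_t H (unit_obj H) (unit_obj H) A A \<eta> \<eta> t)"

definition hopf_algebra_in where
  "hopf_algebra_in (A :: ('k, 'h, 'm::ab_group_add) hmod) \<mu> \<eta> \<delta> e s \<longleftrightarrow>
    bialgebra_in A \<mu> \<eta> \<delta> e \<and> is_hom A A s \<and>
    (\<forall>a\<in>carr A. \<mu> (map_t H A A A A s id (\<delta> a)) = \<eta> (e a)) \<and>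
    (\<forall>a\<in>carr A. \<mu> (map_t H A A A A id s (\<delta> a)) = \<eta> (e a))"

end


section \<open>The centraliser of \<open>H_s\<close>\<close>

definition C_obj :: "('k::field, 'h::{ring,monoid_mult}) qgroupoid \<Rightarrow> ('k, 'h, 'h) hmod"
  where "C_obj H = \<lparr>carr = C_H H, msc = smult H, act = Ad H\<rparr>"

definition prod_F :: "('k::field, 'h::{ring,monoid_mult}) qgroupoid \<Rightarrow> ('h, 'h, 'k) tensor \<Rightarrow> 'h \<Rightarrow> 'h \<Rightarrow> 'h"
  where "prod_F H F a b = sw H (\<lambda>f f'. Ad H f a * Ad H f' b) F"

definition mult_F :: "('k::field, 'h::{ring,monoid_mult}) qgroupoid \<Rightarrow> ('h, 'h, 'k) tensor
    \<Rightarrow> ('h, 'h, 'k) tensor \<Rightarrow> 'h"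
  where "mult_F H F = lift_t H (C_obj H) (C_obj H) (prod_F H F)"

definition comult_F :: "('k::field, 'h::{ring,monoid_mult}) qgroupoid \<Rightarrow> ('h, 'h, 'k) tensor
    \<Rightarrow> 'h \<Rightarrow> ('h, 'h, 'k) tensor"
  where "comult_F H G a =
    sw H (\<lambda>a\<^sub>1 a\<^sub>2. sw H (\<lambda>g g'. tens_t H (C_obj H) (C_obj H) (Ad H g a\<^sub>1) (Ad H g' a\<^sub>2)) G) (comult H a)"

end

theory Submission
  imports Defs
begin

text \<open>
  Cocommutativity forces \<open>H\<^sub>s = H\<^sub>t\<close>. This base \<open>B\<close> is a commutative subalgebra, fixed pointwise by
  \<open>S\<close>, with \<open>\<Delta>(1) \<in> B \<otimes> B\<close> as a separability idempotent; moreover \<open>S\<^sup>2 = id\<close>. Hence \<open>M \<otimes>\<^sub>t N\<close> is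
  \<open>M \<otimes>\<^sub>B N\<close>, and maps out of it are the bilinear maps balanced over \<open>B\<close>. The adjoint action
  takes values in the centraliser and is compatible there with product, coproduct, \<open>\<epsilon>\<^sub>t\<close> and \<open>S\<close>, so
  each axiom reduces to an identity between words in \<open>F\<close> and \<open>F\<^sup>-\<^sup>1\<close> in tensor powers of \<open>H\<close>:
  associativity is the cocycle identity, coassociativity its inverse, and the antipode axioms use only
  \<open>F F\<^sup>-\<^sup>1 = \<Delta>(1)\<close>. For the compatibility of product and coproduct, expand \<open>F\<close> over four legs: since the
  middle legs may be exchanged, the cocycle identity gives
  \<open>F\<^bsub>12,34\<^esub> F\<^sub>1\<^sub>2 F\<^sub>3\<^sub>4 = W F\<^sub>2\<^sub>3\<close> and \<open>F\<^bsub>13,24\<^esub> F\<^sub>1\<^sub>3 F\<^sub>2\<^sub>4 = W F\<^sub>3\<^sub>2\<close> with the same \<open>W\<close>, and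
  the quotient of the two is the braiding \<open>F\<^sup>-\<^sup>1 F\<^sub>2\<^sub>1\<close> of the middle legs.
\<close>

section \<open>Maps out of tensor products\<close>

text \<open>Sweedler notation \<open>sw\<close> is a choice over expansions and can be manipulated
  only when the integrand is bilinear, so nested expressions would carry side conditions at every
  level. They are replaced by the finite sums \<open>sumt\<close>, for which swapping and
  distributing are unconditional; bilinearity is checked only where a coproduct is reassociated,
  flipped or multiplied. The second obstacle is that \<Delta>(1) need not be 1 \<otimes> 1:
  \<open>F\<close> is invertible only relative to an idempotent, and every cancellation leaves a
  \<Delta>(1) that has to be absorbed elsewhere. This succeeds because \<Delta>(1) has its first leg
  in H_s and its second in H_t, and the flip puts each leg in both; hence there is a single base,
  whose elements \<open>F\<close> lets pass from leg to leg. Words in \<open>F\<close> are not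
  computed in tensor powers of H but as operators on multilinear maps, so that three or four factors
  need no further tensor spaces and permuting legs only renames operators.\<close>

abbreviation lin :: "('k::field \<Rightarrow> 'a::ab_group_add \<Rightarrow> 'a) \<Rightarrow> ('k \<Rightarrow> 'b::ab_group_add \<Rightarrow> 'b) \<Rightarrow> ('a \<Rightarrow> 'b) \<Rightarrow> bool"
  where "lin \<equiv> Vector_Spaces.linear"

lemma linD:
  assumes "lin sA sB f"
  shows "f (x + y) = f x + f y" "f (sA c x) = sB c (f x)" "vector_space sA" "vector_space sB"
  using assms by (auto simp: Vector_Spaces.linear_iff)

lemma lin_0: "lin sA sB f \<Longrightarrow> f 0 = 0"
  using linD(1)[of sA sB f 0 0] by simp

lemma lin_sum_apply: "lin sA sB f \<Longrightarrow> f (sum g I) = (\<Sum>i\<in>I. f (g i))"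
  by (induction I rule: infinite_finite_induct) (simp_all add: lin_0 linD(1))

lemma lin_id [simp]: "vector_space s \<Longrightarrow> lin s s (\<lambda>x. x)"
  by (simp add: Vector_Spaces.linear_iff)

lemma lin_scale: "vector_space s \<Longrightarrow> lin s s (\<lambda>x. s c x)"
proof -
  assume "vector_space s"
  then interpret vector_space s .
  show ?thesis by (simp add: Vector_Spaces.linear_iff vector_space_axioms scale_right_distrib mult.commute)
qed

lemma lin_compose: "lin sB sC g \<Longrightarrow> lin sA sB f \<Longrightarrow> lin sA sC (\<lambda>x. g (f x))"
  by (simp add: Vector_Spaces.linear_iff)

lemma lin_sum [simp]:
  assumes "vector_space sA" "vector_space sB" "\<And>i. lin sA sB (f i)"
  shows "lin sA sB (\<lambda>x. \<Sum>i\<in>I. f i x)"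
proof -
  interpret vector_space sB by fact
  show ?thesis
    using assms by (auto simp: Vector_Spaces.linear_iff sum.distrib scale_sum_right)
qed

text \<open>Bundles the hypotheses of \<open>lift_along_tens\<close>. Scalars are only moved between
  the two arguments, so the target needs no scalar multiplication.\<close>

definition balanced ::
  "('k::field \<Rightarrow> 'a::ab_group_add \<Rightarrow> 'a) \<Rightarrow> ('k \<Rightarrow> 'b::ab_group_add \<Rightarrow> 'b) \<Rightarrow> 'a set \<Rightarrow> 'b set
    \<Rightarrow> ('a \<Rightarrow> 'b \<Rightarrow> 'c::ab_group_add) \<Rightarrow> bool"
  where "balanced sA sB A B f \<longleftrightarrow>
    vector_space sA \<and> vector_space sB \<and> module.subspace sA A \<and> module.subspace sB B \<and>
    (\<forall>x\<in>A. \<forall>y\<in>A. \<forall>b\<in>B. f (x + y) b = f x b + f y b) \<and>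
    (\<forall>a\<in>A. \<forall>x\<in>B. \<forall>y\<in>B. f a (x + y) = f a x + f a y) \<and>
    (\<forall>c. \<forall>a\<in>A. \<forall>b\<in>B. f (sA c a) b = f a (sB c b))"

lemma lin_tens_left [simp]: "lin s sA f \<Longrightarrow> vector_space sB \<Longrightarrow> lin s tscale (\<lambda>x. tens sA sB (f x) b)"
proof -
  assume f: "lin s sA f" and "vector_space sB"
  have "lin sA tscale (\<lambda>x. tens sA sB x b)"
    unfolding Vector_Spaces.linear_iff
  proof (intro conjI allI)
    show "vector_space sA" by (rule linD(4)[OF f])
    show "vector_space tscale" by (rule tscale_vector_space)
    fix x y c
    show "tens sA sB (x + y) b = tens sA sB x b + tens sA sB y b"
      by transfer (auto simp: fun_eq_iff bilinear_form_def Vector_Spaces.linear_iff)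
    show "tens sA sB (sA c x) b = tscale c (tens sA sB x b)"
      by transfer (auto simp: fun_eq_iff bilinear_form_def Vector_Spaces.linear_iff)
  qed
  with f show ?thesis by (rule lin_compose[rotated])
qed

lemma lin_tens_right [simp]: "lin s sB f \<Longrightarrow> vector_space sA \<Longrightarrow> lin s tscale (\<lambda>x. tens sA sB a (f x))"
proof -
  assume f: "lin s sB f" and "vector_space sA"
  have "lin sB tscale (\<lambda>x. tens sA sB a x)"
    unfolding Vector_Spaces.linear_iff
  proof (intro conjI allI)
    show "vector_space sB" by (rule linD(4)[OF f])
    show "vector_space tscale" by (rule tscale_vector_space)
    fix x y c
    show "tens sA sB a (x + y) = tens sA sB a x + tens sA sB a y"
      by transfer (auto simp: fun_eq_iff bilinear_form_def Vector_Spaces.linear_iff)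
    show "tens sA sB a (sB c x) = tscale c (tens sA sB a x)"
      by transfer (auto simp: fun_eq_iff bilinear_form_def Vector_Spaces.linear_iff)
  qed
  with f show ?thesis by (rule lin_compose[rotated])
qed

lemma tensor_space_zero: "0 \<in> tensor_space sA sB A B"
  unfolding tensor_space_def by (rule module.span_zero) (simp add: tscale_vector_space module_iff_vector_space)

lemma tensor_space_subspace: "module.subspace tscale (tensor_space sA sB A B)"
  unfolding tensor_space_def by (rule module.subspace_span) (simp add: tscale_vector_space module_iff_vector_space)

lemma tens_in_tensor_space: "a \<in> A \<Longrightarrow> b \<in> B \<Longrightarrow> tens sA sB a b \<in> tensor_space sA sB A B"
  unfolding tensor_space_def by (rule module.span_base) (auto simp: tscale_vector_space module_iff_vector_space)

lemma tensor_space_add: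
  "s \<in> tensor_space sA sB A B \<Longrightarrow> t \<in> tensor_space sA sB A B \<Longrightarrow> s + t \<in> tensor_space sA sB A B"
  unfolding tensor_space_def by (rule module.span_add) (auto simp: tscale_vector_space module_iff_vector_space)

lemma tensor_space_scale:
  "t \<in> tensor_space sA sB A B \<Longrightarrow> tscale c t \<in> tensor_space sA sB A B"
  unfolding tensor_space_def by (rule module.span_scale) (auto simp: tscale_vector_space module_iff_vector_space)

lemma tensor_space_sum:
  "(\<And>i. i \<in> I \<Longrightarrow> t i \<in> tensor_space sA sB A B) \<Longrightarrow> sum t I \<in> tensor_space sA sB A B"
  by (induction I rule: infinite_finite_induct) (auto simp: tensor_space_add tensor_space_zero)

lemma sum_append:
  fixes f :: "nat \<Rightarrow> 'a::comm_monoid_add"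
  shows "(\<Sum>i<n + m. if i < n then f i else g (i - n)) = (\<Sum>i<n. f i) + (\<Sum>i<m. g i)"
proof -
  have "(\<Sum>i<n + m. if i < n then f i else g (i - n)) =
    (\<Sum>i<n. if i < n then f i else g (i - n)) + (\<Sum>i\<in>{n..<n+m}. if i < n then f i else g (i - n))"
    by (subst sum.union_disjoint[symmetric]) (auto intro: sum.cong)
  also have "(\<Sum>i\<in>{n..<n+m}. if i < n then f i else g (i - n)) = (\<Sum>i<m. g i)"
    by (rule sum.reindex_bij_witness[of _ "\<lambda>i. i + n" "\<lambda>i. i - n"]) auto
  finally show ?thesis by simp
qed

text \<open>Scalar coefficients are absorbed into the first factor, which turns a linear combination
  of pure tensors into the plain sum that \<open>lift_along\<close> reads.\<close>

lemma tensor_space_expand: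
  assumes vA: "vector_space sA" and vB: "vector_space sB" and A: "module.subspace sA A"
    and t: "t \<in> tensor_space sA sB A B"
  obtains n :: nat and a b where "\<forall>i<n. a i \<in> A \<and> b i \<in> B" "t = (\<Sum>i<n. tens sA sB (a i) (b i))"
proof -
  interpret A: vector_space sA by fact
  interpret T: vector_space "tscale :: _ \<Rightarrow> ('b, 'c, 'a) tensor \<Rightarrow> _" by (rule tscale_vector_space)
  have "\<exists>(n::nat) a b. (\<forall>i<n. a i \<in> A \<and> b i \<in> B) \<and> t = (\<Sum>i<n. tens sA sB (a i) (b i))"
    using t unfolding tensor_space_def
  proof (induction rule: T.span_induct_alt)
    case base
    show ?case by (rule exI[of _ 0]) simp
  next
    case (step c x y)
    then obtain a0 b0 n a b where x: "x = tens sA sB a0 b0" "a0 \<in> A" "b0 \<in> B"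
      and y: "\<forall>i<n. a i \<in> A \<and> b i \<in> B" "y = (\<Sum>i<n::nat. tens sA sB (a i) (b i))" by auto
    have "tscale c x = tens sA sB (sA c a0) b0"
      using linD(2)[OF lin_tens_left[OF lin_id[OF vA] vB]] x by metis
    then show ?case
      by (intro exI[of _ "Suc n"] exI[of _ "case_nat (sA c a0) a"] exI[of _ "case_nat b0 b"])
        (use x y A.subspace_scale[OF A] in \<open>auto simp: sum.lessThan_Suc_shift simp del: sum.lessThan_Suc split: nat.split\<close>)
  qed
  then show ?thesis using that by blast
qed

lemma tensor_space_induct [consumes 4, case_names tens zero add]:
  assumes "vector_space sA" "vector_space sB" "module.subspace sA A" "t \<in> tensor_space sA sB A B"
    and P: "\<And>a b. a \<in> A \<Longrightarrow> b \<in> B \<Longrightarrow> P (tens sA sB a b)" "P 0"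
    "\<And>s t. s \<in> tensor_space sA sB A B \<Longrightarrow> t \<in> tensor_space sA sB A B \<Longrightarrow> P s \<Longrightarrow> P t \<Longrightarrow> P (s + t)"
  shows "P t"
proof -
  obtain n :: nat and a b where ab: "\<forall>i<n. a i \<in> A \<and> b i \<in> B"
      and t: "t = (\<Sum>i<n. tens sA sB (a i) (b i))"
    using tensor_space_expand[OF assms(1-4)] by blast
  have "P (\<Sum>i<m. tens sA sB (a i) (b i))" if "m \<le> n" for m
    using that
    by (induction m) (auto intro!: P tensor_space_sum tens_in_tensor_space simp: ab)
  then show ?thesis using t by simp
qed

lemma lift_along_sum:
  fixes n :: nat
  assumes "balanced sA sB A B f" "\<And>i. i < n \<Longrightarrow> a i \<in> A \<and> b i \<in> B"
  shows "lift_along (tens sA sB) A B f (\<Sum>i<n. tens sA sB (a i) (b i)) = (\<Sum>i<n. f (a i) (b i))"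
  using assms by (intro lift_along_tens) (auto simp: balanced_def)

lemma lift_along_pure:
  assumes "balanced sA sB A B f" "a \<in> A" "b \<in> B"
  shows "lift_along (tens sA sB) A B f (tens sA sB a b) = f a b"
  using lift_along_sum[of sA sB A B f 1 "\<lambda>_. a" "\<lambda>_. b"] assms by simp

lemma lift_along_zero:
  assumes "balanced sA sB A B f"
  shows "lift_along (tens sA sB) A B f 0 = 0"
  using lift_along_sum[of sA sB A B f 0 "\<lambda>_. 0" "\<lambda>_. 0"] assms by simp

text \<open>The value does not depend on the expansion, so the sum may be expanded by concatenating
  expansions of the two summands.\<close>

lemma lift_along_add:
  assumes f: "balanced sA sB A B f"
    and s: "s \<in> tensor_space sA sB A B" and t: "t \<in> tensor_space sA sB A B"
  shows "lift_along (tens sA sB) A B f (s + t) = lift_along (tens sA sB) A B f s + lift_along (tens sA sB) A B f t"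
proof -
  have v: "vector_space sA" "vector_space sB" "module.subspace sA A" using f by (auto simp: balanced_def)
  obtain n :: nat and a b where n: "\<forall>i<n. a i \<in> A \<and> b i \<in> B" "s = (\<Sum>i<n. tens sA sB (a i) (b i))"
    using tensor_space_expand[OF v s] .
  obtain m :: nat and a' b' where m: "\<forall>i<m. a' i \<in> A \<and> b' i \<in> B" "t = (\<Sum>i<m. tens sA sB (a' i) (b' i))"
    using tensor_space_expand[OF v t] .
  define a'' where "a'' i = (if i < n then a i else a' (i - n))" for i
  define b'' where "b'' i = (if i < n then b i else b' (i - n))" for i
  have ab: "a'' i \<in> A \<and> b'' i \<in> B" if "i < n + m" for i
    using that n(1) m(1) by (auto simp: a''_def b''_def)
  have *: "(\<Sum>i<n+m. h (a'' i) (b'' i)) = (\<Sum>i<n. h (a i) (b i)) + (\<Sum>i<m. h (a' i) (b' i))"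
    for h :: "_ \<Rightarrow> _ \<Rightarrow> 'z::comm_monoid_add"
    by (subst sum_append[symmetric]) (auto simp: a''_def b''_def intro!: sum.cong)
  have "lift_along (tens sA sB) A B f (s + t) = lift_along (tens sA sB) A B f (\<Sum>i<n+m. tens sA sB (a'' i) (b'' i))"
    by (simp add: * n m)
  also have "\<dots> = (\<Sum>i<n+m. f (a'' i) (b'' i))"
    by (rule lift_along_sum[OF f ab])
  also have "\<dots> = lift_along (tens sA sB) A B f s + lift_along (tens sA sB) A B f t"
    using lift_along_sum[OF f, of n a b] lift_along_sum[OF f, of m a' b'] n m by (simp add: *)
  finally show ?thesis .
qed

lemma lift_along_cong:
  assumes "\<And>a b. a \<in> A \<Longrightarrow> b \<in> B \<Longrightarrow> f a b = g a b"
  shows "lift_along p A B f t = lift_along p A B g t"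
proof -
  have "(\<Sum>i<n. f (a i) (b i)) = (\<Sum>i<n. g (a i) (b i))" if "\<forall>i<n. a i \<in> A \<and> b i \<in> B" for n :: nat and a b
    using that assms by (auto intro!: sum.cong)
  then show ?thesis
    unfolding lift_along_def by (intro arg_cong[where f = Eps] ext ex_cong1 conj_cong refl) auto
qed

section \<open>Sweedler sums along a chosen expansion\<close>

definition legs :: "('k::field, 'h::ab_group_add) qgroupoid \<Rightarrow> ('h, 'h, 'k) tensor
    \<Rightarrow> nat \<times> (nat \<Rightarrow> 'h) \<times> (nat \<Rightarrow> 'h)"
  where "legs H t = (SOME (n, a, b). t = (\<Sum>i<n. a i \<otimes>\<^bsub>H\<^esub> b i))"

text \<open>
  \<open>sumt H t f\<close> evaluates \<open>f\<close> along one chosen expansion of \<open>t\<close>. In contrast to \<open>sw\<close> it is a finite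
  sum, so that nested Sweedler expressions can be rearranged without checking bilinearity.
\<close>

definition sumt :: "('k::field, 'h::ab_group_add) qgroupoid \<Rightarrow> ('h, 'h, 'k) tensor
    \<Rightarrow> ('h \<Rightarrow> 'h \<Rightarrow> 'c::comm_monoid_add) \<Rightarrow> 'c"
  where "sumt H t f = (case legs H t of (n, a, b) \<Rightarrow> \<Sum>i<n. f (a i) (b i))"

lemma sumt_add: "sumt H t (\<lambda>a b. f a b + g a b) = sumt H t f + sumt H t g"
  by (simp add: sumt_def split_beta sum.distrib)

lemma sumt_swap: "sumt H s (\<lambda>a b. sumt H t (f a b)) = sumt H t (\<lambda>c d. sumt H s (\<lambda>a b. f a b c d))"
  by (simp add: sumt_def split_beta, rule sum.swap)

lemma sumt_mult_left: "x * sumt H t f = sumt H t (\<lambda>a b. x * f a b)" for x :: "'x::ring"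
  by (simp add: sumt_def split_beta sum_distrib_left)

lemma sumt_mult_right: "sumt H t f * x = sumt H t (\<lambda>a b. f a b * x)" for x :: "'x::ring"
  by (simp add: sumt_def split_beta sum_distrib_right)

lemma sumt_lin: "lin sA sB g \<Longrightarrow> g (sumt H t f) = sumt H t (\<lambda>a b. g (f a b))"
  by (simp add: sumt_def split_beta lin_sum_apply)

text \<open>Maps built from \<open>lift_along\<close> or \<open>lift_t\<close> are defined by choice
  and are additive only on a subspace; hence the restriction to a set \<open>A\<close>.\<close>

lemma sumt_additive_on:
  assumes "\<And>x y. x \<in> A \<Longrightarrow> y \<in> A \<Longrightarrow> x + y \<in> A \<and> g (x + y) = g x + g y" "0 \<in> A" "\<And>a b. f a b \<in> A"
  shows "g (sumt H t f) = sumt H t (\<lambda>a b. (g (f a b) :: 'y::ab_group_add))"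
proof -
  have "g 0 = 0" using assms(1)[of 0 0] assms(2) by simp
  have "(\<Sum>i<n. f (a i) (b i)) \<in> A \<and> g (\<Sum>i<n. f (a i) (b i)) = (\<Sum>i<n. g (f (a i) (b i)))" for n :: nat and a b
    by (induction n) (auto simp: assms \<open>g 0 = 0\<close>)
  then show ?thesis by (simp add: sumt_def split_beta)
qed

lemma sumt_in_subspace:
  assumes "vector_space s" "module.subspace s A" "\<And>a b. f a b \<in> A"
  shows "sumt H t f \<in> A"
  unfolding sumt_def split_beta
  by (rule module.subspace_sum) (use assms in \<open>auto simp: module_iff_vector_space\<close>)

lemma lin_sumt [simp]:
  assumes "\<And>a b. lin sA sB (\<lambda>x. f x a b)"
  shows "lin sA sB (\<lambda>x. sumt H t (f x))"
  unfolding sumt_def split_beta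
  by (rule lin_sum) (use assms linD in blast)+

lemma sumt_in_tensor_space:
  assumes "\<And>a b. f a b \<in> tensor_space sA sB A B"
  shows "sumt H t f \<in> tensor_space sA sB A B"
  unfolding sumt_def split_beta by (rule tensor_space_sum) (use assms in auto)

section \<open>Multilinear calculus with the coproduct of a weak bialgebra\<close>

context weak_bialgebra
begin

abbreviation "sH \<equiv> smult H"

lemma vs_H [simp]: "vector_space sH"
  by (rule vector_space)

lemma vs_tscale [simp]: "vector_space tscale"
  by (rule tscale_vector_space)

lemma subspace_UNIV [simp]: "module.subspace sH UNIV"
  by (rule module.subspace_UNIV) (simp add: module_iff_vector_space)

lemma tens_HH [simp]: "a \<otimes> b \<in> HH H"
  unfolding tensH_def HH_def by (rule tens_in_tensor_space) auto

lemma legs_HH: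
  assumes "t \<in> HH H"
  shows "t = sumt H t (\<lambda>a b. a \<otimes> b)"
proof -
  obtain n :: nat and a b where "t = (\<Sum>i<n. a i \<otimes> b i)"
    by (rule tensor_space_expand[OF vs_H vs_H subspace_UNIV assms[unfolded HH_def]]) (simp add: tensH_def)
  then have "\<exists>p. case p of (n::nat, a, b) \<Rightarrow> t = (\<Sum>i<n. a i \<otimes> b i)"
    by (intro exI[of _ "(n, a, b)"]) simp
  from someI_ex[OF this] show ?thesis
    unfolding sumt_def legs_def[symmetric] by (simp add: split_beta)
qed

definition bil :: "('k \<Rightarrow> 'v \<Rightarrow> 'v) \<Rightarrow> ('h \<Rightarrow> 'h \<Rightarrow> 'v::ab_group_add) \<Rightarrow> bool" where
  bil_def [simp]: "bil s f \<longleftrightarrow> (\<forall>b. lin sH s (\<lambda>a. f a b)) \<and> (\<forall>a. lin sH s (\<lambda>b. f a b))"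

definition tri :: "('k \<Rightarrow> 'v \<Rightarrow> 'v) \<Rightarrow> ('h \<Rightarrow> 'h \<Rightarrow> 'h \<Rightarrow> 'v::ab_group_add) \<Rightarrow> bool" where
  tri_def [simp]: "tri s f \<longleftrightarrow> (\<forall>b c. lin sH s (\<lambda>a. f a b c)) \<and> (\<forall>a c. lin sH s (\<lambda>b. f a b c)) \<and>
    (\<forall>a b. lin sH s (\<lambda>c. f a b c))"

definition quad :: "('k \<Rightarrow> 'v \<Rightarrow> 'v) \<Rightarrow> ('h \<Rightarrow> 'h \<Rightarrow> 'h \<Rightarrow> 'h \<Rightarrow> 'v::ab_group_add) \<Rightarrow> bool" where
  quad_def [simp]: "quad s f \<longleftrightarrow> (\<forall>b c d. lin sH s (\<lambda>a. f a b c d)) \<and> (\<forall>a c d. lin sH s (\<lambda>b. f a b c d)) \<and>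
    (\<forall>a b d. lin sH s (\<lambda>c. f a b c d)) \<and> (\<forall>a b c. lin sH s (\<lambda>d. f a b c d))"

lemma bil_comp:
  assumes "bil s f"
  shows "lin sA sH g \<Longrightarrow> lin sA s (\<lambda>x. f (g x) b)" "lin sA sH g \<Longrightarrow> lin sA s (\<lambda>x. f a (g x))"
  using assms lin_compose[of sH s "\<lambda>a. f a b" sA g] lin_compose[of sH s "\<lambda>b. f a b" sA g] by auto

lemma tri_comp:
  assumes "tri s f"
  shows "lin sA sH g \<Longrightarrow> lin sA s (\<lambda>x. f (g x) b c)" "lin sA sH g \<Longrightarrow> lin sA s (\<lambda>x. f a (g x) c)"
    "lin sA sH g \<Longrightarrow> lin sA s (\<lambda>x. f a b (g x))"
  using assms lin_compose[of sH s "\<lambda>a. f a b c" sA g] lin_compose[of sH s "\<lambda>b. f a b c" sA g]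
    lin_compose[of sH s "\<lambda>c. f a b c" sA g] by auto

lemma quad_comp:
  assumes "quad s f"
  shows "lin sA sH g \<Longrightarrow> lin sA s (\<lambda>x. f (g x) b c d)" "lin sA sH g \<Longrightarrow> lin sA s (\<lambda>x. f a (g x) c d)"
    "lin sA sH g \<Longrightarrow> lin sA s (\<lambda>x. f a b (g x) d)" "lin sA sH g \<Longrightarrow> lin sA s (\<lambda>x. f a b c (g x))"
  using assms lin_compose[of sH s "\<lambda>a. f a b c d" sA g] lin_compose[of sH s "\<lambda>b. f a b c d" sA g]
    lin_compose[of sH s "\<lambda>c. f a b c d" sA g] lin_compose[of sH s "\<lambda>d. f a b c d" sA g] by auto

lemma bil_balanced: "bil s f \<Longrightarrow> balanced sH sH UNIV UNIV f"
  unfolding balanced_def by (simp add: Vector_Spaces.linear_iff)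

lemma HH_add: "s \<in> HH H \<Longrightarrow> t \<in> HH H \<Longrightarrow> s + t \<in> HH H"
  unfolding HH_def by (rule tensor_space_add)

lemma HH_0 [simp]: "0 \<in> HH H"
  unfolding HH_def by (rule tensor_space_zero)

lemma HH_sumt [simp]: "(\<And>a b. f a b \<in> HH H) \<Longrightarrow> sumt H t f \<in> HH H"
  unfolding HH_def by (rule sumt_in_tensor_space)

text \<open>For a bilinear integrand \<open>sw\<close> is independent of the expansion, so the one
  chosen by \<open>legs\<close> may be used. Through this rule definitions in terms of
  \<open>sw\<close> become finite sums.\<close>

lemma sw_sumt:
  assumes "t \<in> HH H" "bil s f"
  shows "sw H f t = sumt H t f"
proof -
  have "sw H f t = sw H f (sumt H t (\<lambda>a b. a \<otimes> b))"
    using legs_HH[OF assms(1)] by simp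
  also have "\<dots> = sumt H t f"
    unfolding sumt_def split_beta sw_def tensH_def
    by (rule lift_along_sum[OF bil_balanced[OF assms(2)]]) auto
  finally show ?thesis .
qed

lemma sumt_pure:
  assumes "bil s f"
  shows "sumt H (a \<otimes> b) f = f a b"
  using lift_along_pure[OF bil_balanced[OF assms], of a b] sw_sumt[OF tens_HH assms, of a b]
  by (simp add: sw_def tensH_def[abs_def])

lemma sumt_add_tensor:
  assumes "bil s f" "t \<in> HH H" "u \<in> HH H"
  shows "sumt H (t + u) f = sumt H t f + sumt H u f"
  using lift_along_add[OF bil_balanced[OF assms(1)], of t u] sw_sumt[OF _ assms(1), symmetric]
    assms HH_add[OF assms(2,3)]
  by (simp add: sw_def tensH_def[abs_def] HH_def)

lemma sumt_sumt:
  assumes "bil s f" "\<And>a b. g a b \<in> HH H"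
  shows "sumt H (sumt H t g) f = sumt H t (\<lambda>a b. sumt H (g a b) f)"
  by (rule sumt_additive_on[where A = "HH H"]) (use assms HH_add sumt_add_tensor[OF assms(1)] in auto)

lemma sumt_scale_tensor:
  assumes f: "bil s f" and t: "t \<in> HH H"
  shows "sumt H (tscale c t) f = s c (sumt H t f)"
proof -
  have e: "tscale c t = sumt H t (\<lambda>a b. sH c a \<otimes> b)"
    by (subst legs_HH[OF t], subst sumt_lin[OF lin_scale[OF vs_tscale]])
      (simp add: tensH_def[abs_def] linD(2)[OF lin_tens_left[OF lin_id[OF vs_H] vs_H], symmetric])
  have "s c (sumt H t f) = sumt H t (\<lambda>a b. s c (f a b))"
    by (rule sumt_lin, rule lin_scale) (use f linD(4)[of sH s] in auto)
  also have "\<dots> = sumt H t (\<lambda>a b. f (sH c a) b)"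
    using f by (simp add: Vector_Spaces.linear_iff)
  finally show ?thesis
    unfolding e by (simp add: sumt_sumt[OF f] sumt_pure[OF f] del: bil_def)
qed

lemma lin_sumt_tensor:
  assumes "lin sA tscale T" "\<And>x. T x \<in> HH H" "bil s f"
  shows "lin sA s (\<lambda>x. sumt H (T x) f)"
  using assms(1,3) sumt_add_tensor[OF assms(3) assms(2,2)] sumt_scale_tensor[OF assms(3,2)]
  by (auto simp: Vector_Spaces.linear_iff)

abbreviation "D h \<equiv> sumt H (comult H h)"
abbreviation "\<epsilon> \<equiv> counit H"
abbreviation "et \<equiv> eps_t H"
abbreviation "es \<equiv> eps_s H"

lemma lin_mult_left [simp]: "lin s sH f \<Longrightarrow> lin s sH (\<lambda>x. c * f x)"
  by (simp add: Vector_Spaces.linear_iff distrib_left smult_mult_right)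

lemma lin_mult_right [simp]: "lin s sH f \<Longrightarrow> lin s sH (\<lambda>x. f x * c)"
  by (simp add: Vector_Spaces.linear_iff distrib_right smult_mult_left)

lemma lin_field_mult [simp]:
  "lin s ((*) :: 'k \<Rightarrow> 'k \<Rightarrow> 'k) f \<Longrightarrow> lin s ((*) :: 'k \<Rightarrow> 'k \<Rightarrow> 'k) (\<lambda>x. f x * c)"
  "lin s ((*) :: 'k \<Rightarrow> 'k \<Rightarrow> 'k) f \<Longrightarrow> lin s ((*) :: 'k \<Rightarrow> 'k \<Rightarrow> 'k) (\<lambda>x. c * f x)"
  by (simp_all add: Vector_Spaces.linear_iff algebra_simps)

lemma lin_smult_left:
  assumes "lin sA ((*) :: 'k \<Rightarrow> 'k \<Rightarrow> 'k) f" "vector_space s"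
  shows "lin sA s (\<lambda>x. s (f x) c)"
proof -
  interpret vector_space s by fact
  show ?thesis using assms by (simp add: Vector_Spaces.linear_iff scale_left_distrib)
qed

lemma lin_smult_right: "lin sA s f \<Longrightarrow> lin sA s (\<lambda>x. s c (f x))"
  by (rule lin_compose[OF lin_scale]) (auto dest: linD)

lemmas lin_smult [simp] =
  lin_smult_left[of _ _ sH, OF _ vs_H] lin_smult_right[of _ sH]
  lin_smult_left[of _ _ tscale, OF _ vs_tscale] lin_smult_right[of _ tscale]

lemma lin_counit [simp]: "lin s sH f \<Longrightarrow> lin s (*) (\<lambda>x. \<epsilon> (f x))"
  by (rule lin_compose[OF counit_linear])

lemma lin_comult [simp]: "lin s sH f \<Longrightarrow> lin s tscale (\<lambda>x. comult H (f x))"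
  by (rule lin_compose[OF comult_linear])

lemma lin_tensH [simp]: "lin s sH f \<Longrightarrow> lin s tscale (\<lambda>x. f x \<otimes> b)" "lin s sH f \<Longrightarrow> lin s tscale (\<lambda>x. b \<otimes> f x)"
  unfolding tensH_def by simp_all

lemma lin_tensHHH [simp]: "lin s sH f \<Longrightarrow> lin s tscale (\<lambda>x. tensHHH H (f x) u)"
  "lin s tscale g \<Longrightarrow> lin s tscale (\<lambda>x. tensHHH H a (g x))"
  unfolding tensHHH_def by simp_all

lemma comult_HH [simp]: "comult H h \<in> HH H"
  by (rule comult_in)

lemma lin_D [simp]: "lin sA sH g \<Longrightarrow> bil s f \<Longrightarrow> lin sA s (\<lambda>x. D (g x) f)"
  by (rule lin_sumt_tensor) auto

lemmas sw_simps [simp] = sw_sumt[where s = sH] sw_sumt[where s = tscale] sw_sumt[where s = "(*)"]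

text \<open>The universal bilinear map \<open>a \<otimes> b\<close> is itself among the tests and
  recovers each tensor from its expansion. Identities in H \<otimes> H can thus be checked by the
  same bilinear calculus as everything else.\<close>

lemma HH_eqI:
  assumes "s \<in> HH H" "t \<in> HH H"
    and "\<And>f. bil tscale (f :: 'h \<Rightarrow> 'h \<Rightarrow> ('h,'h,'k) tensor) \<Longrightarrow> sumt H s f = sumt H t f"
  shows "s = t"
  using assms(3)[of "\<lambda>a b. a \<otimes> b"] legs_HH[OF assms(1)] legs_HH[OF assms(2)] by simp

subsection \<open>The algebra \<open>H \<otimes> H\<close>\<close>

lemma mult2_sumt:
  "s \<in> HH H \<Longrightarrow> t \<in> HH H \<Longrightarrow> s \<bullet> t = sumt H s (\<lambda>a b. sumt H t (\<lambda>c d. (a * c) \<otimes> (b * d)))"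
  unfolding mult2_def by simp

lemma mult2_HH [simp]: "s \<in> HH H \<Longrightarrow> t \<in> HH H \<Longrightarrow> s \<bullet> t \<in> HH H"
  by (simp add: mult2_sumt)

lemma sumt_mult2:
  assumes "s \<in> HH H" "t \<in> HH H" "bil v f"
  shows "sumt H (s \<bullet> t) f = sumt H s (\<lambda>a b. sumt H t (\<lambda>c d. f (a * c) (b * d)))"
  by (simp add: mult2_sumt assms sumt_sumt[OF assms(3)] sumt_pure[OF assms(3)] del: bil_def)

lemma mult2_assoc:
  assumes "s \<in> HH H" "t \<in> HH H" "u \<in> HH H"
  shows "s \<bullet> t \<bullet> u = s \<bullet> (t \<bullet> u)"
  using assms
  by (simp add: mult2_sumt[of "s \<bullet> t"] mult2_sumt[of s "t \<bullet> u"] sumt_mult2[where v = tscale] mult.assoc)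

lemma D_mult:
  assumes "bil s f"
  shows "D (h * l) f = D h (\<lambda>a b. D l (\<lambda>c d. f (a * c) (b * d)))"
  by (simp only: comult_mult sumt_mult2[OF comult_HH comult_HH assms])

lemma mult2_add_right: "u \<in> HH H \<Longrightarrow> x \<in> HH H \<Longrightarrow> y \<in> HH H \<Longrightarrow> u \<bullet> (x + y) = u \<bullet> x + u \<bullet> y"
  by (simp add: mult2_sumt HH_add sumt_add_tensor[where s = tscale] sumt_add)

lemma mult2_add_left: "u \<in> HH H \<Longrightarrow> x \<in> HH H \<Longrightarrow> y \<in> HH H \<Longrightarrow> (x + y) \<bullet> u = x \<bullet> u + y \<bullet> u"
  by (simp add: mult2_sumt HH_add sumt_add_tensor[where s = tscale])

lemma mult2_scale_left: "u \<in> HH H \<Longrightarrow> x \<in> HH H \<Longrightarrow> tscale c x \<bullet> u = tscale c (x \<bullet> u)"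
  using sumt_scale_tensor[of tscale "\<lambda>a b. sumt H u (\<lambda>c d. a * c \<otimes> (b * d))" x c] tensor_space_scale[of x sH sH UNIV UNIV c]
  by (simp add: mult2_sumt HH_def)

lemma mult2_scale_right: "u \<in> HH H \<Longrightarrow> x \<in> HH H \<Longrightarrow> u \<bullet> tscale c x = tscale c (u \<bullet> x)"
  using tensor_space_scale[of x sH sH UNIV UNIV c]
  by (simp add: mult2_sumt HH_def sumt_scale_tensor[of tscale, unfolded HH_def] sumt_lin[OF lin_scale[OF vs_tscale]])

subsection \<open>Trilinear maps on \<open>H \<otimes> H \<otimes> H\<close>\<close>

definition HHH where "HHH = tensor_space sH tscale UNIV (HH H)"

lemma HHH_sumt [simp]: "(\<And>a b. f a b \<in> HHH) \<Longrightarrow> sumt H t f \<in> HHH"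
  unfolding HHH_def by (rule sumt_in_tensor_space)

lemma HHH_tens [simp]: "u \<in> HH H \<Longrightarrow> tensHHH H a u \<in> HHH"
  unfolding HHH_def tensHHH_def by (rule tens_in_tensor_space) auto

definition bal3 where "bal3 f \<longleftrightarrow> balanced sH tscale UNIV (HH H) f"

text \<open>With its trilinear version \<open>ev3\<close> below, this is the device that turns
  equations between threefold tensors, such as coassociativity and the cocycle axiom, into Sweedler
  identities.\<close>

definition ev :: "('h \<Rightarrow> ('h, 'h, 'k) tensor \<Rightarrow> 'v::ab_group_add) \<Rightarrow> ('h, ('h, 'h, 'k) tensor, 'k) tensor \<Rightarrow> 'v"
  where "ev f = lift_along (tensHHH H) UNIV (HH H) f"

lemma ev_tens: "bal3 f \<Longrightarrow> u \<in> HH H \<Longrightarrow> ev f (tensHHH H a u) = f a u"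
  unfolding ev_def tensHHH_def bal3_def tensHHH_def[abs_def] by (rule lift_along_pure) auto

lemma ev_add: "bal3 f \<Longrightarrow> s \<in> HHH \<Longrightarrow> t \<in> HHH \<Longrightarrow> ev f (s + t) = ev f s + ev f t"
  unfolding ev_def HHH_def bal3_def tensHHH_def[abs_def] by (rule lift_along_add)

lemma HHH_add: "s \<in> HHH \<Longrightarrow> t \<in> HHH \<Longrightarrow> s + t \<in> HHH"
  unfolding HHH_def by (rule tensor_space_add)

lemma HHH_0: "0 \<in> HHH"
  unfolding HHH_def by (rule tensor_space_zero)

lemma ev_sumt:
  assumes "bal3 f" "\<And>a b. g a b \<in> HHH"
  shows "ev f (sumt H t g) = sumt H t (\<lambda>a b. ev f (g a b))"
  by (rule sumt_additive_on[where A = HHH]) (use assms HHH_add HHH_0 ev_add in auto)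

lemma bal3_lin:
  assumes "\<And>u. u \<in> HH H \<Longrightarrow> lin sH s (\<lambda>a. f a u)"
    "\<And>a x y. x \<in> HH H \<Longrightarrow> y \<in> HH H \<Longrightarrow> f a (x + y) = f a x + f a y"
    "\<And>a c x. x \<in> HH H \<Longrightarrow> f a (tscale c x) = s c (f a x)"
  shows "bal3 f"
  using assms unfolding bal3_def balanced_def
  by (auto simp: Vector_Spaces.linear_iff HH_def tensor_space_subspace)

lemma bal3_tri:
  assumes "tri s f"
  shows "bal3 (\<lambda>a u. sumt H u (f a))"
proof (rule bal3_lin)
  have b: "bil s (f a)" for a using assms by simp
  show "lin sH s (\<lambda>a. sumt H u (f a))" for u
    using assms by simp
  show "sumt H (x + y) (f a) = sumt H x (f a) + sumt H y (f a)" if "x \<in> HH H" "y \<in> HH H" for a x y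
    using b that by (rule sumt_add_tensor)
  show "sumt H (tscale c x) (f a) = s c (sumt H x (f a))" if "x \<in> HH H" for a c x
    using b that by (rule sumt_scale_tensor)
qed

abbreviation "ev3 f \<equiv> ev (\<lambda>a u. sumt H u (f a))"

lemma ev3_tens: "tri s f \<Longrightarrow> u \<in> HH H \<Longrightarrow> ev3 f (tensHHH H a u) = sumt H u (f a)"
  using ev_tens[OF bal3_tri] .

lemma ev3_sumt: "tri s f \<Longrightarrow> (\<And>a b. g a b \<in> HHH) \<Longrightarrow> ev3 f (sumt H t g) = sumt H t (\<lambda>a b. ev3 f (g a b))"
  using ev_sumt[OF bal3_tri] .

lemma ev3_pure: "tri s f \<Longrightarrow> ev3 f (tensHHH H a (b \<otimes> c)) = f a b c"
  by (subst ev3_tens, assumption, simp, rule sumt_pure[where s = s]) auto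

lemma ev3_comult_id:
  assumes "t \<in> HH H" "tri s f"
  shows "ev3 f (comult_id H t) = sumt H t (\<lambda>a b. D a (\<lambda>a1 a2. f a1 a2 b))"
  unfolding comult_id_def using assms(1)
  by (simp add: ev3_sumt[OF assms(2)] ev3_pure[OF assms(2)] del: tri_def)

lemma ev3_id_comult:
  assumes "t \<in> HH H" "tri s f"
  shows "ev3 f (id_comult H t) = sumt H t (\<lambda>a b. D b (\<lambda>b1 b2. f a b1 b2))"
  unfolding id_comult_def using assms(1)
  by (simp add: ev3_sumt[OF assms(2)] ev3_tens[OF assms(2)] del: tri_def)

lemma D_coassoc:
  "tri s f \<Longrightarrow> D h (\<lambda>a b. D a (\<lambda>a1 a2. f a1 a2 b)) = D h (\<lambda>a b. D b (\<lambda>b1 b2. f a b1 b2))"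
  using ev3_comult_id[of "comult H h" s f] ev3_id_comult[of "comult H h" s f] coassoc[of h]
  by (simp del: tri_def)

lemma D_one_left: "tri s f \<Longrightarrow> D 1 (\<lambda>a b. D b (\<lambda>b1 b2. f a b1 b2)) = D 1 (\<lambda>a b. D 1 (\<lambda>c d. f a (b * c) d))"
  using ev3_id_comult[of "comult H 1" s f] arg_cong[OF comult_one_left, of "ev3 f"]
  by (simp add: ev3_sumt ev3_pure del: tri_def)

lemma D_one_right: "tri s f \<Longrightarrow> D 1 (\<lambda>a b. D b (\<lambda>b1 b2. f a b1 b2)) = D 1 (\<lambda>a b. D 1 (\<lambda>c d. f a (c * b) d))"
  using ev3_id_comult[of "comult H 1" s f] arg_cong[OF comult_one_right, of "ev3 f"]
  by (simp add: ev3_sumt ev3_pure del: tri_def)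

lemma D_counit_left:
  assumes "lin sH s f"
  shows "D h (\<lambda>a b. f (sH (\<epsilon> a) b)) = f h"
  using counit_left[of h] sumt_lin[OF assms, of H "comult H h" "\<lambda>a b. sH (\<epsilon> a) b"] by simp

lemma D_counit_right:
  assumes "lin sH s f"
  shows "D h (\<lambda>a b. f (sH (\<epsilon> b) a)) = f h"
  using counit_right[of h] sumt_lin[OF assms, of H "comult H h" "\<lambda>a b. sH (\<epsilon> b) a"] by simp

section \<open>Counital maps and the legs of \<Delta>(1)\<close>

lemma et_eq: "et h = D 1 (\<lambda>a b. sH (\<epsilon> (a * h)) b)"
  unfolding eps_t_def by simp

lemma es_eq: "es h = D 1 (\<lambda>a b. sH (\<epsilon> (h * b)) a)"
  unfolding eps_s_def by simp

lemma lin_et [simp]: "lin s sH f \<Longrightarrow> lin s sH (\<lambda>x. et (f x))"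
  unfolding et_eq by simp

lemma lin_es [simp]: "lin s sH f \<Longrightarrow> lin s sH (\<lambda>x. es (f x))"
  unfolding es_eq by simp

lemma counit_mult_D_right: "\<epsilon> (h * g * l) = D g (\<lambda>a b. \<epsilon> (h * b) * \<epsilon> (a * l))"
  using counit_mult_right[of h g l] by simp

lemma tensHHH_add: "tensHHH H a (u + v) = tensHHH H a u + tensHHH H a v"
  using linD(1)[OF lin_tensHHH(2)[OF lin_id[OF vs_tscale]]] .

lemma tensHHH_scale: "tensHHH H a (tscale c u) = tscale c (tensHHH H a u)"
  using linD(2)[OF lin_tensHHH(2)[OF lin_id[OF vs_tscale]]] .

lemma tscale_sumt: "tscale c (sumt H t g) = sumt H t (\<lambda>a b. tscale c (g a b))"
  by (rule sumt_lin[OF lin_scale[OF vs_tscale]])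

text \<open>\<open>mult3\<close> is a lift nested in a lift. When the right factor is an explicit
  Sweedler sum, the inner lift can be computed for all arguments from \<open>HH H\<close>, and a
  single evaluation of the left factor remains.\<close>

lemma mult3_sumt:
  assumes q: "\<And>x y. q x y \<in> HH H"
  shows "mult3 H s (sumt H T (\<lambda>x y. tensHHH H (p x y) (q x y))) =
    ev (\<lambda>a u. sumt H T (\<lambda>x y. tensHHH H (a * p x y) (u \<bullet> q x y))) s"
    "bal3 (\<lambda>a u. sumt H T (\<lambda>x y. tensHHH H (a * p x y) (u \<bullet> q x y)))"
proof -
  have 1: "bal3 (\<lambda>c v. tensHHH H (a * c) (u \<bullet> v))" if "u \<in> HH H" for a u
    using that by (intro bal3_lin[where s = tscale]) (simp_all add: mult2_add_right mult2_scale_right tensHHH_add tensHHH_scale)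
  show "bal3 (\<lambda>a u. sumt H T (\<lambda>x y. tensHHH H (a * p x y) (u \<bullet> q x y)))"
    using q by (intro bal3_lin[where s = tscale])
      (simp_all add: mult2_add_left mult2_scale_left tensHHH_add tensHHH_scale sumt_add tscale_sumt)
  have 2: "ev (\<lambda>c v. tensHHH H (a * c) (u \<bullet> v)) (sumt H T (\<lambda>x y. tensHHH H (p x y) (q x y))) =
     sumt H T (\<lambda>x y. tensHHH H (a * p x y) (u \<bullet> q x y))" if "u \<in> HH H" for a u
    using q by (simp add: ev_sumt[OF 1[OF that]] ev_tens[OF 1[OF that]])
  show "mult3 H s (sumt H T (\<lambda>x y. tensHHH H (p x y) (q x y))) =
    ev (\<lambda>a u. sumt H T (\<lambda>x y. tensHHH H (a * p x y) (u \<bullet> q x y))) s"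
    unfolding mult3_def ev_def[symmetric]
    unfolding ev_def by (rule lift_along_cong) (use 2 in \<open>simp add: ev_def\<close>)
qed

lemma sumt_bil:
  assumes "bil s f"
  shows "f (sumt H t g) b = sumt H t (\<lambda>p q. f (g p q) b)" "f a (sumt H t g) = sumt H t (\<lambda>p q. f a (g p q))"
  using assms sumt_lin[of sH s "\<lambda>a. f a b" H t g] sumt_lin[of sH s "\<lambda>b. f a b" H t g] by auto

lemma sumt_push:
  "\<epsilon> (sumt H t g) = sumt H t (\<lambda>a b. \<epsilon> (g a b))"
  "sH c (sumt H t g) = sumt H t (\<lambda>a b. sH c (g a b))"
  "et (sumt H t g) = sumt H t (\<lambda>a b. et (g a b))"
  "es (sumt H t g) = sumt H t (\<lambda>a b. es (g a b))"
  by (rule sumt_lin[where sA = sH and sB = "(*)"] sumt_lin[where sA = sH and sB = sH], simp)+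

lemma D_sumt: "bil s f \<Longrightarrow> D (sumt H t g) f = sumt H t (\<lambda>a b. D (g a b) f)"
  by (rule sumt_lin[where sA = sH and sB = s]) simp

lemma bil_scale:
  assumes "bil s f"
  shows "f (sH c a) b = f a (sH c b)"
  using assms by (simp add: Vector_Spaces.linear_iff)

lemma D_scale: "bil s f \<Longrightarrow> D (sH c h) f = D h (\<lambda>a b. f (sH c a) b)"
proof -
  assume f: "bil s f"
  have "D (sH c h) f = s c (D h f)"
    using f by (intro linD(2)[of sH s]) simp
  also have "\<dots> = D h (\<lambda>a b. s c (f a b))"
    by (rule sumt_lin, rule lin_scale) (use f linD(4)[of sH s] in auto)
  also have "\<dots> = D h (\<lambda>a b. f (sH c a) b)"
    using f by (simp add: Vector_Spaces.linear_iff)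
  finally show ?thesis .
qed

text \<open>The flipped counit axiom with 1 in the middle: both sides are \<epsilon>(g 1_2)
  \<epsilon>(1_1 h).\<close>

lemma counit_et: "\<epsilon> (g * et h) = \<epsilon> (g * h)"
proof -
  have "\<epsilon> (g * et h) = D 1 (\<lambda>a b. \<epsilon> (a * h) * \<epsilon> (g * b))"
    by (simp add: et_eq sumt_mult_left sumt_push smult_mult_right[symmetric] linD(2)[OF counit_linear])
  also have "\<dots> = \<epsilon> (g * h)"
    using counit_mult_D_right[of g 1 h] by (simp add: mult.commute)
  finally show ?thesis .
qed

lemma counit_es: "\<epsilon> (es g * h) = \<epsilon> (g * h)"
proof -
  have "\<epsilon> (es g * h) = D 1 (\<lambda>a b. \<epsilon> (g * b) * \<epsilon> (a * h))"
    by (simp add: es_eq sumt_mult_right sumt_push smult_mult_left[symmetric] linD(2)[OF counit_linear])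
  also have "\<dots> = \<epsilon> (g * h)"
    using counit_mult_D_right[of g 1 h] by simp
  finally show ?thesis .
qed

lemma et_mult_et: "et (g * et h) = et (g * h)"
  by (simp add: et_eq[of "g * _"] mult.assoc[symmetric] counit_et)

lemma es_mult_es: "es (es g * h) = es (g * h)"
  by (simp add: es_eq[of "_ * h"] mult.assoc counit_es)

text \<open>This places the second leg of \<Delta>(1) in H_t. Inserting the formula for
  \<open>et\<close> produces two copies of \<Delta>(1), weak comultiplicativity of the unit merges
  them into 1_1 \<otimes> \<Delta>(1_2), and the counit removes the additional leg.\<close>

lemma D_one_et:
  assumes f: "bil s f"
  shows "D 1 (\<lambda>a b. f a (et b)) = D 1 f"
proof -
  have "D 1 (\<lambda>a b. f a (et b)) = D 1 (\<lambda>a b. D 1 (\<lambda>c d. f a (sH (\<epsilon> (c * b)) d)))"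
    by (simp add: et_eq sumt_bil[OF f] del: bil_def)
  also have "\<dots> = D 1 (\<lambda>a b. D b (\<lambda>c d. f a (sH (\<epsilon> c) d)))"
    by (rule D_one_right[symmetric, where s = s]) (use f in \<open>simp add: bil_comp[OF f]\<close>)
  also have "\<dots> = D 1 (\<lambda>a b. f a b)"
    using f D_counit_left[of s "f _"] by simp
  finally show ?thesis .
qed

text \<open>Likewise the first leg lies in H_s; the two copies of \<Delta>(1) exchange their
  roles.\<close>

lemma D_one_es:
  assumes f: "bil s f"
  shows "D 1 (\<lambda>a b. f (es a) b) = D 1 f"
proof -
  have "D 1 (\<lambda>c d. f (es c) d) = D 1 (\<lambda>c d. D 1 (\<lambda>a b. f (sH (\<epsilon> (c * b)) a) d))"
    by (simp add: es_eq sumt_bil[OF f] del: bil_def)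
  also have "\<dots> = D 1 (\<lambda>a b. D 1 (\<lambda>c d. f (sH (\<epsilon> (c * b)) a) d))"
    by (rule sumt_swap)
  also have "\<dots> = D 1 (\<lambda>a b. D b (\<lambda>c d. f (sH (\<epsilon> c) a) d))"
    by (rule D_one_right[symmetric, where s = s]) (use f in \<open>simp add: bil_comp[OF f]\<close>)
  also have "\<dots> = D 1 (\<lambda>a b. D b (\<lambda>c d. f a (sH (\<epsilon> c) d)))"
    by (simp only: bil_scale[OF f])
  also have "\<dots> = D 1 (\<lambda>a b. f a b)"
    using f D_counit_left[of s "f _"] by simp
  finally show ?thesis .
qed

end

section \<open>The common base of a cocommutative quantum groupoid\<close>

locale cocommutative_quantum_groupoid = quantum_groupoid +
  assumes cocomm: "cocommutative H"
begin

abbreviation "S \<equiv> antipode H"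
abbreviation "B \<equiv> H_t H"

lemma lin_S [simp]: "lin s sH f \<Longrightarrow> lin s sH (\<lambda>x. S (f x))"
  by (rule lin_compose[OF antipode_linear])

lemma S_sumt: "S (sumt H t g) = sumt H t (\<lambda>a b. S (g a b))"
  by (rule sumt_lin[where sA = sH and sB = sH]) simp

lemma D_comm:
  assumes "bil s f"
  shows "D h f = D h (\<lambda>a b. f b a)"
proof -
  have "comult H h = sumt H (comult H h) (\<lambda>a b. b \<otimes> a)"
    using fun_cong[OF cocomm[unfolded cocommutative_def], of h] by (simp add: comult_cop_def)
  then have "D h f = sumt H (sumt H (comult H h) (\<lambda>a b. b \<otimes> a)) f"
    by (rule arg_cong)
  then show ?thesis
    by (simp add: sumt_sumt[OF assms] sumt_pure[OF assms] del: bil_def)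
qed

lemma D_one_et':
  assumes f: "bil s f"
  shows "D 1 (\<lambda>a b. f (et a) b) = D 1 f"
proof -
  have "D 1 (\<lambda>a b. f (et a) b) = D 1 (\<lambda>a b. f (et b) a)"
    by (rule D_comm[where s = s]) (use f in \<open>simp add: bil_comp[OF f]\<close>)
  also have "\<dots> = D 1 (\<lambda>a b. f b a)"
    by (rule D_one_et[where s = s]) (use f in simp)
  also have "\<dots> = D 1 f"
    by (rule D_comm[symmetric, OF f])
  finally show ?thesis .
qed

text \<open>The element \<open>es h\<close> is a combination of first legs of \<Delta>(1).
  Cocommutativity makes these second legs, which \<open>et\<close> fixes.\<close>

lemma et_es: "et (es h) = es h"
proof -
  have "et (es h) = D 1 (\<lambda>a b. sH (\<epsilon> (h * b)) (et a))"
    by (simp add: es_eq[of h] sumt_push linD(2)[OF lin_et[OF lin_id[OF vs_H]]])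
  also have "\<dots> = es h"
    unfolding es_eq by (rule D_one_et'[where s = sH]) simp
  finally show ?thesis .
qed

lemma et_eq': "et h = D 1 (\<lambda>a b. sH (\<epsilon> (b * h)) a)"
  unfolding et_eq by (rule D_comm[where s = sH]) simp

lemma es_et: "es (et h) = et h"
proof -
  have "es (et h) = D 1 (\<lambda>a b. sH (\<epsilon> (b * h)) (es a))"
    by (simp add: et_eq'[of h] sumt_push linD(2)[OF lin_es[OF lin_id[OF vs_H]]])
  also have "\<dots> = et h"
    unfolding et_eq' by (rule D_one_es[where s = sH]) simp
  finally show ?thesis .
qed

lemma H_s_eq: "H_s H = B"
proof (intro set_eqI iffI)
  fix x
  show "x \<in> B" if "x \<in> H_s H" using that et_es unfolding H_s_def H_t_def by (metis rangeE rangeI)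
  show "x \<in> H_s H" if "x \<in> B" using that es_et unfolding H_s_def H_t_def by (metis rangeE rangeI)
qed

lemma et_in [simp]: "et h \<in> B" by (simp add: H_t_def)
lemma es_in [simp]: "es h \<in> B" unfolding H_s_eq[symmetric] by (simp add: H_s_def)

lemma et_B [simp]: "z \<in> B \<Longrightarrow> et z = z"
proof -
  assume "z \<in> B"
  then obtain h where h: "z = et h" unfolding H_t_def by auto
  have "et (es (et h)) = et h" by (simp only: et_es) (simp only: es_et)
  then show "et z = z" by (simp only: h es_et)
qed

lemma es_B [simp]: "z \<in> B \<Longrightarrow> es z = z"
  unfolding H_t_def using es_et by auto

text \<open>As a combination of second legs of \<Delta>(1), \<open>z\<close> has a coproduct that
  can be read off the threefold unit; the two product forms of the latter put \<open>z\<close> on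
  the left or on the right of the first leg.\<close>

lemma D_B_left:
  assumes f: "bil s f" and z: "z \<in> B"
  shows "D z f = D 1 (\<lambda>a b. f (z * a) b)" "D z f = D 1 (\<lambda>a b. f (a * z) b)"
proof -
  have z': "z = D 1 (\<lambda>a b. sH (\<epsilon> (a * z)) b)"
    using et_B[OF z] by (simp add: et_eq)
  have "D z f = D 1 (\<lambda>a b. D b (\<lambda>b1 b2. f (sH (\<epsilon> (a * z)) b1) b2))"
    by (subst z') (simp add: D_sumt[OF f] D_scale[OF f] del: bil_def)
  note * = this
  have t: "tri s (\<lambda>a b1 b2. f (sH (\<epsilon> (a * z)) b1) b2)"
    using f by (simp add: bil_comp[OF f])
  have "D z f = D 1 (\<lambda>c d. D 1 (\<lambda>a b. f (sH (\<epsilon> (a * z)) (b * c)) d))"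
    unfolding * D_one_left[OF t] by (rule sumt_swap)
  also have "\<dots> = D 1 (\<lambda>c d. f (D 1 (\<lambda>a b. sH (\<epsilon> (a * z)) b) * c) d)"
    by (simp only: sumt_mult_right sumt_bil[OF f] smult_mult_left)
  finally show "D z f = D 1 (\<lambda>a b. f (z * a) b)"
    unfolding z'[symmetric] .
  have "D z f = D 1 (\<lambda>c d. D 1 (\<lambda>a b. f (sH (\<epsilon> (a * z)) (c * b)) d))"
    unfolding * D_one_right[OF t] by (rule sumt_swap)
  also have "\<dots> = D 1 (\<lambda>c d. f (c * D 1 (\<lambda>a b. sH (\<epsilon> (a * z)) b)) d)"
    by (simp only: sumt_mult_left sumt_bil[OF f] smult_mult_right)
  finally show "D z f = D 1 (\<lambda>a b. f (a * z) b)"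
    unfolding z'[symmetric] .
qed

lemma D_B_right:
  assumes f: "bil s f" and z: "z \<in> B"
  shows "D z f = D 1 (\<lambda>a b. f a (z * b))" "D z f = D 1 (\<lambda>a b. f a (b * z))"
proof -
  have g: "bil s (\<lambda>a b. f b a)" using f by simp
  have "D z f = D z (\<lambda>a b. f b a)" by (rule D_comm[OF f])
  also have "\<dots> = D 1 (\<lambda>a b. f b (z * a))" by (rule D_B_left[OF g z])
  also have "\<dots> = D 1 (\<lambda>a b. f a (z * b))"
    by (rule D_comm[where s = s]) (use f in \<open>simp add: bil_comp[OF f]\<close>)
  finally show "D z f = D 1 (\<lambda>a b. f a (z * b))" .
  have "D z f = D z (\<lambda>a b. f b a)" by (rule D_comm[OF f])
  also have "\<dots> = D 1 (\<lambda>a b. f b (a * z))" by (rule D_B_left[OF g z])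
  also have "\<dots> = D 1 (\<lambda>a b. f a (b * z))"
    by (rule D_comm[where s = s]) (use f in \<open>simp add: bil_comp[OF f]\<close>)
  finally show "D z f = D 1 (\<lambda>a b. f a (b * z))" .
qed

text \<open>\<Delta> is multiplicative, and the copy of \<Delta>(1) that accompanies a base element
  is absorbed by \<Delta>(h).\<close>

lemma D_B_mult:
  assumes f: "bil s f" and z: "z \<in> B"
  shows "D (z * h) f = D h (\<lambda>a b. f (z * a) b)" "D (z * h) f = D h (\<lambda>a b. f a (z * b))"
    "D (h * z) f = D h (\<lambda>a b. f (a * z) b)" "D (h * z) f = D h (\<lambda>a b. f a (b * z))"
proof -
  have b: "bil s (\<lambda>a b. D h (\<lambda>c d. f (a * c) (b * d)))" "bil s (\<lambda>c d. f (a * c) (b * d))" for a b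
    using f by (simp_all add: bil_comp[OF f])
  have l: "bil s (\<lambda>a b. f (z * a) b)" "bil s (\<lambda>a b. f a (z * b))" "bil s (\<lambda>a b. f (a * z) b)" "bil s (\<lambda>a b. f a (b * z))"
    using f by (simp_all add: bil_comp[OF f])
  show "D (z * h) f = D h (\<lambda>a b. f (z * a) b)"
    using D_mult[OF l(1), of 1 h] by (simp only: D_mult[OF f] D_B_left(1)[OF b(1) z] mult.assoc mult_1_left)
  show "D (z * h) f = D h (\<lambda>a b. f a (z * b))"
    using D_mult[OF l(2), of 1 h] by (simp only: D_mult[OF f] D_B_right(1)[OF b(1) z] mult.assoc mult_1_left)
  show "D (h * z) f = D h (\<lambda>a b. f (a * z) b)"
    using D_mult[OF l(3), of h 1] by (simp only: D_mult[OF f] D_B_left(2)[OF b(2) z] mult.assoc mult_1_right)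
  show "D (h * z) f = D h (\<lambda>a b. f a (b * z))"
    using D_mult[OF l(4), of h 1] by (simp only: D_mult[OF f] D_B_right(2)[OF b(2) z] mult.assoc mult_1_right)
qed

text \<open>\<open>w\<close> is a combination of first legs of \<Delta>(1), and multiplying these
  legs by \<open>z\<close> on either side gives the same tensor, namely \<Delta>(z).\<close>

lemma B_comm:
  assumes z: "z \<in> B" and w: "w \<in> B"
  shows "z * w = w * z"
proof -
  have w': "w = D 1 (\<lambda>a b. sH (\<epsilon> (b * w)) a)" using et_B[OF w] by (simp add: et_eq')
  have b: "bil sH (\<lambda>a b. sH (\<epsilon> (b * w)) a)" by simp
  have "z * w = D 1 (\<lambda>a b. sH (\<epsilon> (b * w)) (z * a))"
    by (subst w') (simp add: sumt_mult_left smult_mult_right)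
  also have "\<dots> = D 1 (\<lambda>a b. sH (\<epsilon> (b * w)) (a * z))"
    using D_B_left[OF b z] by simp
  also have "\<dots> = w * z"
    by (subst (2) w') (simp add: sumt_mult_right smult_mult_left)
  finally show ?thesis .
qed

text \<open>Both 1_1 z \<otimes> 1_2 and 1_1 \<otimes> z 1_2 equal \<Delta>(z), so \<open>z\<close>
  leaves the counit and reappears on the other leg.\<close>

lemma et_mult_B:
  assumes z: "z \<in> B"
  shows "et (z * h) = z * et h"
proof -
  have b: "bil sH (\<lambda>a b. sH (\<epsilon> (a * h)) b)" by simp
  have "et (z * h) = D 1 (\<lambda>a b. sH (\<epsilon> (a * z * h)) b)" by (simp add: et_eq mult.assoc)
  also have "\<dots> = D 1 (\<lambda>a b. sH (\<epsilon> (a * h)) (z * b))"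
    using D_B_left(2)[OF b z] D_B_right(1)[OF b z] by simp
  also have "\<dots> = z * et h" by (simp add: et_eq sumt_mult_left smult_mult_right)
  finally show ?thesis .
qed

lemma es_mult_B:
  assumes z: "z \<in> B"
  shows "es (h * z) = z * es h"
proof -
  have b: "bil sH (\<lambda>a b. sH (\<epsilon> (h * b)) a)" by simp
  have "es (h * z) = D 1 (\<lambda>a b. sH (\<epsilon> (h * (z * b))) a)" by (simp add: es_eq mult.assoc)
  also have "\<dots> = D 1 (\<lambda>a b. sH (\<epsilon> (h * b)) (z * a))"
    using D_B_left(1)[OF b z] D_B_right(1)[OF b z] by simp
  also have "\<dots> = z * es h" by (simp add: es_eq sumt_mult_left smult_mult_right)
  finally show ?thesis .
qed

lemma et_1 [simp]: "et 1 = 1"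
  using counit_left[of 1] by (simp add: et_eq)

lemma one_B [simp]: "1 \<in> B"
  using et_in[of 1] by simp

lemma mult_B [simp]: "z \<in> B \<Longrightarrow> w \<in> B \<Longrightarrow> z * w \<in> B"
  using et_mult_B[of z w] et_in[of "z * w"] by simp

text \<open>\<Delta>(1) lies in B \<otimes> B, so identities evaluated at \<Delta>(1) need to be
  checked on the base only, where elements commute.\<close>

lemma D_one_B:
  assumes f: "bil s f" and g: "bil s g"
    and eq: "\<And>a b. a \<in> B \<Longrightarrow> b \<in> B \<Longrightarrow> f a b = g a b"
  shows "D 1 f = D 1 g"
proof -
  have *: "D 1 f = D 1 (\<lambda>a b. f (et a) (et b))" if f: "bil s f" for f
  proof -
    have "D 1 (\<lambda>a b. f (et a) (et b)) = D 1 (\<lambda>a b. f (et a) b)"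
      by (rule D_one_et[where s = s]) (use f in \<open>simp add: bil_comp[OF f]\<close>)
    then show ?thesis using D_one_et'[OF f] by simp
  qed
  show ?thesis unfolding *[OF f] *[OF g] by (simp add: eq)
qed

text \<open>Starting from 1_2 h, the counit introduces a coproduct, which splits into \<Delta>(1_2)
  and \<Delta>(h). The threefold unit then becomes a product of two copies of \<Delta>(1): one is
  absorbed by \<Delta>(h), the other forms \<open>et\<close> together with the counit.\<close>

lemma D_et:
  assumes f: "bil s f"
  shows "D h (\<lambda>a b. f (et a) b) = D 1 (\<lambda>a b. f a (b * h))"
proof -
  have "D 1 (\<lambda>p q. f p (q * h)) = D 1 (\<lambda>p q. D (q * h) (\<lambda>a b. f p (sH (\<epsilon> a) b)))"
    using f D_counit_left[of s "f _"] by simp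
  also have "\<dots> = D 1 (\<lambda>p q. D q (\<lambda>c d. D h (\<lambda>a b. f p (sH (\<epsilon> (c * a)) (d * b)))))"
    by (subst D_mult[where s = s]) (use f in \<open>simp_all add: bil_comp[OF f]\<close>)
  also have "\<dots> = D 1 (\<lambda>p q. D 1 (\<lambda>c d. D h (\<lambda>a b. f p (sH (\<epsilon> (q * c * a)) (d * b)))))"
    by (rule D_one_left[where s = s]) (use f in \<open>simp add: bil_comp[OF f]\<close>)
  also have "\<dots> = D 1 (\<lambda>p q. D (1 * h) (\<lambda>a b. f p (sH (\<epsilon> (q * a)) b)))"
    by (subst D_mult[where s = s]) (use f in \<open>simp_all add: bil_comp[OF f] mult.assoc\<close>)
  also have "\<dots> = D h (\<lambda>a b. D 1 (\<lambda>p q. f (sH (\<epsilon> (q * a)) p) b))"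
    by (simp add: sumt_swap[of H "comult H 1"] bil_scale[OF f] del: bil_def)
  also have "\<dots> = D h (\<lambda>a b. f (et a) b)"
    by (simp only: et_eq' sumt_bil[OF f])
  finally show ?thesis by simp
qed

lemma D_es:
  assumes f: "bil s f"
  shows "D h (\<lambda>a b. f (es a) b) = D 1 (\<lambda>a b. f a (h * b))"
proof -
  have "D 1 (\<lambda>p q. f p (h * q)) = D 1 (\<lambda>p q. D (h * q) (\<lambda>a b. f p (sH (\<epsilon> a) b)))"
    using f D_counit_left[of s "f _"] by simp
  also have "\<dots> = D 1 (\<lambda>p q. D h (\<lambda>a b. D q (\<lambda>c d. f p (sH (\<epsilon> (a * c)) (b * d)))))"
    by (subst D_mult[where s = s]) (use f in \<open>simp_all add: bil_comp[OF f]\<close>)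
  also have "\<dots> = D 1 (\<lambda>p q. D q (\<lambda>c d. D h (\<lambda>a b. f p (sH (\<epsilon> (a * c)) (b * d)))))"
    by (subst sumt_swap) (rule refl)
  also have "\<dots> = D 1 (\<lambda>p q. D 1 (\<lambda>c d. D h (\<lambda>a b. f p (sH (\<epsilon> (a * (c * q))) (b * d)))))"
    by (rule D_one_right[where s = s]) (use f in \<open>simp add: bil_comp[OF f]\<close>)
  also have "\<dots> = D 1 (\<lambda>p q. D h (\<lambda>a b. D 1 (\<lambda>c d. f p (sH (\<epsilon> (a * (c * q))) (b * d)))))"
    by (subst sumt_swap[of H "comult H h"]) (rule refl)
  also have "\<dots> = D 1 (\<lambda>p q. D (h * 1) (\<lambda>a b. f p (sH (\<epsilon> (a * q)) b)))"
    by (subst D_mult[where s = s]) (use f in \<open>simp_all add: bil_comp[OF f] mult.assoc\<close>)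
  also have "\<dots> = D h (\<lambda>a b. D 1 (\<lambda>p q. f (sH (\<epsilon> (a * q)) p) b))"
    by (simp add: sumt_swap[of H "comult H 1"] bil_scale[OF f] del: bil_def)
  also have "\<dots> = D h (\<lambda>a b. f (es a) b)"
    by (simp only: es_eq sumt_bil[OF f])
  finally show ?thesis by simp
qed

section \<open>The antipode: antimultiplicative, involutive, compatible with the coproduct\<close>

lemma D_S_id: "D h (\<lambda>a b. S a * b) = es h"
  using fun_cong[OF antipode_left, of h] by (simp add: conv_def)

lemma D_id_S: "D h (\<lambda>a b. a * S b) = et h"
  using fun_cong[OF antipode_right, of h] by (simp add: conv_def)

lemma D_es_S: "D h (\<lambda>a b. es a * S b) = S h"
  using fun_cong[OF antipode_antipode, of h] by (simp add: conv_def[of H _ S] antipode_left)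

text \<open>The other bracketing of the axiom S * id * S = S.\<close>

lemma D_S_et: "D h (\<lambda>a b. S a * et b) = S h"
proof -
  have "D h (\<lambda>a b. S a * et b) = D h (\<lambda>a b. D b (\<lambda>b1 b2. S a * b1 * S b2))"
    by (simp add: D_id_S[symmetric] sumt_mult_left mult.assoc)
  also have "\<dots> = D h (\<lambda>a b. D a (\<lambda>a1 a2. S a1 * a2 * S b))"
    by (rule D_coassoc[symmetric, where s = sH]) simp
  also have "\<dots> = S h"
    by (simp add: sumt_mult_right[symmetric] D_S_id D_es_S)
  finally show ?thesis .
qed

text \<open>The fourfold coproduct is reassociated so that its two middle legs come from one
  application of \<Delta>; cocommutativity then exchanges them.\<close>

lemma D_swap23:
  assumes Q: "quad v Q"
  shows "D h (\<lambda>a b. D a (\<lambda>p q. D b (\<lambda>r s. Q p q r s))) = D h (\<lambda>a b. D a (\<lambda>p q. D b (\<lambda>r s. Q p r q s)))"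
proof -
  have 1: "D h (\<lambda>a b. D a (\<lambda>p q. D b (\<lambda>r s. Q p q r s))) = D h (\<lambda>p w. D w (\<lambda>x s. D x (\<lambda>q r. Q p q r s)))"
    if Q: "quad v Q" for Q
  proof -
    have "D h (\<lambda>a b. D a (\<lambda>p q. D b (\<lambda>r s. Q p q r s))) = D h (\<lambda>p w. D w (\<lambda>q b. D b (\<lambda>r s. Q p q r s)))"
      by (rule D_coassoc[where s = v]) (use Q in \<open>simp add: quad_comp[OF Q]\<close>)
    also have "\<dots> = D h (\<lambda>p w. D w (\<lambda>x s. D x (\<lambda>q r. Q p q r s)))"
      by (subst D_coassoc[where s = v]) (use Q in \<open>simp_all add: quad_comp[OF Q]\<close>)
    finally show ?thesis .
  qed
  have "D x (\<lambda>q r. Q p q r s) = D x (\<lambda>q r. Q p r q s)" for p s x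
    by (rule D_comm[where s = v]) (use Q in simp)
  then show ?thesis
    using 1[OF Q] 1[of "\<lambda>p q r s. Q p r q s"] Q by simp
qed

text \<open>The classical convolution argument with the unit replaced by \<open>es\<close> and
  \<open>et\<close>. In S(h_1 g_1) et(h_2 g_2) the second factor is expanded to h_2 g_2 S(g_3)
  S(h_3), after which S(h_1 g_1) h_2 g_2 contracts to a base element.\<close>

lemma S_mult: "S (h * g) = S g * S h"
proof -
  have b: "bil sH (\<lambda>a b. S a * b)" by simp
  have "S (h * g) = D h (\<lambda>u b. D g (\<lambda>v d. S (u * v) * et (b * d)))"
    unfolding D_S_et[of "h * g", symmetric] by (subst D_mult[where s = sH]) simp_all
  also have "\<dots> = D h (\<lambda>u b. D g (\<lambda>v d. S (u * v) * D b (\<lambda>p q. p * D d (\<lambda>r s. r * S s) * S q)))"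
  proof -
    \<comment> \<open>Here \<open>d\<close> may be replaced by \<open>et d\<close>, which lies in
      the base and can be placed between the two legs of \<Delta>(b).\<close>
    have "et (b * d) = D b (\<lambda>p q. p * D d (\<lambda>r s. r * S s) * S q)" for b d
    proof -
      have "et (b * d) = D (b * et d) (\<lambda>p q. p * S q)" by (simp only: D_id_S et_mult_et)
      also have "\<dots> = D b (\<lambda>p q. p * et d * S q)"
        by (rule D_B_mult[where s = sH]) simp_all
      finally show ?thesis by (simp only: D_id_S)
    qed
    then show ?thesis by simp
  qed
  also have "\<dots> = D h (\<lambda>u b. D b (\<lambda>p q. D g (\<lambda>v d. D d (\<lambda>r s. S (u * v) * p * r * S s * S q))))"
    by (simp only: sumt_mult_left sumt_mult_right mult.assoc, subst sumt_swap[of H "comult H g"], rule refl)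
  also have "\<dots> = D h (\<lambda>x q. D x (\<lambda>u p. D g (\<lambda>y s. D y (\<lambda>v r. S (u * v) * (p * r) * S s * S q))))"
    by (subst D_coassoc[where s = sH, symmetric], simp, subst D_coassoc[where s = sH]) (simp_all add: mult.assoc)
  also have "\<dots> = D h (\<lambda>x q. D g (\<lambda>y s. D (x * y) (\<lambda>a b. S a * b) * S s * S q))"
    unfolding D_mult[OF b] sumt_mult_right by (simp only: mult.assoc) (intro arg_cong[where f = "D h"] ext sumt_swap)
  \<comment> \<open>Passing from \<open>x\<close> to \<open>es x\<close> leaves a base element,
    which may be moved to the second leg of \<Delta>(y).\<close>
  also have "\<dots> = D h (\<lambda>x q. D g (\<lambda>y s. D (es x * y) (\<lambda>a b. S a * b) * S s * S q))"
    by (simp only: D_S_id es_mult_es)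
  also have "\<dots> = D h (\<lambda>x q. D g (\<lambda>y s. D y (\<lambda>a b. S a * (es x * b)) * S s * S q))"
    by (subst D_B_mult(2)[where s = sH]) simp_all
  also have "\<dots> = D h (\<lambda>x q. D g (\<lambda>a y. D y (\<lambda>b s. S a * es x * b * S s * S q)))"
    by (subst D_coassoc[where s = sH, symmetric]) (simp_all add: sumt_mult_right mult.assoc)
  also have "\<dots> = D h (\<lambda>x q. D g (\<lambda>a y. S a * es x * et y * S q))"
    by (simp add: D_id_S[symmetric] sumt_mult_left sumt_mult_right mult.assoc)
  \<comment> \<open>\<open>es x\<close> and \<open>et y\<close> commute, which separates the legs of
    \<open>g\<close> from those of \<open>h\<close>.\<close>
  also have "\<dots> = D h (\<lambda>x q. D g (\<lambda>a y. S a * et y) * (es x * S q))"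
    by (simp only: sumt_mult_right mult.assoc[symmetric]) (simp only: mult.assoc B_comm[OF es_in et_in])
  also have "\<dots> = S g * S h"
    by (simp only: D_S_et sumt_mult_left[symmetric] D_es_S)
  finally show ?thesis .
qed

lemma es_1 [simp]: "es 1 = 1" by simp

text \<open>By \<Delta>(z) = 1_1 z \<otimes> 1_2, antimultiplicativity pulls S z out of S(1_1 z) 1_2
  and leaves \<open>es 1\<close>.\<close>

lemma S_B [simp]:
  assumes "z \<in> B" shows "S z = z"
proof -
  have "es z = D 1 (\<lambda>a b. S (a * z) * b)"
    unfolding D_S_id[of z, symmetric] by (rule D_B_left[where s = sH]) (simp_all add: assms)
  also have "\<dots> = S z"
    by (simp only: S_mult mult.assoc sumt_mult_left[symmetric] D_S_id es_1 mult_1_right)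
  finally show ?thesis using assms by simp
qed

lemma S_et: "S (et h) = et h" by simp
lemma S_es: "S (es h) = es h" by simp

text \<open>Separability of \<Delta>(1): its second leg lies in the base, which S fixes, so the
  product of the legs is the convolution id * S at 1.\<close>

lemma D_one_mult: "D 1 (\<lambda>a b. a * b) = 1" "D 1 (\<lambda>a b. b * a) = 1"
proof -
  have "D 1 (\<lambda>a b. a * b) = D 1 (\<lambda>a b. a * S b)"
    by (rule D_one_B[where s = sH]) auto
  then show "D 1 (\<lambda>a b. a * b) = 1" by (simp only: D_id_S et_1)
  then show "D 1 (\<lambda>a b. b * a) = 1" using D_comm[of sH "\<lambda>a b. a * b" 1] by simp
qed

lemma D_et_id: "D h (\<lambda>a b. et a * b) = h"
proof -
  have "D h (\<lambda>a b. et a * b) = D 1 (\<lambda>a b. a * (b * h))"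
    by (rule D_et[where s = sH]) simp
  then show ?thesis by (simp add: mult.assoc[symmetric] sumt_mult_right[symmetric] D_one_mult)
qed

lemma D_id_es: "D h (\<lambda>a b. a * es b) = h"
proof -
  have "D h (\<lambda>a b. a * es b) = D h (\<lambda>a b. b * es a)"
    by (rule D_comm[where s = sH]) simp
  also have "\<dots> = D 1 (\<lambda>a b. h * b * a)"
    by (rule D_es[where s = sH]) simp
  finally show ?thesis by (simp add: mult.assoc sumt_mult_left[symmetric] D_one_mult)
qed

lemma D_S_comm: "D h (\<lambda>a b. b * S a) = et h" "D h (\<lambda>a b. S b * a) = es h"
  using D_comm[of sH "\<lambda>a b. a * S b" h] D_comm[of sH "\<lambda>a b. S a * b" h] by (simp_all add: D_S_id D_id_S)

text \<open>Cocommutativity gives S * S^2 = \<open>es\<close> and S^2 * S = \<open>et\<close>. Hence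
  S^2 = S^2 * S * S^2 = \<open>et\<close> * S^2 = id * S * S^2 = id * \<open>es\<close> = id, all
  products being convolutions.\<close>

lemma S_S [simp]: "S (S h) = h"
proof -
  have 1: "D h (\<lambda>a b. S a * S (S b)) = es h" for h
    by (simp only: S_mult[symmetric] S_sumt[symmetric] D_S_comm S_es)
  have 2: "D h (\<lambda>a b. S (S a) * S b) = et h" for h
    by (simp only: S_mult[symmetric] S_sumt[symmetric] D_S_comm S_et)
  have "S (S h) = D h (\<lambda>a b. S (S b) * es a)"
    by (subst D_es_S[symmetric]) (simp only: S_sumt S_mult S_es)
  also have "\<dots> = D h (\<lambda>a b. S (S a) * es b)"
    by (rule D_comm[where s = sH]) simp
  also have "\<dots> = D h (\<lambda>a b. D b (\<lambda>c d. S (S a) * S c * S (S d)))"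
    by (simp only: 1[symmetric] sumt_mult_left mult.assoc)
  also have "\<dots> = D h (\<lambda>a b. D a (\<lambda>c d. S (S c) * S d * S (S b)))"
    by (rule D_coassoc[symmetric, where s = sH]) simp
  also have "\<dots> = D h (\<lambda>a b. D a (\<lambda>c d. c * S d * S (S b)))"
    by (simp only: 2 D_id_S sumt_mult_right[symmetric])
  also have "\<dots> = D h (\<lambda>a b. D b (\<lambda>c d. a * S c * S (S d)))"
    by (rule D_coassoc[where s = sH]) simp
  also have "\<dots> = h"
    by (simp only: 1 sumt_mult_left[symmetric] mult.assoc D_id_es)
  finally show ?thesis .
qed

lemma inv_S [simp]: "inv S = S"
  by (rule inv_equality) simp_all

text \<open>\<open>D_et\<close> and \<open>D_es\<close> turn one of the counital legs into a leg of
  \<Delta>(1), and linearity over the base pulls the other one out.\<close>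

lemma D_et_et:
  assumes f: "bil s f"
  shows "D h (\<lambda>a b. f (et a) (et b)) = D (et h) f" "D h (\<lambda>a b. f (es a) (es b)) = D (es h) f"
proof -
  have g: "bil s (\<lambda>a b. f a (et b))" "bil s (\<lambda>a b. f a (es b))" using f by (simp_all add: bil_comp[OF f])
  have "D h (\<lambda>a b. f (et a) (et b)) = D 1 (\<lambda>a b. f a (et (b * h)))"
    by (rule D_et[OF g(1)])
  also have "\<dots> = D 1 (\<lambda>a b. f a (b * et h))"
    by (rule D_one_B[where s = s]) (use f in \<open>simp_all add: bil_comp[OF f] et_mult_B\<close>)
  also have "\<dots> = D (et h) f"
    by (rule D_B_right[symmetric, OF f]) simp
  finally show "D h (\<lambda>a b. f (et a) (et b)) = D (et h) f" .
  have "D h (\<lambda>a b. f (es a) (es b)) = D 1 (\<lambda>a b. f a (es (h * b)))"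
    by (rule D_es[OF g(2)])
  also have "\<dots> = D 1 (\<lambda>a b. f a (b * es h))"
    by (rule D_one_B[where s = s]) (use f in \<open>simp_all add: bil_comp[OF f] es_mult_B\<close>)
  also have "\<dots> = D (es h) f"
    by (rule D_B_right[symmetric, OF f]) simp
  finally show "D h (\<lambda>a b. f (es a) (es b)) = D (es h) f" .
qed

text \<open>Cocommutativity allows the legs to appear unflipped. The scheme is that of
  \<open>S_mult\<close>, one level up: \<Delta>(S h_1) \<Delta>(et h_2) is expanded until \<Delta>(S
  h_1 h_2) can be contracted to \<Delta>(es h_1).\<close>

lemma D_S:
  assumes f: "bil s f"
  shows "D (S h) f = D h (\<lambda>a b. f (S a) (S b))"
proof -
  note [simp] = bil_comp[OF f]
  have g: "bil s (\<lambda>u v. D b (\<lambda>q t. f (u * S q) (v * S t)))" for b by simp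
  have "D (S h) f = D h (\<lambda>a b. D (S a * et b) f)"
    by (subst D_S_et[symmetric]) (simp only: D_sumt[OF f])
  also have "\<dots> = D h (\<lambda>a b. D (S a) (\<lambda>u v. D (et b) (\<lambda>p q. f (u * p) (v * q))))"
    by (simp only: D_mult[OF f])
  also have "\<dots> = D h (\<lambda>a b. D (S a) (\<lambda>u v. D b (\<lambda>c d. D c (\<lambda>p r. D d (\<lambda>q t. f (u * (p * S q)) (v * (r * S t)))))))"
  proof -
    have "D (et b) g = D b (\<lambda>c d. D c (\<lambda>p r. D d (\<lambda>q t. g (p * S q) (r * S t))))" if g: "bil s g" for b g
    proof -
      note [simp] = bil_comp[OF g]
      have "D (et b) g = D b (\<lambda>c d. g (et c) (et d))" by (rule D_et_et(1)[symmetric, OF g])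
      also have "\<dots> = D b (\<lambda>c d. D c (\<lambda>p q. D d (\<lambda>r t. g (p * S q) (r * S t))))"
        by (simp only: D_id_S[symmetric] sumt_bil[OF g]) (intro arg_cong[where f = "D b"] ext sumt_swap)
      also have "\<dots> = D b (\<lambda>c d. D c (\<lambda>p r. D d (\<lambda>q t. g (p * S q) (r * S t))))"
        by (rule D_swap23[where v = s]) simp
      finally show ?thesis .
    qed
    then show ?thesis by simp
  qed
  also have "\<dots> = D h (\<lambda>a b. D b (\<lambda>c d. D (S a) (\<lambda>u v. D c (\<lambda>p r. D d (\<lambda>q t. f (u * p * S q) (v * r * S t))))))"
    by (subst sumt_swap) (simp add: mult.assoc)
  also have "\<dots> = D h (\<lambda>a b. D a (\<lambda>c d. D (S c) (\<lambda>u v. D d (\<lambda>p r. D b (\<lambda>q t. f (u * p * S q) (v * r * S t))))))"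
    by (rule D_coassoc[symmetric, where s = s]) simp
  also have "\<dots> = D h (\<lambda>a b. D a (\<lambda>c d. D (S c * d) (\<lambda>u v. D b (\<lambda>q t. f (u * S q) (v * S t)))))"
    by (subst D_mult[where s = s]) simp_all
  also have "\<dots> = D h (\<lambda>a b. D (es a) (\<lambda>u v. D b (\<lambda>q t. f (u * S q) (v * S t))))"
    by (simp only: D_S_id[symmetric] D_sumt[OF g])
  also have "\<dots> = D h (\<lambda>a b. D a (\<lambda>u v. D b (\<lambda>q t. f (es u * S q) (es v * S t))))"
    by (subst D_et_et(2)[where s = s]) simp_all
  also have "\<dots> = D h (\<lambda>a b. D a (\<lambda>u q. D b (\<lambda>v t. f (es u * S q) (es v * S t))))"
    by (rule D_swap23[where v = s]) simp
  also have "\<dots> = D h (\<lambda>a b. f (S a) (S b))"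
    by (simp only: D_es_S sumt_bil[OF f, symmetric])
  finally show ?thesis .
qed

lemma et_S: "et (S h) = es h"
  unfolding D_id_S[of "S h", symmetric] by (subst D_S[where s = sH]) (simp_all add: D_S_id)

subsection \<open>The centraliser and the adjoint action\<close>

abbreviation "C \<equiv> C_H H"

lemma C_iff: "a \<in> C \<longleftrightarrow> (\<forall>x\<in>B. a * x = x * a)"
  by (simp add: C_H_def H_s_eq)

lemma C_comm: "a \<in> C \<Longrightarrow> x \<in> B \<Longrightarrow> a * x = x * a"
  by (simp add: C_iff)

lemma B_in_C [simp]: "x \<in> B \<Longrightarrow> x \<in> C"
  by (simp add: C_iff B_comm)

lemma C_mult [simp]:
  assumes "a \<in> C" "b \<in> C" shows "a * b \<in> C"
  unfolding C_iff
proof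
  fix x assume x: "x \<in> B"
  have "a * b * x = a * (x * b)" by (simp add: mult.assoc C_comm[OF assms(2) x])
  also have "\<dots> = x * (a * b)" by (simp add: mult.assoc[symmetric] C_comm[OF assms(1) x])
  finally show "a * b * x = x * (a * b)" .
qed

lemma C_S [simp]:
  assumes "a \<in> C" shows "S a \<in> C"
  unfolding C_iff
proof
  fix x assume x: "x \<in> B"
  have "S a * x = S (x * a)" by (simp add: S_mult x)
  also have "\<dots> = S (a * x)" by (simp add: C_comm[OF assms x])
  also have "\<dots> = x * S a" by (simp add: S_mult x)
  finally show "S a * x = x * S a" .
qed

lemma C_subspace [simp]: "module.subspace sH C"
proof -
  interpret vector_space sH by simp
  show ?thesis
    by (rule subspaceI) (auto simp: C_iff distrib_left distrib_right smult_mult_left[symmetric] smult_mult_right[symmetric])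
qed

lemma B_subspace [simp]: "module.subspace sH B"
proof -
  interpret vector_space sH by simp
  have l: "lin sH sH et" by (rule lin_et) simp
  have "x \<in> B \<longleftrightarrow> et x = x" for x by (metis et_B et_in)
  then show ?thesis
    by (intro subspaceI) (auto simp: linD(1,2)[OF l] lin_0[OF l])
qed

abbreviation "ad \<equiv> Ad H"

lemma ad_eq: "ad h a = D h (\<lambda>p q. p * a * S q)"
  unfolding Ad_def by simp

lemma lin_ad [simp]: "lin s sH f \<Longrightarrow> lin s sH (\<lambda>x. ad (f x) a)" "lin s sH f \<Longrightarrow> lin s sH (\<lambda>x. ad h (f x))"
  unfolding ad_eq by simp_all

lemma ad_sumt: "ad (sumt H t g) a = sumt H t (\<lambda>u v. ad (g u v) a)" "ad h (sumt H t g) = sumt H t (\<lambda>u v. ad h (g u v))"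
  by (rule sumt_lin[where sA = sH and sB = sH], simp)+

lemma ad_B_mult:
  assumes y: "y \<in> B"
  shows "ad (y * h) a = y * ad h a" "ad (y * h) a = ad h a * y"
proof -
  show "ad (y * h) a = y * ad h a"
    unfolding ad_eq by (subst D_B_mult(1)[where s = sH]) (simp_all add: y sumt_mult_left mult.assoc)
  show "ad (y * h) a = ad h a * y"
    unfolding ad_eq by (subst D_B_mult(2)[where s = sH]) (simp_all add: y sumt_mult_right mult.assoc S_mult)
qed

text \<open>Multiplying \<open>ad h a\<close> by a base element on the left or on the right both
  amounts to replacing \<open>h\<close> by \<open>y * h\<close>; so the values centralise the base
  even when \<open>a\<close> does not.\<close>

lemma ad_in_C [simp]: "ad h a \<in> C"
  unfolding C_iff using ad_B_mult by metis

lemma ad_mult: "ad (g * h) a = ad g (ad h a)"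
  unfolding ad_eq by (subst D_mult[where s = sH]) (simp_all add: sumt_mult_left sumt_mult_right mult.assoc S_mult)

lemma ad_1 [simp]:
  assumes a: "a \<in> C"
  shows "ad 1 a = a"
proof -
  have "ad 1 a = D 1 (\<lambda>p q. a * (p * q))"
    unfolding ad_eq by (rule D_one_B[where s = sH]) (simp_all add: C_comm[OF a, symmetric] mult.assoc)
  then show ?thesis by (simp add: sumt_mult_left[symmetric] D_one_mult)
qed

lemma ad_B: "z \<in> B \<Longrightarrow> a \<in> C \<Longrightarrow> ad z a = z * a"
  using ad_B_mult(1)[of z 1 a] by simp

lemma ad_et: "z \<in> B \<Longrightarrow> ad h z = et (h * z)"
  unfolding ad_eq D_id_S[symmetric] by (subst D_B_mult(3)[where s = sH]) simp_all

text \<open>The inner factor S(h_2) h_3 contracts to a base element, past which \<open>a\<close> can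
  be moved because it centralises the base; then id * \<open>es\<close> = id applies.\<close>

lemma ad_prod:
  assumes a: "a \<in> C"
  shows "D h (\<lambda>p q. ad p a * ad q b) = ad h (a * b)"
proof -
  have "D h (\<lambda>p q. ad p a * ad q b) = D h (\<lambda>p q. D p (\<lambda>u v. D q (\<lambda>r s. u * a * S v * r * b * S s)))"
    by (simp only: ad_eq sumt_mult_right, simp only: sumt_mult_left mult.assoc)
  also have "\<dots> = D h (\<lambda>u w. D w (\<lambda>v q. D q (\<lambda>r s. u * a * S v * r * b * S s)))"
    by (rule D_coassoc[where s = sH]) simp
  also have "\<dots> = D h (\<lambda>u w. D w (\<lambda>x s. D x (\<lambda>v r. u * a * S v * r * b * S s)))"
    by (subst D_coassoc[symmetric, where s = sH]) simp_all
  also have "\<dots> = D h (\<lambda>u w. D w (\<lambda>x s. u * (a * es x) * b * S s))"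
    by (simp add: D_S_id[symmetric] sumt_mult_left sumt_mult_right mult.assoc)
  also have "\<dots> = D h (\<lambda>u w. D w (\<lambda>x s. u * es x * a * b * S s))"
    by (simp only: C_comm[OF a es_in] mult.assoc)
  also have "\<dots> = D h (\<lambda>y s. D y (\<lambda>u x. u * es x * a * b * S s))"
    by (rule D_coassoc[symmetric, where s = sH]) simp
  also have "\<dots> = D h (\<lambda>y s. D y (\<lambda>u x. u * es x) * (a * b * S s))"
    by (simp only: sumt_mult_right mult.assoc)
  also have "\<dots> = ad h (a * b)"
    by (simp only: D_id_es ad_eq mult.assoc)
  finally show ?thesis .
qed

text \<open>Multiplicativity of \<Delta> and \<open>D_S\<close> leave the four legs of \<Delta>(h)
  paired wrongly: the middle two have to be exchanged, which \<open>D_swap23\<close>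
  permits.\<close>

lemma D_ad:
  assumes f: "bil s f"
  shows "D (ad h a) f = D h (\<lambda>p q. D a (\<lambda>u v. f (ad p u) (ad q v)))"
proof -
  note [simp] = bil_comp[OF f]
  have bf: "lin sH s (\<lambda>a. f a b)" "lin sH s (f a)" for a b using f by auto
  have "D (ad h a) f = D h (\<lambda>x y. D x (\<lambda>p q. D a (\<lambda>u v. D y (\<lambda>r t. f (p * u * S r) (q * v * S t)))))"
    unfolding ad_eq D_sumt[OF f] by (simp add: D_mult[where s = s] D_S[where s = s] bf)
  also have "\<dots> = D h (\<lambda>x y. D x (\<lambda>p q. D y (\<lambda>r t. D a (\<lambda>u v. f (p * u * S r) (q * v * S t)))))"
    by (subst sumt_swap[of H "comult H a"]) (rule refl)
  also have "\<dots> = D h (\<lambda>x y. D x (\<lambda>p r. D y (\<lambda>q t. D a (\<lambda>u v. f (p * u * S r) (q * v * S t)))))"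
    by (rule D_swap23[where v = s]) simp
  also have "\<dots> = D h (\<lambda>x y. D y (\<lambda>q t. D x (\<lambda>p r. D a (\<lambda>u v. f (p * u * S r) (q * v * S t)))))"
    by (intro arg_cong[where f = "D h"] ext sumt_swap)
  also have "\<dots> = D h (\<lambda>p q. D a (\<lambda>u v. f (ad p u) (ad q v)))"
    by (simp only: ad_eq sumt_bil[OF f] sumt_swap[of H "comult H a"])
  finally show ?thesis .
qed

text \<open>Antimultiplicativity and S^2 = id reverse the two legs of \<Delta>(h), and
  cocommutativity restores them.\<close>

lemma S_ad: "S (ad h a) = ad h (S a)"
proof -
  have "S (ad h a) = D h (\<lambda>p q. q * S a * S p)"
    by (simp add: ad_eq S_sumt S_mult mult.assoc)
  also have "\<dots> = ad h (S a)"
    unfolding ad_eq by (rule D_comm[where s = sH]) simp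
  finally show ?thesis .
qed

text \<open>Under \<open>et\<close> the factor S(h_2) may be replaced by et(S h_2) = es(h_2). Being
  in the base it passes \<open>a\<close>, and h_1 es(h_2) contracts to h.\<close>

lemma et_ad:
  assumes a: "a \<in> C"
  shows "et (ad h a) = et (h * a)"
proof -
  have "et (ad h a) = D h (\<lambda>p q. et (p * a * et (S q)))"
    by (simp add: ad_eq sumt_push et_mult_et)
  also have "\<dots> = D h (\<lambda>p q. et (p * es q * a))"
    by (simp only: et_S C_comm[OF a es_in] mult.assoc)
  also have "\<dots> = et (h * a)"
    by (simp only: sumt_push(3)[symmetric] sumt_mult_right[symmetric] D_id_es)
  finally show ?thesis .
qed

lemma es_C:
  assumes a: "a \<in> C"
  shows "es a = et a"
  unfolding es_eq et_eq' by (rule D_one_B[where s = sH]) (simp_all add: C_comm[OF a])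

text \<open>The expansion of \<Delta>(a) chosen by \<open>legs\<close> need not have its factors in
  C. Since \<open>a\<close> equals \<open>ad 1 a\<close>, they may be replaced by values of the
  adjoint action, which do lie in C.\<close>

lemma D_C:
  assumes a: "a \<in> C" and f: "bil s f"
  shows "D 1 (\<lambda>p q. D a (\<lambda>u v. f (ad p u) (ad q v))) = D a f"
  using D_ad[OF f, of 1 a] a by simp

lemma D_C_cong:
  assumes a: "a \<in> C" and f: "bil s f" "bil s g" and eq: "\<And>u v. u \<in> C \<Longrightarrow> v \<in> C \<Longrightarrow> f u v = g u v"
  shows "D a f = D a g"
  by (subst (1 2) D_C[OF a, symmetric, where s = s]) (use f eq in simp_all)

end

section \<open>Twisting by a cocycle\<close>

locale twisting_cocycle = cocommutative_quantum_groupoid H + weak_invertible_unit_2_cocycle H F G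
  for H :: "('k::field, 'h::{ring,monoid_mult}) qgroupoid" (structure) and F G :: "('h, 'h, 'k) tensor" +
  assumes normalised: "sw H (\<lambda>f f'. smult H (counit H f) f') F = 1"
begin

abbreviation "e \<equiv> comult H 1"

lemma cop [simp]: "comult_cop H = comult H"
  using cocomm by (simp add: cocommutative_def)

lemma e_e: "e \<bullet> e = e"
  using comult_mult[of 1 1] by simp

lemma F_HH [simp]: "F \<in> HH H" and G_HH [simp]: "G \<in> HH H"
  using cocycle_in inverse_in by auto

lemma F_G: "F \<bullet> G = e" and G_F: "G \<bullet> F = e"
  using inverse_left inverse_right by simp_all

lemma e_F: "e \<bullet> F = F" and F_e: "F \<bullet> e = F"
  using cocycle_in e_e by (auto simp: mult2_assoc) (auto simp: mult2_assoc[symmetric])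

lemma e_G: "e \<bullet> G = G" and G_e: "G \<bullet> e = G"
  using inverse_in e_e by (auto simp: mult2_assoc) (auto simp: mult2_assoc[symmetric])

text \<open>The properties shared by \<open>F\<close>, its inverse and \<Delta>(1). Absorption of
  \<Delta>(1) and the crossing rule together allow a base element to stand on either side of either
  leg; this makes the maps defined by \<open>T\<close> balanced over the base.\<close>

definition central :: "('h, 'h, 'k) tensor \<Rightarrow> bool" where
  "central T \<longleftrightarrow> T \<in> HH H \<and> e \<bullet> T = T \<and> T \<bullet> e = T \<and> (\<forall>y\<in>B. (1 \<otimes> y) \<bullet> T = T \<bullet> (y \<otimes> 1))"

lemma central_F [simp]: "central F"
  by (simp add: central_def e_F F_e cocycle_s H_s_eq)

lemma sumt_left:
  assumes "T \<in> HH H" "bil s f"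
  shows "sumt H ((x \<otimes> y) \<bullet> T) f = sumt H T (\<lambda>a b. f (x * a) (y * b))"
    "sumt H (T \<bullet> (x \<otimes> y)) f = sumt H T (\<lambda>a b. f (a * x) (b * y))"
  using assms(2) by (simp_all add: sumt_mult2[where v = s] assms(1) sumt_pure[where s = s] bil_comp[OF assms(2)])

lemma sumt_e:
  assumes "central T" "bil s f"
  shows "D 1 (\<lambda>a b. sumt H T (\<lambda>c d. f (a * c) (b * d))) = sumt H T f"
    "sumt H T (\<lambda>a b. D 1 (\<lambda>c d. f (a * c) (b * d))) = sumt H T f"
  using assms sumt_mult2[of e T s f] sumt_mult2[of T e s f] by (simp_all add: central_def)

text \<open>Stated from right absorption of \<Delta>(1) because it is also applied to the twisted
  coproducts \<open>twist h\<close>.\<close>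

lemma sumt_B_right:
  assumes T: "T \<in> HH H" "T \<bullet> e = T" and f: "bil s f" and y: "y \<in> B"
  shows "sumt H T (\<lambda>a b. f (a * y) b) = sumt H T (\<lambda>a b. f a (b * y))"
proof -
  note [simp] = bil_comp[OF f]
  have b: "bil s (\<lambda>c d. f (a * c) (b * d))" "bil s (\<lambda>a b. f (a * y) b)" "bil s (\<lambda>a b. f a (b * y))" for a b
    using f by simp_all
  have e: "sumt H T g = sumt H T (\<lambda>a b. D 1 (\<lambda>c d. g (a * c) (b * d)))" if "bil s g" for g
    using sumt_mult2[OF T(1) comult_HH[of 1] that] T(2) by simp
  have "D 1 (\<lambda>c d. f (a * (c * y)) (b * d)) = D 1 (\<lambda>c d. f (a * c) (b * (d * y)))" for a b
    using D_B_left(2)[OF b(1) y] D_B_right(2)[OF b(1) y] by simp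
  then show ?thesis
    unfolding e[OF b(2)] e[OF b(3)] by (simp only: mult.assoc)
qed

lemma sumt_B_left:
  assumes T: "central T" and f: "bil s f" and y: "y \<in> B"
  shows "sumt H T (\<lambda>a b. f (y * a) b) = sumt H T (\<lambda>a b. f a (y * b))"
    "sumt H T (\<lambda>a b. f (a * y) b) = sumt H T (\<lambda>a b. f a (b * y))"
proof -
  note [simp] = bil_comp[OF f]
  have b: "bil s (\<lambda>a b. sumt H T (\<lambda>c d. f (a * c) (b * d)))"
    "bil s (\<lambda>a b. f (y * a) b)" "bil s (\<lambda>a b. f a (y * b))"
    using f by simp_all
  show "sumt H T (\<lambda>a b. f (y * a) b) = sumt H T (\<lambda>a b. f a (y * b))"
    using D_B_left(1)[OF b(1) y] D_B_right(1)[OF b(1) y]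
    by (simp only: sumt_e(1)[OF T b(2), symmetric] sumt_e(1)[OF T b(3), symmetric] mult.assoc)
  show "sumt H T (\<lambda>a b. f (a * y) b) = sumt H T (\<lambda>a b. f a (b * y))"
    using sumt_B_right[OF _ _ f y] T by (simp add: central_def)
qed

lemma sumt_B:
  assumes T: "central T" and f: "bil s f" and y: "y \<in> B"
  shows "sumt H T (\<lambda>a b. f a (y * b)) = sumt H T (\<lambda>a b. f (a * y) b)"
proof -
  have "sumt H ((1 \<otimes> y) \<bullet> T) f = sumt H (T \<bullet> (y \<otimes> 1)) f"
    using T y by (simp add: central_def)
  then show ?thesis
    using sumt_left[of T s f] T f by (simp add: central_def)
qed

text \<open>The condition on the inverse for H_t, read from right to left, is the crossing rule that
  \<open>F\<close> satisfies for H_s.\<close>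

lemma central_G [simp]: "central G"
proof -
  have "(1 \<otimes> y) \<bullet> G = G \<bullet> (y \<otimes> 1)" if y: "y \<in> B" for y
    by (rule inverse_t[OF y, symmetric])
  then show ?thesis by (simp add: central_def e_G G_e)
qed

lemma central_e [simp]: "central e"
proof -
  have "(1 \<otimes> y) \<bullet> e = e \<bullet> (y \<otimes> 1)" if y: "y \<in> B" for y
  proof (rule HH_eqI)
    fix f :: "'h \<Rightarrow> 'h \<Rightarrow> ('h, 'h, 'k) tensor" assume f: "bil tscale f"
    show "sumt H ((1 \<otimes> y) \<bullet> e) f = sumt H (e \<bullet> (y \<otimes> 1)) f"
      using D_B_right(1)[OF f y] D_B_left(2)[OF f y] by (simp add: sumt_left[OF _ f] del: bil_def)
  qed simp_all
  then show ?thesis by (simp add: central_def e_e)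
qed

text \<open>Evaluating both sides of the cocycle axiom on a trilinear map by \<open>ev3\<close>
  replaces \<open>mult3\<close> by nested sums.\<close>

lemma cocycle_D:
  assumes f: "tri s f"
  shows "sumt H F (\<lambda>a b. D a (\<lambda>u v. sumt H F (\<lambda>c d. f (u * c) (v * d) b))) =
    sumt H F (\<lambda>a b. D b (\<lambda>u v. sumt H F (\<lambda>c d. f a (u * c) (v * d))))"
proof -
  note [simp] = tri_comp[OF f]
  have b: "bil s (f a)" for a using f by simp
  have id: "comult_id H F = sumt H F (\<lambda>a b. D a (\<lambda>u v. tensHHH H u (v \<otimes> b)))"
    "id_comult H F = sumt H F (\<lambda>a b. tensHHH H a (comult H b))"
    unfolding comult_id_def id_comult_def by simp_all
  have 1: "sw H (\<lambda>a b. tensHHH H a (b \<otimes> 1)) F = sumt H F (\<lambda>a b. tensHHH H a (b \<otimes> 1))" by simp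
  have 2: "tensHHH H 1 F = sumt H F (\<lambda>a b. tensHHH H 1 (a \<otimes> b))"
    by (subst legs_HH[OF F_HH], rule sumt_lin[OF lin_tensHHH(2)[OF lin_id[OF vs_tscale]]])
  have 3: "ev3 f (mult3 H (comult_id H F) (sumt H F (\<lambda>a b. tensHHH H a (b \<otimes> 1)))) =
      sumt H F (\<lambda>a b. D a (\<lambda>u v. sumt H F (\<lambda>c d. f (u * c) (v * d) b)))"
  proof -
    have "ev3 f (tensHHH H x ((y \<otimes> z) \<bullet> (d \<otimes> 1))) = f x (y * d) z" for x y z d
      by (simp add: ev3_tens[OF f] sumt_left[OF _ b] sumt_pure[where s = s] del: bil_def)
         (subst sumt_pure[where s = s], use f in simp_all)
    then show ?thesis
      by (simp add: mult3_sumt(1) id ev_sumt[OF mult3_sumt(2)] ev_tens[OF mult3_sumt(2)]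
          ev3_sumt[OF f] del: tri_def bil_def)
  qed
  have 4: "ev3 f (mult3 H (id_comult H F) (sumt H F (\<lambda>a b. tensHHH H 1 (a \<otimes> b)))) =
      sumt H F (\<lambda>a b. D b (\<lambda>u v. sumt H F (\<lambda>c d. f a (u * c) (v * d))))"
  proof -
    have "ev3 f (tensHHH H x (comult H y \<bullet> (c \<otimes> d))) = D y (\<lambda>u v. f x (u * c) (v * d))" for x y c d
      by (simp add: ev3_tens[OF f] sumt_left[OF _ b] del: bil_def)
    moreover have b3: "bal3 (\<lambda>a u. sumt H F (\<lambda>c d. tensHHH H a (u \<bullet> (c \<otimes> d))))"
      using mult3_sumt(2)[of "\<lambda>x y. x \<otimes> y" F "\<lambda>_ _. 1"] by simp
    ultimately show ?thesis
      by (simp add: mult3_sumt(1) id ev_sumt[OF b3] ev_tens[OF b3] ev3_sumt[OF f] del: tri_def bil_def)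
        (intro arg_cong[where f = "sumt H F"] ext sumt_swap)
  qed
  show ?thesis
    unfolding 3[symmetric] 4[symmetric] using cocycle by (simp only: 1 2)
qed

section \<open>Normalisation of the cocycle and of its inverse\<close>

lemma sumt_F_G: "bil s f \<Longrightarrow> sumt H F (\<lambda>a b. sumt H G (\<lambda>c d. f (a * c) (b * d))) = D 1 f"
  using sumt_mult2[of F G s f] by (simp add: F_G)

text \<open>Multiplying out the definition of \<open>et\<close> yields \<Delta>(1) T with \<epsilon>
  applied to one leg, and \<open>T\<close> absorbs \<Delta>(1).\<close>

lemma central_et:
  assumes T: "central T"
  shows "sumt H T (\<lambda>c d. et c * d) = sumt H T (\<lambda>c d. sH (\<epsilon> c) d)"
    "sumt H T (\<lambda>c d. et d * c) = sumt H T (\<lambda>c d. sH (\<epsilon> d) c)"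
proof -
  have "sumt H T (\<lambda>c d. et c * d) = D 1 (\<lambda>p q. sumt H T (\<lambda>c d. sH (\<epsilon> (p * c)) (q * d)))"
    by (simp only: et_eq sumt_mult_right smult_mult_left[symmetric]) (rule sumt_swap)
  also have "\<dots> = sumt H T (\<lambda>c d. sH (\<epsilon> c) d)"
    by (rule sumt_e(1)[OF T, where s = sH]) simp
  finally show "sumt H T (\<lambda>c d. et c * d) = sumt H T (\<lambda>c d. sH (\<epsilon> c) d)" .
  have "sumt H T (\<lambda>c d. et d * c) = D 1 (\<lambda>p q. sumt H T (\<lambda>c d. sH (\<epsilon> (q * d)) (p * c)))"
    by (simp only: et_eq' sumt_mult_right smult_mult_left[symmetric]) (rule sumt_swap)
  also have "\<dots> = sumt H T (\<lambda>c d. sH (\<epsilon> d) c)"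
    by (rule sumt_e(1)[OF T, where s = sH]) simp
  finally show "sumt H T (\<lambda>c d. et d * c) = sumt H T (\<lambda>c d. sH (\<epsilon> d) c)" .
qed

text \<open>The counit sees \<open>g\<close> only through \<open>et g\<close>; this base element can
  be absorbed into \<Delta>(h), where the counit axiom applies.\<close>

lemma D_counit_mult:
  "D h (\<lambda>a b. sH (\<epsilon> (b * g)) a) = h * et g" "D h (\<lambda>a b. sH (\<epsilon> (a * g)) b) = h * et g"
proof -
  have "D h (\<lambda>a b. sH (\<epsilon> (b * et g)) a) = D (h * et g) (\<lambda>a b. sH (\<epsilon> b) a)"
    by (rule D_B_mult(4)[symmetric, where s = sH]) simp_all
  then show "D h (\<lambda>a b. sH (\<epsilon> (b * g)) a) = h * et g"
    using D_counit_right[OF lin_id[OF vs_H]] by (simp add: counit_et)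
  have "D h (\<lambda>a b. sH (\<epsilon> (a * et g)) b) = D (h * et g) (\<lambda>a b. sH (\<epsilon> a) b)"
    by (rule D_B_mult(3)[symmetric, where s = sH]) simp_all
  then show "D h (\<lambda>a b. sH (\<epsilon> (a * g)) b) = h * et g"
    using D_counit_left[OF lin_id[OF vs_H]] by (simp add: counit_et)
qed

lemma F_norm_left: "sumt H F (\<lambda>a b. sH (\<epsilon> a) b) = 1"
  using normalised by simp

text \<open>Applying \<open>id \<otimes> \<epsilon> \<otimes> id\<close> to the cocycle identity turns one normalisation into the other.\<close>

lemma F_norm_right: "sumt H F (\<lambda>a b. sH (\<epsilon> b) a) = 1"
proof -
  define u where "u = sumt H F (\<lambda>a b. sH (\<epsilon> b) a)"
  \<comment> \<open>With \<epsilon> on the middle leg, one side of the cocycle identity acquires the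
    factor \<open>u\<close> on its first leg, the other the given normalisation on its
    second.\<close>
  have 1: "sumt H F (\<lambda>a b. g (a * u) b) = sumt H F g" if g: "bil tscale g" for g :: "_ \<Rightarrow> _ \<Rightarrow> ('h, 'h, 'k) tensor"
  proof -
    note [simp] = bil_comp[OF g]
    have gl: "lin sH tscale (\<lambda>a. g a b)" "lin sH tscale (g a)" for a b using g by auto
    have "sumt H F (\<lambda>a b. g (a * u) b) = sumt H F (\<lambda>a b. sumt H F (\<lambda>c d. g (a * et d * c) b))"
      by (simp only: u_def central_et(2)[OF central_F, symmetric] sumt_mult_left sumt_bil[OF g] mult.assoc)
    also have "\<dots> = sumt H F (\<lambda>a b. D a (\<lambda>u v. sumt H F (\<lambda>c d. g (sH (\<epsilon> (v * d)) (u * c)) b)))"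
      by (simp only: D_counit_mult(1)[symmetric] sumt_mult_right sumt_bil[OF g] smult_mult_left[symmetric] sumt_swap[of H F])
    also have "\<dots> = sumt H F (\<lambda>a b. D b (\<lambda>u v. sumt H F (\<lambda>c d. g (sH (\<epsilon> (u * c)) a) (v * d))))"
      by (rule cocycle_D[where s = tscale]) (use gl in simp)
    also have "\<dots> = sumt H F (\<lambda>a b. sumt H F (\<lambda>c d. g a (b * et c * d)))"
      by (simp only: bil_scale[OF g] D_counit_mult(2)[symmetric] sumt_mult_right sumt_bil[OF g] smult_mult_left[symmetric] sumt_swap[of H F])
    also have "\<dots> = sumt H F (\<lambda>a b. g a (b * sumt H F (\<lambda>c d. et c * d)))"
      by (simp only: sumt_mult_left sumt_bil[OF g] mult.assoc)
    also have "\<dots> = sumt H F g"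
      by (simp only: central_et(1)[OF central_F] F_norm_left mult_1_right)
    finally show ?thesis .
  qed
  have 2: "F \<bullet> (u \<otimes> 1) = F"
  proof (rule HH_eqI)
    fix g :: "'h \<Rightarrow> 'h \<Rightarrow> ('h, 'h, 'k) tensor" assume g: "bil tscale g"
    show "sumt H (F \<bullet> (u \<otimes> 1)) g = sumt H F g"
      using 1[OF g] by (simp add: sumt_left[OF F_HH g])
  qed simp_all
  \<comment> \<open>Cancelling \<open>F\<close> leaves an equation relative to \<Delta>(1) only,
    from which id \<otimes> \<epsilon> extracts u = 1.\<close>
  have "e \<bullet> (u \<otimes> 1) = e"
    using arg_cong[OF 2, of "\<lambda>t. G \<bullet> t"] by (simp add: mult2_assoc[symmetric] G_F)
  then have "sumt H (e \<bullet> (u \<otimes> 1)) (\<lambda>a b. sH (\<epsilon> b) a) = D 1 (\<lambda>a b. sH (\<epsilon> b) a)" by simp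
  then have "D 1 (\<lambda>a b. sH (\<epsilon> b) (a * u)) = 1"
    using D_counit_right[OF lin_id[OF vs_H]] by (simp add: sumt_left[where s = sH])
  then show ?thesis
    using D_counit_right[of sH "\<lambda>a. a * u" 1] by (simp add: smult_mult_left u_def)
qed

text \<open>Apply \<epsilon> \<otimes> id to F G = \<Delta>(1). As \<epsilon> need not be
  multiplicative, the leg of \<open>G\<close> under it is first replaced by its image under
  \<open>et\<close>, which crosses to the other leg of \<open>F\<close> and decouples the two
  sums.\<close>

lemma G_norm_left: "sumt H G (\<lambda>a b. sH (\<epsilon> a) b) = 1"
proof -
  have "1 = sumt H F (\<lambda>a b. sumt H G (\<lambda>c d. sH (\<epsilon> (a * c)) (b * d)))"
    by (subst sumt_F_G[where s = sH]) (simp_all add: D_counit_left[OF lin_id[OF vs_H]])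
  also have "\<dots> = sumt H G (\<lambda>c d. sumt H F (\<lambda>a b. sH (\<epsilon> (a * et c)) (b * d)))"
    by (simp only: counit_et) (rule sumt_swap)
  also have "\<dots> = sumt H G (\<lambda>c d. sumt H F (\<lambda>a b. sH (\<epsilon> a) (b * et c * d)))"
    by (subst sumt_B_left(2)[OF central_F, where s = sH]) simp_all
  also have "\<dots> = sumt H G (\<lambda>c d. sumt H F (\<lambda>a b. sH (\<epsilon> a) b) * (et c * d))"
    by (simp only: sumt_mult_right smult_mult_left mult.assoc)
  finally show ?thesis
    by (simp add: F_norm_left central_et)
qed

lemma G_norm_right: "sumt H G (\<lambda>a b. sH (\<epsilon> b) a) = 1"
proof -
  have "1 = sumt H F (\<lambda>a b. sumt H G (\<lambda>c d. sH (\<epsilon> (b * d)) (a * c)))"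
    by (subst sumt_F_G[where s = sH]) (simp_all add: D_counit_right[OF lin_id[OF vs_H]])
  also have "\<dots> = sumt H G (\<lambda>c d. sumt H F (\<lambda>a b. sH (\<epsilon> (b * et d)) (a * c)))"
    by (simp only: counit_et) (rule sumt_swap)
  also have "\<dots> = sumt H G (\<lambda>c d. sumt H F (\<lambda>a b. sH (\<epsilon> b) (a * et d * c)))"
    by (subst sumt_B_left(2)[OF central_F, symmetric, where s = sH]) simp_all
  also have "\<dots> = sumt H G (\<lambda>c d. sumt H F (\<lambda>a b. sH (\<epsilon> b) a) * (et d * c))"
    by (simp only: sumt_mult_right smult_mult_left mult.assoc)
  finally show ?thesis
    by (simp add: F_norm_right central_et)
qed

end

subsection \<open>Words in the cocycle\<close>

text \<open>
  An element of \<open>H \<otimes> \<dots> \<otimes> H\<close> acts on multilinear maps by left multiplication of the arguments; a leg is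
  one of these tensor factors, or several of them reached through iterated comultiplication. Since
  \<open>(T U) \<cdot> f = U \<cdot> (T \<cdot> f)\<close>, products of tensors appear below in reversed order.
\<close>

locale twist_legs = twisting_cocycle H F G
  for H :: "('k::field, 'h::{ring,monoid_mult}) qgroupoid" (structure) and F G :: "('h, 'h, 'k) tensor" +
  fixes M :: "('x \<Rightarrow> 'v::ab_group_add) set" and s :: "'k \<Rightarrow> 'v \<Rightarrow> 'v"
  assumes M_sumt: "(\<And>p q. g p q \<in> M) \<Longrightarrow> (\<lambda>x. sumt H t (\<lambda>p q. g p q x)) \<in> M"
begin

text \<open>The last clause ranges over arbitrary functions, not only over \<open>M\<close>: the
  operators act by substitution in the argument, so sums can be pulled out without membership
  conditions. Membership in \<open>M\<close> supplies linearity in the acting element.\<close>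

definition leg :: "('h \<Rightarrow> ('x \<Rightarrow> 'v) \<Rightarrow> 'x \<Rightarrow> 'v) \<Rightarrow> bool" where
  "leg \<rho> \<longleftrightarrow> (\<forall>a. \<forall>f\<in>M. \<rho> a f \<in> M) \<and> (\<forall>f\<in>M. \<forall>x. lin sH s (\<lambda>a. \<rho> a f x)) \<and>
    (\<forall>a b. \<forall>f\<in>M. \<rho> (a * b) f = \<rho> b (\<rho> a f)) \<and>
    (\<forall>a t g. \<rho> a (\<lambda>x. sumt H t (\<lambda>p q. g p q x)) = (\<lambda>x. sumt H t (\<lambda>p q. \<rho> a (g p q) x)))"

definition commute :: "('h \<Rightarrow> ('x \<Rightarrow> 'v) \<Rightarrow> 'x \<Rightarrow> 'v) \<Rightarrow> ('h \<Rightarrow> ('x \<Rightarrow> 'v) \<Rightarrow> 'x \<Rightarrow> 'v) \<Rightarrow> bool" where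
  "commute \<rho> \<sigma> \<longleftrightarrow> (\<forall>a b. \<forall>f\<in>M. \<rho> a (\<sigma> b f) = \<sigma> b (\<rho> a f))"

text \<open>Spreads the coproduct of the acting element over two legs, so that
  \<open>ap F (\<rho> \<odot> \<sigma>) \<tau>\<close> is the action of (\<Delta> \<otimes> id)
  F.\<close>

definition both (infixr "\<odot>" 75) where
  "(\<rho> \<odot> \<sigma>) a f = (\<lambda>x. D a (\<lambda>p q. \<rho> p (\<sigma> q f) x))"

definition ap where
  "ap T \<rho> \<sigma> f = (\<lambda>x. sumt H T (\<lambda>p q. \<rho> p (\<sigma> q f) x))"

lemma leg_M [simp]: "leg \<rho> \<Longrightarrow> f \<in> M \<Longrightarrow> \<rho> a f \<in> M"
  by (simp add: leg_def)

lemma leg_lin: "leg \<rho> \<Longrightarrow> f \<in> M \<Longrightarrow> lin sH s (\<lambda>a. \<rho> a f x)"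
  by (simp add: leg_def)

lemma leg_mult: "leg \<rho> \<Longrightarrow> f \<in> M \<Longrightarrow> \<rho> (a * b) f = \<rho> b (\<rho> a f)"
  by (simp add: leg_def)

lemma leg_sumt: "leg \<rho> \<Longrightarrow> \<rho> a (\<lambda>x. sumt H t (\<lambda>p q. g p q x)) = (\<lambda>x. sumt H t (\<lambda>p q. \<rho> a (g p q) x))"
  by (simp add: leg_def)

lemma commuteD: "commute \<rho> \<sigma> \<Longrightarrow> f \<in> M \<Longrightarrow> \<rho> a (\<sigma> b f) = \<sigma> b (\<rho> a f)"
  by (simp add: commute_def)

lemma commute_sym: "commute \<rho> \<sigma> \<Longrightarrow> commute \<sigma> \<rho>"
  by (simp add: commute_def)

lemma legs_lin:
  assumes "leg \<rho>" "leg \<sigma>" "commute \<rho> \<sigma>" "f \<in> M"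
  shows "lin sH s (\<lambda>a. \<rho> a (\<sigma> b f) x)" "lin sH s (\<lambda>b. \<rho> a (\<sigma> b f) x)"
proof -
  show "lin sH s (\<lambda>a. \<rho> a (\<sigma> b f) x)" using assms by (simp add: leg_lin)
  show "lin sH s (\<lambda>b. \<rho> a (\<sigma> b f) x)" using assms by (simp add: leg_lin commuteD[OF assms(3)])
qed

lemma legs_bil:
  assumes "leg \<rho>" "leg \<sigma>" "commute \<rho> \<sigma>" "f \<in> M"
  shows "bil s (\<lambda>a b. \<rho> a (\<sigma> b f) x)"
  using legs_lin[OF assms] by simp

lemma legs_tri:
  assumes "leg \<rho>" "leg \<sigma>" "leg \<tau>" "commute \<rho> \<sigma>" "commute \<rho> \<tau>" "commute \<sigma> \<tau>" "f \<in> M"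
  shows "tri s (\<lambda>a b c. \<rho> a (\<sigma> b (\<tau> c f)) x)"
proof -
  have "\<rho> a (\<sigma> b (\<tau> c f)) = \<tau> c (\<rho> a (\<sigma> b f))" for a b c
    using assms by (simp add: commuteD[OF assms(5)] commuteD[OF assms(6)])
  then have "lin sH s (\<lambda>c. \<rho> a (\<sigma> b (\<tau> c f)) x)" for a b
    using assms by (simp add: leg_lin)
  then show ?thesis
    using assms legs_lin[of \<rho> \<sigma> "\<tau> _ f" _ x] by simp
qed

lemma ap_M [simp]: "leg \<rho> \<Longrightarrow> leg \<sigma> \<Longrightarrow> f \<in> M \<Longrightarrow> ap T \<rho> \<sigma> f \<in> M"
  unfolding ap_def by (rule M_sumt) simp

lemma commute_both [simp]:
  assumes "leg \<rho>" "leg \<sigma>" "leg \<tau>" "commute \<rho> \<tau>" "commute \<sigma> \<tau>"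
  shows "commute (\<rho> \<odot> \<sigma>) \<tau>"
  using assms unfolding commute_def[of "_ \<odot> _"] both_def
  by (simp add: leg_sumt[OF assms(3)] commuteD[OF assms(4)] commuteD[OF assms(5)])

lemma commute_both' [simp]:
  assumes "leg \<rho>" "leg \<sigma>" "leg \<tau>" "commute \<tau> \<rho>" "commute \<tau> \<sigma>"
  shows "commute \<tau> (\<rho> \<odot> \<sigma>)"
  using assms unfolding commute_def[of _ "_ \<odot> _"] both_def
  by (simp add: leg_sumt[OF assms(3)] commuteD[OF assms(4)] commuteD[OF assms(5)])

text \<open>Multiplicativity of \<Delta> makes two commuting legs behave as one, so every rule for
  legs applies again to composite ones.\<close>

lemma leg_both [simp]:
  assumes "leg \<rho>" "leg \<sigma>" "commute \<rho> \<sigma>"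
  shows "leg (\<rho> \<odot> \<sigma>)"
  unfolding leg_def
proof (intro conjI allI ballI)
  fix a b x t g f
  show "(\<rho> \<odot> \<sigma>) a (\<lambda>x. sumt H t (\<lambda>p q. g p q x)) = (\<lambda>x. sumt H t (\<lambda>p q. (\<rho> \<odot> \<sigma>) a (g p q) x))"
    unfolding both_def by (simp only: leg_sumt[OF assms(1)] leg_sumt[OF assms(2)]) (rule ext, rule sumt_swap)
  assume f: "f \<in> M"
  show "(\<rho> \<odot> \<sigma>) a f \<in> M" unfolding both_def by (rule M_sumt) (use assms f in simp)
  show "lin sH s (\<lambda>a. (\<rho> \<odot> \<sigma>) a f x)"
    unfolding both_def by (rule lin_D, simp, rule legs_bil) (use assms f in simp_all)
  have "(\<rho> \<odot> \<sigma>) (a * b) f = (\<lambda>x. D a (\<lambda>p q. D b (\<lambda>c d. \<rho> (p * c) (\<sigma> (q * d) f) x)))"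
    unfolding both_def by (rule ext, rule D_mult, rule legs_bil) (use assms f in simp_all)
  also have "\<dots> = (\<lambda>x. D b (\<lambda>c d. D a (\<lambda>p q. \<rho> c (\<sigma> d (\<rho> p (\<sigma> q f))) x)))"
    using assms f by (subst sumt_swap) (simp add: leg_mult[OF assms(1)] leg_mult[OF assms(2)] commuteD[OF assms(3)])
  also have "\<dots> = (\<rho> \<odot> \<sigma>) b ((\<rho> \<odot> \<sigma>) a f)"
    unfolding both_def by (simp only: leg_sumt[OF assms(1)] leg_sumt[OF assms(2)])
  finally show "(\<rho> \<odot> \<sigma>) (a * b) f = (\<rho> \<odot> \<sigma>) b ((\<rho> \<odot> \<sigma>) a f)" .
qed

lemma both_comm:
  assumes "leg \<rho>" "leg \<sigma>" "commute \<rho> \<sigma>" "f \<in> M"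
  shows "(\<rho> \<odot> \<sigma>) a f = (\<sigma> \<odot> \<rho>) a f"
proof
  fix x
  have "(\<rho> \<odot> \<sigma>) a f x = D a (\<lambda>p q. \<rho> q (\<sigma> p f) x)"
    unfolding both_def by (rule D_comm, rule legs_bil) (use assms in simp_all)
  then show "(\<rho> \<odot> \<sigma>) a f x = (\<sigma> \<odot> \<rho>) a f x"
    using assms by (simp add: both_def commuteD[OF assms(3)])
qed

lemma both_assoc:
  assumes "leg \<rho>" "leg \<sigma>" "leg \<tau>" "commute \<rho> \<sigma>" "commute \<rho> \<tau>" "commute \<sigma> \<tau>" "f \<in> M"
  shows "((\<rho> \<odot> \<sigma>) \<odot> \<tau>) a f = (\<rho> \<odot> \<sigma> \<odot> \<tau>) a f"
proof
  fix x
  have "((\<rho> \<odot> \<sigma>) \<odot> \<tau>) a f x = D a (\<lambda>p q. D p (\<lambda>u v. \<rho> u (\<sigma> v (\<tau> q f)) x))"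
    by (simp add: both_def)
  also have "\<dots> = D a (\<lambda>p q. D q (\<lambda>u v. \<rho> p (\<sigma> u (\<tau> v f)) x))"
    by (rule D_coassoc, rule legs_tri) (use assms in simp_all)
  also have "\<dots> = (\<rho> \<odot> \<sigma> \<odot> \<tau>) a f x"
    using assms by (simp add: both_def leg_sumt[OF assms(1)])
  finally show "((\<rho> \<odot> \<sigma>) \<odot> \<tau>) a f x = (\<rho> \<odot> \<sigma> \<odot> \<tau>) a f x" .
qed

lemma ap_ap:
  assumes "leg \<rho>" "leg \<sigma>" "commute \<rho> \<sigma>" "f \<in> M" "T \<in> HH H" "U \<in> HH H"
  shows "ap U \<rho> \<sigma> (ap T \<rho> \<sigma> f) = ap (T \<bullet> U) \<rho> \<sigma> f"
proof
  fix x
  have "ap U \<rho> \<sigma> (ap T \<rho> \<sigma> f) x = sumt H U (\<lambda>c d. sumt H T (\<lambda>p q. \<rho> c (\<sigma> d (\<rho> p (\<sigma> q f))) x))"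
    by (simp only: ap_def leg_sumt[OF assms(1)] leg_sumt[OF assms(2)])
  also have "\<dots> = sumt H T (\<lambda>p q. sumt H U (\<lambda>c d. \<rho> (p * c) (\<sigma> (q * d) f) x))"
    using assms by (subst sumt_swap) (simp add: leg_mult[OF assms(1)] leg_mult[OF assms(2)] commuteD[OF assms(3)])
  also have "\<dots> = ap (T \<bullet> U) \<rho> \<sigma> f x"
    unfolding ap_def by (rule sumt_mult2[symmetric, OF _ _ legs_bil]) (use assms in simp_all)
  finally show "ap U \<rho> \<sigma> (ap T \<rho> \<sigma> f) x = ap (T \<bullet> U) \<rho> \<sigma> f x" .
qed

lemma ap_act:
  assumes "leg \<rho>" "leg \<sigma>" "leg \<tau>" "commute \<tau> \<rho>" "commute \<tau> \<sigma>" "f \<in> M"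
  shows "\<tau> a (ap T \<rho> \<sigma> f) = ap T \<rho> \<sigma> (\<tau> a f)"
  using assms by (simp add: ap_def leg_sumt[OF assms(3)] commuteD[OF assms(4)] commuteD[OF assms(5)])

lemma ap_sumt:
  assumes "leg \<rho>" "leg \<sigma>"
  shows "ap T \<rho> \<sigma> (\<lambda>x. sumt H t (\<lambda>p q. g p q x)) = (\<lambda>x. sumt H t (\<lambda>p q. ap T \<rho> \<sigma> (g p q) x))"
  by (simp only: ap_def leg_sumt[OF assms(1)] leg_sumt[OF assms(2)]) (rule ext, rule sumt_swap)

lemma ap_comm:
  assumes "leg \<rho>" "leg \<sigma>" "leg \<tau>" "leg \<upsilon>" "commute \<rho> \<tau>" "commute \<rho> \<upsilon>" "commute \<sigma> \<tau>" "commute \<sigma> \<upsilon>" "f \<in> M"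
  shows "ap T \<rho> \<sigma> (ap U \<tau> \<upsilon> f) = ap U \<tau> \<upsilon> (ap T \<rho> \<sigma> f)"
proof -
  have "ap T \<rho> \<sigma> (ap U \<tau> \<upsilon> f) = ap T \<rho> \<sigma> (\<lambda>x. sumt H U (\<lambda>p q. \<tau> p (\<upsilon> q f) x))"
    by (simp add: ap_def)
  also have "\<dots> = (\<lambda>x. sumt H U (\<lambda>p q. ap T \<rho> \<sigma> (\<tau> p (\<upsilon> q f)) x))"
    using assms by (intro ap_sumt)
  also have "\<dots> = (\<lambda>x. sumt H U (\<lambda>p q. \<tau> p (\<upsilon> q (ap T \<rho> \<sigma> f)) x))"
    using assms commute_sym by (simp add: ap_act[symmetric])
  also have "\<dots> = ap U \<tau> \<upsilon> (ap T \<rho> \<sigma> f)"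
    by (simp add: ap_def)
  finally show ?thesis .
qed

lemma ap_B:
  assumes T: "central T" and legs: "leg \<rho>" "leg \<sigma>" "commute \<rho> \<sigma>" "f \<in> M" and y: "y \<in> B"
  shows "ap T \<rho> \<sigma> (\<rho> y f) = \<rho> y (ap T \<rho> \<sigma> f)" "ap T \<rho> \<sigma> (\<sigma> y f) = \<sigma> y (ap T \<rho> \<sigma> f)"
    "ap T \<rho> \<sigma> (\<rho> y f) = ap T \<rho> \<sigma> (\<sigma> y f)"
proof -
  have b: "bil s (\<lambda>a b. \<rho> a (\<sigma> b f) x)" for x by (rule legs_bil) (use legs in simp_all)
  note B = sumt_B_left[OF T b y] sumt_B[OF T b y]
  have e: "\<rho> p (\<sigma> q (\<rho> y f)) = \<rho> (y * p) (\<sigma> q f)" "\<rho> y (\<rho> p (\<sigma> q f)) = \<rho> (p * y) (\<sigma> q f)"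
    "\<rho> p (\<sigma> q (\<sigma> y f)) = \<rho> p (\<sigma> (y * q) f)" "\<sigma> y (\<rho> p (\<sigma> q f)) = \<rho> p (\<sigma> (q * y) f)" for p q
    using legs by (simp_all add: leg_mult[OF legs(1)] leg_mult[OF legs(2)] commuteD[OF legs(3)])
  show "ap T \<rho> \<sigma> (\<rho> y f) = \<rho> y (ap T \<rho> \<sigma> f)" "ap T \<rho> \<sigma> (\<sigma> y f) = \<sigma> y (ap T \<rho> \<sigma> f)"
    "ap T \<rho> \<sigma> (\<rho> y f) = ap T \<rho> \<sigma> (\<sigma> y f)"
    unfolding ap_def by (simp_all only: leg_sumt[OF legs(1)] leg_sumt[OF legs(2)] e B)
qed

lemma ap_e_sym:
  assumes "leg \<rho>" "leg \<sigma>" "commute \<rho> \<sigma>" "f \<in> M"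
  shows "ap e \<rho> \<sigma> f = ap e \<sigma> \<rho> f"
proof
  fix x
  have "ap e \<rho> \<sigma> f x = D 1 (\<lambda>p q. \<rho> q (\<sigma> p f) x)"
    unfolding ap_def by (rule D_comm, rule legs_bil) (use assms in simp_all)
  then show "ap e \<rho> \<sigma> f x = ap e \<sigma> \<rho> f x"
    using assms by (simp add: ap_def commuteD[OF assms(3)])
qed

lemma e_both:
  assumes "leg \<rho>" "leg \<sigma>" "commute \<rho> \<sigma>" "f \<in> M"
  shows "ap e \<rho> \<sigma> ((\<rho> \<odot> \<sigma>) a f) = (\<rho> \<odot> \<sigma>) a f" "(\<rho> \<odot> \<sigma>) a (ap e \<rho> \<sigma> f) = (\<rho> \<odot> \<sigma>) a f"
  using leg_mult[OF leg_both[OF assms(1-3)] assms(4), of a 1] leg_mult[OF leg_both[OF assms(1-3)] assms(4), of 1 a]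
  by (simp_all add: ap_def both_def)

text \<open>The two product forms of the threefold unit, read as operators; the last claim is
  coassociativity.\<close>

lemma ap_e_both:
  assumes legs: "leg \<rho>" "leg \<sigma>" "leg \<tau>" "commute \<rho> \<sigma>" "commute \<rho> \<tau>" "commute \<sigma> \<tau>" "f \<in> M"
  shows "ap e (\<rho> \<odot> \<sigma>) \<tau> f = ap e \<rho> \<sigma> (ap e \<sigma> \<tau> f)" "ap e (\<rho> \<odot> \<sigma>) \<tau> f = ap e \<sigma> \<tau> (ap e \<rho> \<sigma> f)"
    "ap e \<rho> (\<sigma> \<odot> \<tau>) f = ap e (\<rho> \<odot> \<sigma>) \<tau> f"
proof -
  have t: "tri s (\<lambda>a b c. \<rho> a (\<sigma> b (\<tau> c f)) x)" for x by (rule legs_tri) (use assms in simp_all)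
  have 1: "ap e (\<rho> \<odot> \<sigma>) \<tau> f x = D 1 (\<lambda>a b. D b (\<lambda>u v. \<rho> a (\<sigma> u (\<tau> v f)) x))" for x
    unfolding ap_def both_def by (rule D_coassoc, rule t)
  then show "ap e \<rho> (\<sigma> \<odot> \<tau>) f = ap e (\<rho> \<odot> \<sigma>) \<tau> f"
    by (intro ext) (simp only: ap_def both_def leg_sumt[OF legs(1)])
  show "ap e (\<rho> \<odot> \<sigma>) \<tau> f = ap e \<rho> \<sigma> (ap e \<sigma> \<tau> f)"
    using legs
    by (intro ext, subst 1, subst D_one_right[OF t])
      (simp add: ap_def leg_sumt[OF legs(1)] leg_sumt[OF legs(2)] leg_mult[OF legs(2)])
  show "ap e (\<rho> \<odot> \<sigma>) \<tau> f = ap e \<sigma> \<tau> (ap e \<rho> \<sigma> f)"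
    using legs
    by (intro ext, subst 1, subst D_one_left[OF t])
      (simp add: ap_def leg_sumt[OF legs(2)] leg_sumt[OF legs(3)] leg_mult[OF legs(2)]
         commuteD[OF legs(4)] commuteD[OF legs(5)] commuteD[OF legs(6)], rule sumt_swap)
qed

text \<open>Flipping the two parts of the composite leg turns the copy of \<Delta>(1) on
  \<open>\<sigma>\<close>, \<open>\<tau>\<close> into one on \<open>\<rho>\<close>,
  \<open>\<tau>\<close>.\<close>

lemma ap_e_both':
  assumes legs: "leg \<rho>" "leg \<sigma>" "leg \<tau>" "commute \<rho> \<sigma>" "commute \<rho> \<tau>" "commute \<sigma> \<tau>" "f \<in> M"
  shows "ap e (\<rho> \<odot> \<sigma>) \<tau> f = ap e \<rho> \<sigma> (ap e \<rho> \<tau> f)" "ap e (\<rho> \<odot> \<sigma>) \<tau> f = ap e \<rho> \<tau> (ap e \<rho> \<sigma> f)"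
proof -
  have "ap e (\<rho> \<odot> \<sigma>) \<tau> f = ap e (\<sigma> \<odot> \<rho>) \<tau> f"
    unfolding ap_def using legs by (simp add: both_comm[OF legs(1,2,4)])
  then show "ap e (\<rho> \<odot> \<sigma>) \<tau> f = ap e \<rho> \<sigma> (ap e \<rho> \<tau> f)" "ap e (\<rho> \<odot> \<sigma>) \<tau> f = ap e \<rho> \<tau> (ap e \<rho> \<sigma> f)"
    using legs ap_e_both(1,2)[of \<sigma> \<rho> \<tau> f] commute_sym ap_e_sym[OF legs(1,2,4)] by simp_all
qed

text \<open>The two operators share the leg \<open>\<rho>\<close>, but \<Delta>(1) has its entries
  in the base, and a base element on \<open>\<rho>\<close> passes through a central
  \<open>T\<close>.\<close>

lemma ap_comm_e:
  assumes T: "central T"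
    and legs: "leg \<rho>" "leg \<sigma>" "leg \<tau>" "commute \<rho> \<sigma>" "commute \<rho> \<tau>" "commute \<sigma> \<tau>" "f \<in> M"
  shows "ap T \<rho> \<sigma> (ap e \<rho> \<tau> f) = ap e \<rho> \<tau> (ap T \<rho> \<sigma> f)"
proof
  fix x
  have b1: "lin sH s (\<lambda>c. ap T \<rho> \<sigma> (\<rho> c (\<tau> d f)) x)" for d
  proof -
    have "lin sH s (\<lambda>c. \<rho> (c * p) (\<sigma> q (\<tau> d f)) x)" for p q
      by (rule lin_compose[where g = "\<lambda>c. \<rho> c _ _"], rule leg_lin) (use legs in simp_all)
    then show ?thesis
      using legs by (simp add: ap_def leg_mult[OF legs(1)] commuteD[OF legs(4)])
  qed
  have b2: "lin sH s (\<lambda>d. ap T \<rho> \<sigma> (\<rho> c (\<tau> d f)) x)" for c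
  proof -
    have "ap T \<rho> \<sigma> (\<rho> c (\<tau> d f)) = \<tau> d (ap T \<rho> \<sigma> (\<rho> c f))" for d
      using legs commute_sym by (simp add: ap_act[of \<rho> \<sigma> \<tau>] commuteD[OF legs(5)])
    then show ?thesis using legs by (simp add: leg_lin)
  qed
  have "ap T \<rho> \<sigma> (ap e \<rho> \<tau> f) x = D 1 (\<lambda>c d. ap T \<rho> \<sigma> (\<rho> c (\<tau> d f)) x)"
    unfolding ap_def[of e] by (subst ap_sumt) (use legs in simp_all)
  also have "\<dots> = D 1 (\<lambda>c d. \<rho> c (\<tau> d (ap T \<rho> \<sigma> f)) x)"
  proof (rule D_one_B)
    show "bil s (\<lambda>c d. ap T \<rho> \<sigma> (\<rho> c (\<tau> d f)) x)" using b1 b2 by simp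
    show "bil s (\<lambda>c d. \<rho> c (\<tau> d (ap T \<rho> \<sigma> f)) x)" by (rule legs_bil) (use legs in simp_all)
    show "ap T \<rho> \<sigma> (\<rho> c (\<tau> d f)) x = \<rho> c (\<tau> d (ap T \<rho> \<sigma> f)) x" if "c \<in> B" "d \<in> B" for c d
      using ap_B(1)[OF T legs(1,2,4) _ that(1), of "\<tau> d f"] legs commute_sym by (simp add: ap_act[of \<rho> \<sigma> \<tau>])
  qed
  also have "\<dots> = ap e \<rho> \<tau> (ap T \<rho> \<sigma> f) x"
    by (simp add: ap_def[of e])
  finally show "ap T \<rho> \<sigma> (ap e \<rho> \<tau> f) x = ap e \<rho> \<tau> (ap T \<rho> \<sigma> f) x" .
qed

lemma ap_F_G:
  assumes "leg \<rho>" "leg \<sigma>" "commute \<rho> \<sigma>" "f \<in> M"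
  shows "ap G \<rho> \<sigma> (ap F \<rho> \<sigma> f) = ap e \<rho> \<sigma> f" "ap F \<rho> \<sigma> (ap G \<rho> \<sigma> f) = ap e \<rho> \<sigma> f"
  using ap_ap[OF assms F_HH G_HH] ap_ap[OF assms G_HH F_HH] by (simp_all add: F_G G_F)

lemma ap_e_absorb:
  assumes "leg \<rho>" "leg \<sigma>" "commute \<rho> \<sigma>" "f \<in> M" "central T"
  shows "ap e \<rho> \<sigma> (ap T \<rho> \<sigma> f) = ap T \<rho> \<sigma> f" "ap T \<rho> \<sigma> (ap e \<rho> \<sigma> f) = ap T \<rho> \<sigma> f"
  using ap_ap[OF assms(1-4), of T e] ap_ap[OF assms(1-4), of e T] assms(5) by (simp_all add: central_def)

text \<open>A composite leg contains a coproduct, which absorbs \<Delta>(1).\<close>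

lemma ap_both_absorb:
  assumes legs: "leg \<rho>" "leg \<sigma>" "leg \<tau>" "commute \<rho> \<sigma>" "commute \<rho> \<tau>" "commute \<sigma> \<tau>" "f \<in> M"
  shows "ap e \<rho> \<sigma> (ap T (\<rho> \<odot> \<sigma>) \<tau> f) = ap T (\<rho> \<odot> \<sigma>) \<tau> f" "ap e \<sigma> \<tau> (ap T \<rho> (\<sigma> \<odot> \<tau>) f) = ap T \<rho> (\<sigma> \<odot> \<tau>) f"
proof -
  have "ap e \<rho> \<sigma> (ap T (\<rho> \<odot> \<sigma>) \<tau> f) = (\<lambda>x. sumt H T (\<lambda>a b. ap e \<rho> \<sigma> ((\<rho> \<odot> \<sigma>) a (\<tau> b f)) x))"
    unfolding ap_def[of T] by (rule ap_sumt) (use legs in simp_all)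
  also have "\<dots> = ap T (\<rho> \<odot> \<sigma>) \<tau> f"
    unfolding ap_def[of T] using legs by (simp add: e_both[OF legs(1,2,4)])
  finally show "ap e \<rho> \<sigma> (ap T (\<rho> \<odot> \<sigma>) \<tau> f) = ap T (\<rho> \<odot> \<sigma>) \<tau> f" .
  have "ap e \<sigma> \<tau> (ap T \<rho> (\<sigma> \<odot> \<tau>) f) = (\<lambda>x. sumt H T (\<lambda>a b. ap e \<sigma> \<tau> (\<rho> a ((\<sigma> \<odot> \<tau>) b f)) x))"
    unfolding ap_def[of T] by (rule ap_sumt) (use legs in simp_all)
  also have "\<dots> = (\<lambda>x. sumt H T (\<lambda>a b. \<rho> a (ap e \<sigma> \<tau> ((\<sigma> \<odot> \<tau>) b f)) x))"
    using legs by (simp add: ap_act[of \<sigma> \<tau> \<rho>])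
  also have "\<dots> = ap T \<rho> (\<sigma> \<odot> \<tau>) f"
    unfolding ap_def[of T] using legs by (simp add: e_both[OF legs(2,3,6)])
  finally show "ap e \<sigma> \<tau> (ap T \<rho> (\<sigma> \<odot> \<tau>) f) = ap T \<rho> (\<sigma> \<odot> \<tau>) f" .
qed

lemma ap_cocycle:
  assumes legs: "leg \<rho>" "leg \<sigma>" "leg \<tau>" "commute \<rho> \<sigma>" "commute \<rho> \<tau>" "commute \<sigma> \<tau>" "f \<in> M"
  shows "ap F \<rho> \<sigma> (ap F (\<rho> \<odot> \<sigma>) \<tau> f) = ap F \<sigma> \<tau> (ap F \<rho> (\<sigma> \<odot> \<tau>) f)"
proof
  fix x
  note c = commuteD[OF legs(4)] commuteD[OF legs(5)] commuteD[OF legs(6)]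
  have "ap F \<rho> \<sigma> (ap F (\<rho> \<odot> \<sigma>) \<tau> f) x =
     sumt H F (\<lambda>c d. sumt H F (\<lambda>a b. D a (\<lambda>u v. \<rho> (u * c) (\<sigma> (v * d) (\<tau> b f)) x)))"
    using legs by (simp add: ap_def both_def leg_sumt[OF legs(1)] leg_sumt[OF legs(2)] leg_mult[OF legs(1)] leg_mult[OF legs(2)] c)
  also have "\<dots> = sumt H F (\<lambda>a b. D a (\<lambda>u v. sumt H F (\<lambda>c d. \<rho> (u * c) (\<sigma> (v * d) (\<tau> b f)) x)))"
    by (subst sumt_swap) (intro arg_cong[where f = "sumt H F"] ext sumt_swap)
  also have "\<dots> = sumt H F (\<lambda>a b. D b (\<lambda>u v. sumt H F (\<lambda>c d. \<rho> a (\<sigma> (u * c) (\<tau> (v * d) f)) x)))"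
    by (rule cocycle_D, rule legs_tri) (use legs in simp_all)
  also have "\<dots> = sumt H F (\<lambda>c d. sumt H F (\<lambda>a b. D b (\<lambda>u v. \<rho> a (\<sigma> (u * c) (\<tau> (v * d) f)) x)))"
    by (subst (2) sumt_swap) (intro arg_cong[where f = "sumt H F"] ext sumt_swap)
  also have "\<dots> = ap F \<sigma> \<tau> (ap F \<rho> (\<sigma> \<odot> \<tau>) f) x"
    using legs by (simp add: ap_def both_def leg_sumt[OF legs(1)] leg_sumt[OF legs(2)] leg_sumt[OF legs(3)]
        leg_mult[OF legs(2)] leg_mult[OF legs(3)] c)
  finally show "ap F \<rho> \<sigma> (ap F (\<rho> \<odot> \<sigma>) \<tau> f) x = ap F \<sigma> \<tau> (ap F \<rho> (\<sigma> \<odot> \<tau>) f) x" .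
qed

text \<open>Both sides are inverse to the two expressions of the cocycle identity.\<close>

lemma ap_inverse_cocycle:
  assumes legs: "leg \<rho>" "leg \<sigma>" "leg \<tau>" "commute \<rho> \<sigma>" "commute \<rho> \<tau>" "commute \<sigma> \<tau>" "f \<in> M"
  shows "ap G (\<rho> \<odot> \<sigma>) \<tau> (ap G \<rho> \<sigma> f) = ap G \<rho> (\<sigma> \<odot> \<tau>) (ap G \<sigma> \<tau> f)"
proof -
  \<comment> \<open>\<open>E\<close> is the threefold unit and \<open>X\<close> the cocycle word.
    Relative to \<open>E\<close>, \<open>Z\<close> is a left and \<open>Y\<close> a right inverse of
    \<open>X\<close>, so that as operators Y = E Y = Z X Y = Z E = Z.\<close>
  define X where "X f = ap F \<rho> \<sigma> (ap F (\<rho> \<odot> \<sigma>) \<tau> f)" for f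
  define Y where "Y f = ap G (\<rho> \<odot> \<sigma>) \<tau> (ap G \<rho> \<sigma> f)" for f
  define Z where "Z f = ap G \<rho> (\<sigma> \<odot> \<tau>) (ap G \<sigma> \<tau> f)" for f
  define E where "E f = ap e (\<rho> \<odot> \<sigma>) \<tau> f" for f
  have E: "E g = ap e \<rho> \<tau> (ap e \<rho> \<sigma> g)" "E g = ap e \<sigma> \<tau> (ap e \<rho> \<sigma> g)" "E g = ap e \<rho> (\<sigma> \<odot> \<tau>) g" if "g \<in> M" for g
    using ap_e_both[OF legs(1-6) that] ap_e_both'[OF legs(1-6) that] by (simp_all add: E_def)
  have YM: "Y f \<in> M" using legs by (simp add: Y_def)
  have ZX: "Z (X g) = E g" if g: "g \<in> M" for g
  proof -
    have "Z (X g) = ap G \<rho> (\<sigma> \<odot> \<tau>) (ap e \<sigma> \<tau> (ap F \<rho> (\<sigma> \<odot> \<tau>) g))"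
      unfolding X_def Z_def ap_cocycle[OF legs(1-6) g] using legs g by (simp add: ap_F_G)
    then show ?thesis
      using legs g by (simp add: ap_both_absorb ap_F_G E(3))
  qed
  have XY: "X (Y f) = E f"
  proof -
    have "X (Y f) = ap F \<rho> \<sigma> (ap e (\<rho> \<odot> \<sigma>) \<tau> (ap G \<rho> \<sigma> f))"
      unfolding X_def Y_def using legs by (simp add: ap_F_G)
    also have "\<dots> = ap F \<rho> \<sigma> (ap e \<rho> \<tau> (ap e \<rho> \<sigma> (ap G \<rho> \<sigma> f)))"
      using E(1)[of "ap G \<rho> \<sigma> f"] legs by (simp add: E_def)
    also have "\<dots> = ap e \<rho> \<tau> (ap F \<rho> \<sigma> (ap G \<rho> \<sigma> f))"
      using legs by (simp add: ap_e_absorb ap_comm_e)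
    also have "\<dots> = E f"
      using legs by (simp add: ap_F_G E(1))
    finally show ?thesis .
  qed
  have "Y f = E (Y f)"
    unfolding Y_def E_def using legs by (simp add: ap_e_absorb)
  also have "\<dots> = Z (E f)"
    using ZX[OF YM] XY by simp
  \<comment> \<open>It remains that \<open>Z\<close> absorbs \<open>E\<close>. One factor of
    \<open>E\<close> is taken up by \<open>G\<close> on \<open>\<sigma>\<close>,
    \<open>\<tau>\<close>; the other is moved past it and is taken up by the outer \<open>G\<close>
    as part of the full threefold unit.\<close>
  also have "\<dots> = ap G \<rho> (\<sigma> \<odot> \<tau>) (ap G \<sigma> \<tau> (ap e \<rho> \<sigma> f))"
    unfolding Z_def E(2)[OF legs(7)] using legs by (simp add: ap_e_absorb)
  also have "\<dots> = ap G \<rho> (\<sigma> \<odot> \<tau>) (ap e \<rho> \<sigma> (ap G \<sigma> \<tau> f))"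
  proof -
    have "ap G \<sigma> \<tau> (ap e \<sigma> \<rho> f) = ap e \<sigma> \<rho> (ap G \<sigma> \<tau> f)"
      by (rule ap_comm_e) (use legs commute_sym in simp_all)
    then show ?thesis using legs ap_e_sym[of \<rho> \<sigma>] by simp
  qed
  also have "\<dots> = Z f"
  proof -
    define g where "g = ap G \<sigma> \<tau> f"
    have g: "g \<in> M" using legs by (simp add: g_def)
    have "ap G \<rho> (\<sigma> \<odot> \<tau>) (ap e \<rho> \<sigma> g) = ap G \<rho> (\<sigma> \<odot> \<tau>) (E (ap e \<rho> \<sigma> g))"
      using E(3)[of "ap e \<rho> \<sigma> g"] legs g by (simp add: ap_e_absorb)
    also have "E (ap e \<rho> \<sigma> g) = E g"
      using legs g by (simp add: E(2) ap_e_absorb)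
    also have "ap G \<rho> (\<sigma> \<odot> \<tau>) (E g) = ap G \<rho> (\<sigma> \<odot> \<tau>) g"
      using legs g by (simp add: E(3) ap_e_absorb)
    finally show ?thesis by (simp add: Z_def g_def)
  qed
  finally show ?thesis by (simp add: Y_def Z_def)
qed

lemma both_left_comm:
  assumes legs: "leg \<rho>" "leg \<sigma>" "leg \<tau>" "commute \<rho> \<sigma>" "commute \<rho> \<tau>" "commute \<sigma> \<tau>" "f \<in> M"
  shows "(\<sigma> \<odot> \<rho> \<odot> \<tau>) a f = (\<rho> \<odot> \<sigma> \<odot> \<tau>) a f"
proof -
  have "(\<sigma> \<odot> \<rho> \<odot> \<tau>) a f = ((\<sigma> \<odot> \<rho>) \<odot> \<tau>) a f"
    by (rule both_assoc[symmetric]) (use legs commute_sym in simp_all)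
  also have "\<dots> = ((\<rho> \<odot> \<sigma>) \<odot> \<tau>) a f"
    unfolding both_def[of "_ \<odot> _"] using legs by (simp add: both_comm[OF legs(1,2,4)])
  also have "\<dots> = (\<rho> \<odot> \<sigma> \<odot> \<tau>) a f"
    by (rule both_assoc) (use legs in simp_all)
  finally show ?thesis .
qed

text \<open>Two applications of the cocycle identity, the first with the last two legs
  joined.\<close>

lemma ap_cocycle4:
  assumes legs: "leg \<rho>" "leg \<sigma>" "leg \<tau>" "leg \<upsilon>" "commute \<rho> \<sigma>" "commute \<rho> \<tau>" "commute \<rho> \<upsilon>"
    "commute \<sigma> \<tau>" "commute \<sigma> \<upsilon>" "commute \<tau> \<upsilon>" "f \<in> M"
  shows "ap F \<tau> \<upsilon> (ap F \<rho> \<sigma> (ap F (\<rho> \<odot> \<sigma>) (\<tau> \<odot> \<upsilon>) f)) =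
    ap F \<sigma> \<tau> (ap F (\<sigma> \<odot> \<tau>) \<upsilon> (ap F \<rho> (\<sigma> \<odot> \<tau> \<odot> \<upsilon>) f))"
  using legs by (simp add: ap_cocycle[of \<rho> \<sigma> "\<tau> \<odot> \<upsilon>"] ap_cocycle[of \<sigma> \<tau> \<upsilon>])

text \<open>
  The two ways to multiply out \<open>F\<close> over four legs differ by the order of the middle legs, hence by the
  braiding \<open>F\<^sup>-\<^sup>1 F\<^sub>2\<^sub>1\<close> of these legs.
\<close>

lemma ap_middle_braid:
  assumes legs: "leg \<rho>" "leg \<sigma>" "leg \<tau>" "leg \<upsilon>" "commute \<rho> \<sigma>" "commute \<rho> \<tau>" "commute \<rho> \<upsilon>"
    "commute \<sigma> \<tau>" "commute \<sigma> \<upsilon>" "commute \<tau> \<upsilon>" "f \<in> M"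
  shows "ap F (\<rho> \<odot> \<tau>) (\<sigma> \<odot> \<upsilon>) (ap G (\<rho> \<odot> \<sigma>) (\<tau> \<odot> \<upsilon>) f) =
    ap G \<sigma> \<upsilon> (ap G \<rho> \<tau> (ap F \<tau> \<sigma> (ap G \<sigma> \<tau> (ap F \<tau> \<upsilon> (ap F \<rho> \<sigma> f)))))"
proof -
  note [simp] = legs commute_sym[OF legs(5)] commute_sym[OF legs(6)] commute_sym[OF legs(7)]
    commute_sym[OF legs(8)] commute_sym[OF legs(9)] commute_sym[OF legs(10)]
  define g where "g = ap G (\<rho> \<odot> \<sigma>) (\<tau> \<odot> \<upsilon>) f"
  \<comment> \<open>\<open>W\<close> collects the factors that do not see the order of the two
    middle legs.\<close>
  define W where "W = ap F (\<sigma> \<odot> \<tau>) \<upsilon> (ap F \<rho> (\<sigma> \<odot> \<tau> \<odot> \<upsilon>) g)"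
  define k where "k = ap F (\<rho> \<odot> \<tau>) (\<sigma> \<odot> \<upsilon>) g"
  define h where "h = ap F \<tau> \<upsilon> (ap F \<rho> \<sigma> f)"
  have M [simp]: "g \<in> M" "W \<in> M" "k \<in> M" "h \<in> M" by (simp_all add: g_def W_def k_def h_def)
  have W1: "ap F \<tau> \<upsilon> (ap F \<rho> \<sigma> (ap F (\<rho> \<odot> \<sigma>) (\<tau> \<odot> \<upsilon>) g)) = ap F \<sigma> \<tau> W"
    unfolding W_def by (rule ap_cocycle4) simp_all
  \<comment> \<open>The expansion with \<open>\<sigma>\<close> and \<open>\<tau>\<close> exchanged;
    commutativity of composite legs shows that its inner factors are \<open>W\<close> again.\<close>
  have W2: "ap F \<sigma> \<upsilon> (ap F \<rho> \<tau> k) = ap F \<tau> \<sigma> W"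
  proof -
    have "ap F \<rho> (\<tau> \<odot> \<sigma> \<odot> \<upsilon>) g = ap F \<rho> (\<sigma> \<odot> \<tau> \<odot> \<upsilon>) g"
      unfolding ap_def by (simp add: both_left_comm[of \<sigma> \<tau> \<upsilon>])
    moreover have "ap F (\<tau> \<odot> \<sigma>) \<upsilon> g' = ap F (\<sigma> \<odot> \<tau>) \<upsilon> g'" if "g' \<in> M" for g'
      unfolding ap_def using that by (simp add: both_comm[of \<tau> \<sigma>])
    ultimately show ?thesis
      unfolding W_def k_def by (subst ap_cocycle4) simp_all
  qed
  \<comment> \<open>In this factorisation of the fourfold unit two factors are absorbed by the
    copies of \<open>F\<close> on \<open>\<rho>\<close>, \<open>\<sigma>\<close> and on
    \<open>\<tau>\<close>, \<open>\<upsilon>\<close>; the third is traded below for \<Delta>(1) on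
    \<open>\<sigma>\<close>, \<open>\<tau>\<close>, which \<open>G\<close> absorbs.\<close>
  have e: "ap e (\<rho> \<odot> \<sigma>) (\<tau> \<odot> \<upsilon>) f = ap e \<rho> \<sigma> (ap e \<tau> \<upsilon> (ap e \<rho> \<tau> f))"
    by (simp add: ap_e_both'(1)[of \<rho> \<sigma> "\<tau> \<odot> \<upsilon>"] ap_e_both(3)[of \<rho> \<tau> \<upsilon>] ap_e_both(2)[of \<rho> \<tau> \<upsilon>])
  have "ap F \<tau> \<upsilon> (ap F \<rho> \<sigma> (ap e (\<rho> \<odot> \<sigma>) (\<tau> \<odot> \<upsilon>) f)) = ap F \<tau> \<upsilon> (ap F \<rho> \<sigma> (ap e \<tau> \<upsilon> (ap e \<rho> \<tau> f)))"
    unfolding e by (simp add: ap_e_absorb)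
  also have "\<dots> = ap F \<tau> \<upsilon> (ap e \<tau> \<upsilon> (ap F \<rho> \<sigma> (ap e \<rho> \<tau> f)))"
    by (simp add: ap_comm[of \<rho> \<sigma> \<tau> \<upsilon>])
  also have "\<dots> = ap F \<tau> \<upsilon> (ap e \<rho> \<tau> (ap F \<rho> \<sigma> f))"
    by (simp add: ap_e_absorb ap_comm_e)
  also have "\<dots> = ap e \<rho> \<tau> h"
    using ap_comm_e[of F \<tau> \<upsilon> \<rho> "ap F \<rho> \<sigma> f"] by (simp add: h_def ap_e_sym[of \<rho> \<tau>])
  finally have 1: "ap F \<tau> \<upsilon> (ap F \<rho> \<sigma> (ap e (\<rho> \<odot> \<sigma>) (\<tau> \<odot> \<upsilon>) f)) = ap e \<rho> \<tau> h" .
  have h: "ap e \<rho> \<sigma> h = h"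
    unfolding h_def by (simp add: ap_comm[of \<rho> \<sigma> \<tau> \<upsilon>] ap_e_absorb)
  have "ap e \<rho> \<tau> (ap e \<rho> \<sigma> h) = ap e \<sigma> \<tau> (ap e \<rho> \<sigma> h)"
    using ap_e_both(2)[of \<rho> \<sigma> \<tau> h] ap_e_both'(2)[of \<rho> \<sigma> \<tau> h] by simp
  then have 2: "ap e \<rho> \<tau> h = ap e \<sigma> \<tau> h"
    unfolding h .
  have "ap G \<sigma> \<tau> h = ap G \<sigma> \<tau> (ap F \<tau> \<upsilon> (ap F \<rho> \<sigma> (ap e (\<rho> \<odot> \<sigma>) (\<tau> \<odot> \<upsilon>) f)))"
    unfolding 1 2 by (simp add: ap_e_absorb)
  also have "ap e (\<rho> \<odot> \<sigma>) (\<tau> \<odot> \<upsilon>) f = ap F (\<rho> \<odot> \<sigma>) (\<tau> \<odot> \<upsilon>) g"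
    unfolding g_def by (simp add: ap_F_G)
  also have "ap G \<sigma> \<tau> (ap F \<tau> \<upsilon> (ap F \<rho> \<sigma> (ap F (\<rho> \<odot> \<sigma>) (\<tau> \<odot> \<upsilon>) g))) = ap e \<sigma> \<tau> W"
    unfolding W1 by (simp add: ap_F_G)
  finally have 3: "ap F \<tau> \<sigma> (ap G \<sigma> \<tau> h) = ap F \<sigma> \<upsilon> (ap F \<rho> \<tau> k)"
    unfolding W2 by (simp add: ap_e_sym[of \<sigma> \<tau>] ap_e_absorb)
  have "ap G \<sigma> \<upsilon> (ap G \<rho> \<tau> (ap F \<sigma> \<upsilon> (ap F \<rho> \<tau> k))) = ap e \<sigma> \<upsilon> (ap e \<rho> \<tau> k)"
    by (simp add: ap_comm[of \<rho> \<tau> \<sigma> \<upsilon>] ap_F_G)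
  also have "\<dots> = k"
    unfolding k_def by (simp add: ap_both_absorb)
  finally show ?thesis
    unfolding 3[symmetric] by (simp add: k_def g_def h_def)
qed

end

section \<open>Sweedler form of the inverse cocycle identity and of the braiding of middle
  legs\<close>

context twisting_cocycle
begin

text \<open>An instance of the calculus of legs: \<open>M\<close> consists of the trilinear
  functions of a triple, each leg multiplies one coordinate from the left, and evaluation at (1, 1,
  1) gives back Sweedler sums.\<close>

lemma inverse_cocycle_D:
  fixes f :: "'h \<Rightarrow> 'h \<Rightarrow> 'h \<Rightarrow> 'v::ab_group_add"
  assumes f: "tri s f"
  shows "sumt H G (\<lambda>a b. D a (\<lambda>u v. sumt H G (\<lambda>c d. f (c * u) (d * v) b))) =
    sumt H G (\<lambda>a b. D b (\<lambda>u v. sumt H G (\<lambda>c d. f a (c * u) (d * v))))"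
proof -
  define M :: "('h \<times> 'h \<times> 'h \<Rightarrow> 'v) set" where "M = {f. tri s (\<lambda>a b c. f (a, b, c))}"
  interpret L: twist_legs H F G M s
    by unfold_locales (simp add: M_def)
  define l1 where "l1 a f = (\<lambda>(x, y, z). f (a * x, y, z))" for a :: 'h and f :: "'h \<times> 'h \<times> 'h \<Rightarrow> 'v"
  define l2 where "l2 a f = (\<lambda>(x, y, z). f (x, a * y, z))" for a :: 'h and f :: "'h \<times> 'h \<times> 'h \<Rightarrow> 'v"
  define l3 where "l3 a f = (\<lambda>(x, y, z). f (x, y, a * z))" for a :: 'h and f :: "'h \<times> 'h \<times> 'h \<Rightarrow> 'v"
  note l = l1_def l2_def l3_def
  have Ml: "l1 a f \<in> M" "l2 a f \<in> M" "l3 a f \<in> M"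
    "lin sH s (\<lambda>a. l1 a f x)" "lin sH s (\<lambda>a. l2 a f x)" "lin sH s (\<lambda>a. l3 a f x)" if "f \<in> M" for a f x
  proof -
    have f: "tri s (\<lambda>a b c. f (a, b, c))" using that by (simp add: M_def)
    note [simp] = tri_comp[OF f]
    show "l1 a f \<in> M" "l2 a f \<in> M" "l3 a f \<in> M"
      using f by (simp_all add: M_def l)
    show "lin sH s (\<lambda>a. l1 a f x)" "lin sH s (\<lambda>a. l2 a f x)" "lin sH s (\<lambda>a. l3 a f x)"
      by (cases x; simp add: l)+
  qed
  have legs: "L.leg l1" "L.leg l2" "L.leg l3"
    unfolding L.leg_def using Ml by (auto simp: l mult.assoc fun_eq_iff)
  have comm: "L.commute l1 l2" "L.commute l1 l3" "L.commute l2 l3"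
    unfolding L.commute_def by (auto simp: l fun_eq_iff)
  have "case_prod (\<lambda>x. case_prod (f x)) \<in> M"
    using f by (simp add: M_def)
  from fun_cong[OF L.ap_inverse_cocycle[OF legs comm this], of "(1, 1, 1)"] show ?thesis
    by (simp add: L.ap_def L.both_def l)
qed

text \<open>The same device on quadruples. On the right the pair \<open>c\<close>, \<open>d\<close>
  from \<open>F\<close> and \<open>r\<close>, \<open>t\<close> from the inverse is the braiding of
  the second and third coordinate.\<close>

lemma middle_braid_D:
  fixes f :: "'h \<Rightarrow> 'h \<Rightarrow> 'h \<Rightarrow> 'h \<Rightarrow> 'v::ab_group_add"
  assumes f: "quad s f"
  shows "sumt H F (\<lambda>a b. D a (\<lambda>a1 a2. D b (\<lambda>b1 b2. sumt H G (\<lambda>c d. D c (\<lambda>c1 c2. D d (\<lambda>d1 d2.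
      f (c1 * a1) (c2 * b1) (d1 * a2) (d2 * b2))))))) =
    sumt H G (\<lambda>i j. sumt H G (\<lambda>g h. sumt H F (\<lambda>c d. sumt H G (\<lambda>r t. sumt H F (\<lambda>m n. sumt H F (\<lambda>x y.
      f (x * g) (y * (r * (d * i))) (m * (t * (c * h))) (n * j)))))))"
proof -
  define M :: "('h \<times> 'h \<times> 'h \<times> 'h \<Rightarrow> 'v) set" where "M = {f. quad s (\<lambda>a b c d. f (a, b, c, d))}"
  interpret L: twist_legs H F G M s
    by unfold_locales (simp add: M_def)
  define l1 where "l1 a f = (\<lambda>(x, y, z, w). f (a * x, y, z, w))" for a :: 'h and f :: "'h \<times> 'h \<times> 'h \<times> 'h \<Rightarrow> 'v"
  define l2 where "l2 a f = (\<lambda>(x, y, z, w). f (x, a * y, z, w))" for a :: 'h and f :: "'h \<times> 'h \<times> 'h \<times> 'h \<Rightarrow> 'v"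
  define l3 where "l3 a f = (\<lambda>(x, y, z, w). f (x, y, a * z, w))" for a :: 'h and f :: "'h \<times> 'h \<times> 'h \<times> 'h \<Rightarrow> 'v"
  define l4 where "l4 a f = (\<lambda>(x, y, z, w). f (x, y, z, a * w))" for a :: 'h and f :: "'h \<times> 'h \<times> 'h \<times> 'h \<Rightarrow> 'v"
  note l = l1_def l2_def l3_def l4_def
  have Ml: "l1 a f \<in> M" "l2 a f \<in> M" "l3 a f \<in> M" "l4 a f \<in> M"
    "lin sH s (\<lambda>a. l1 a f x)" "lin sH s (\<lambda>a. l2 a f x)" "lin sH s (\<lambda>a. l3 a f x)" "lin sH s (\<lambda>a. l4 a f x)"
    if "f \<in> M" for a f x
  proof -
    have f: "quad s (\<lambda>a b c d. f (a, b, c, d))" using that by (simp add: M_def)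
    note [simp] = quad_comp[OF f]
    show "l1 a f \<in> M" "l2 a f \<in> M" "l3 a f \<in> M" "l4 a f \<in> M"
      using f by (simp_all add: M_def l)
    show "lin sH s (\<lambda>a. l1 a f x)" "lin sH s (\<lambda>a. l2 a f x)" "lin sH s (\<lambda>a. l3 a f x)" "lin sH s (\<lambda>a. l4 a f x)"
      by (cases x; simp add: l)+
  qed
  have legs: "L.leg l1" "L.leg l2" "L.leg l3" "L.leg l4"
    unfolding L.leg_def using Ml by (auto simp: l mult.assoc fun_eq_iff)
  have comm: "L.commute l1 l2" "L.commute l1 l3" "L.commute l1 l4" "L.commute l2 l3" "L.commute l2 l4" "L.commute l3 l4"
    unfolding L.commute_def by (auto simp: l fun_eq_iff)
  have "case_prod (\<lambda>x. case_prod (\<lambda>y. case_prod (f x y))) \<in> M"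
    using f by (simp add: M_def)
  from fun_cong[OF L.ap_middle_braid[OF legs comm this], of "(1, 1, 1, 1)"] show ?thesis
    by (simp add: L.ap_def L.both_def l)
qed

section \<open>Modules and their twisted tensor products\<close>

sublocale twisted_modules H F G .

abbreviation "hmod M \<equiv> is_hmod H M"

lemma hmodD:
  assumes "hmod M"
  shows "vector_space (msc M)" "module.subspace (msc M) (carr M)" "m \<in> carr M \<Longrightarrow> act M h m \<in> carr M"
    "m \<in> carr M \<Longrightarrow> n \<in> carr M \<Longrightarrow> act M h (m + n) = act M h m + act M h n"
    "m \<in> carr M \<Longrightarrow> act M h (msc M c m) = msc M c (act M h m)"
    "m \<in> carr M \<Longrightarrow> act M (g * h) m = act M g (act M h m)" "m \<in> carr M \<Longrightarrow> act M 1 m = m"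
    "m \<in> carr M \<Longrightarrow> n \<in> carr M \<Longrightarrow> m + n \<in> carr M" "m \<in> carr M \<Longrightarrow> msc M c m \<in> carr M" "0 \<in> carr M"
proof -
  show 1: "vector_space (msc M)" "module.subspace (msc M) (carr M)" using assms by (simp_all add: is_hmod_def)
  show "m \<in> carr M \<Longrightarrow> act M h m \<in> carr M"
    "m \<in> carr M \<Longrightarrow> n \<in> carr M \<Longrightarrow> act M h (m + n) = act M h m + act M h n"
    "m \<in> carr M \<Longrightarrow> act M h (msc M c m) = msc M c (act M h m)"
    "m \<in> carr M \<Longrightarrow> act M (g * h) m = act M g (act M h m)" "m \<in> carr M \<Longrightarrow> act M 1 m = m"
    using assms by (simp_all add: is_hmod_def)
  interpret vector_space "msc M" by fact
  show "m \<in> carr M \<Longrightarrow> n \<in> carr M \<Longrightarrow> m + n \<in> carr M" "m \<in> carr M \<Longrightarrow> msc M c m \<in> carr M" "0 \<in> carr M"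
    using 1(2) by (simp_all add: subspace_add subspace_scale subspace_0)
qed

lemma lin_act: "hmod M \<Longrightarrow> m \<in> carr M \<Longrightarrow> lin s sH g \<Longrightarrow> lin s (msc M) (\<lambda>x. act M (g x) m)"
proof -
  assume "hmod M" "m \<in> carr M" and g: "lin s sH g"
  then have "lin sH (msc M) (\<lambda>h. act M h m)"
    by (simp add: Vector_Spaces.linear_iff is_hmod_def)
  then show ?thesis using g by (rule lin_compose)
qed

definition bilinear_on where
  "bilinear_on M N s f \<longleftrightarrow> vector_space s \<and>
    (\<forall>m\<in>carr M. \<forall>m'\<in>carr M. \<forall>n\<in>carr N. f (m + m') n = f m n + f m' n) \<and>
    (\<forall>m\<in>carr M. \<forall>n\<in>carr N. \<forall>n'\<in>carr N. f m (n + n') = f m n + f m n') \<and>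
    (\<forall>c. \<forall>m\<in>carr M. \<forall>n\<in>carr N. f (msc M c m) n = s c (f m n) \<and> f m (msc N c n) = s c (f m n))"

text \<open>Maps out of \<open>M \<otimes>\<^sub>t N\<close> are the bilinear maps balanced over the base.\<close>

definition base_balanced where
  "base_balanced M N s f \<longleftrightarrow> bilinear_on M N s f \<and>
    (\<forall>y\<in>B. \<forall>m\<in>carr M. \<forall>n\<in>carr N. f (act M y m) n = f m (act N y n))"

lemma bilinear_onD:
  assumes "bilinear_on M N s f"
  shows "vector_space s" "m \<in> carr M \<Longrightarrow> m' \<in> carr M \<Longrightarrow> n \<in> carr N \<Longrightarrow> f (m + m') n = f m n + f m' n"
    "m \<in> carr M \<Longrightarrow> n \<in> carr N \<Longrightarrow> n' \<in> carr N \<Longrightarrow> f m (n + n') = f m n + f m n'"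
    "m \<in> carr M \<Longrightarrow> n \<in> carr N \<Longrightarrow> f (msc M c m) n = s c (f m n)"
    "m \<in> carr M \<Longrightarrow> n \<in> carr N \<Longrightarrow> f m (msc N c n) = s c (f m n)"
  using assms by (simp_all add: bilinear_on_def)

lemma bilinear_on_balanced:
  assumes "hmod M" "hmod N" "bilinear_on M N s f"
  shows "balanced (msc M) (msc N) (carr M) (carr N) f"
  unfolding balanced_def using hmodD(1,2)[OF assms(1)] hmodD(1,2)[OF assms(2)] bilinear_onD[OF assms(3)] by simp

lemma bilinear_on_lin:
  assumes f: "bilinear_on M N s f"
  shows "lin sA (msc M) g \<Longrightarrow> (\<And>x. g x \<in> carr M) \<Longrightarrow> n \<in> carr N \<Longrightarrow> lin sA s (\<lambda>x. f (g x) n)"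
    "lin sA (msc N) k \<Longrightarrow> (\<And>x. k x \<in> carr N) \<Longrightarrow> m \<in> carr M \<Longrightarrow> lin sA s (\<lambda>x. f m (k x))"
  using bilinear_onD[OF f] by (simp_all add: Vector_Spaces.linear_iff)

lemma bilinear_on_act:
  assumes f: "bilinear_on M N s f" and M: "hmod M" "hmod N"
  shows "lin sA sH g \<Longrightarrow> m \<in> carr M \<Longrightarrow> n \<in> carr N \<Longrightarrow> lin sA s (\<lambda>x. f (act M (g x) m) n)"
    "lin sA sH g \<Longrightarrow> m \<in> carr M \<Longrightarrow> n \<in> carr N \<Longrightarrow> lin sA s (\<lambda>x. f m (act N (g x) n))"
proof -
  show "lin sA s (\<lambda>x. f (act M (g x) m) n)" if "lin sA sH g" "m \<in> carr M" "n \<in> carr N"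
    by (rule bilinear_on_lin(1)[OF f]) (use that hmodD(3)[OF M(1)] lin_act[OF M(1)] in simp_all)
  show "lin sA s (\<lambda>x. f m (act N (g x) n))" if "lin sA sH g" "m \<in> carr M" "n \<in> carr N"
    by (rule bilinear_on_lin(2)[OF f]) (use that hmodD(3)[OF M(2)] lin_act[OF M(2)] in simp_all)
qed

lemma bilinear_on_sumt:
  assumes f: "bilinear_on M N s f" and M: "hmod M" "hmod N"
  shows "(\<And>p q. g p q \<in> carr M) \<Longrightarrow> n \<in> carr N \<Longrightarrow> f (sumt H t g) n = sumt H t (\<lambda>p q. f (g p q) n)"
    "(\<And>p q. k p q \<in> carr N) \<Longrightarrow> m \<in> carr M \<Longrightarrow> f m (sumt H t k) = sumt H t (\<lambda>p q. f m (k p q))"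
proof -
  show "f (sumt H t g) n = sumt H t (\<lambda>p q. f (g p q) n)" if "\<And>p q. g p q \<in> carr M" "n \<in> carr N"
    by (rule sumt_additive_on[where A = "carr M" and g = "\<lambda>m. f m n"])
      (use that bilinear_onD[OF f] hmodD[OF M(1)] in simp_all)
  show "f m (sumt H t k) = sumt H t (\<lambda>p q. f m (k p q))" if "\<And>p q. k p q \<in> carr N" "m \<in> carr M"
    by (rule sumt_additive_on[where A = "carr N" and g = "f m"])
      (use that bilinear_onD[OF f] hmodD[OF M(2)] in simp_all)
qed

lemma carr_sumt: "hmod M \<Longrightarrow> (\<And>p q. g p q \<in> carr M) \<Longrightarrow> sumt H t g \<in> carr M"
  using sumt_in_subspace[OF hmodD(1,2)] by blast

text \<open>Balancedness moves the first leg of \<Delta>(1) to the second argument, where it meets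
  the other leg, and the product of the legs is 1. Balanced maps therefore do not notice the
  projection by \<Delta>(1).\<close>

lemma base_balanced_one:
  assumes f: "base_balanced M N s f" and M: "hmod M" "hmod N" and mn: "m \<in> carr M" "n \<in> carr N"
  shows "D 1 (\<lambda>a b. f (act M a m) (act N b n)) = f m n"
proof -
  have b: "bilinear_on M N s f" using f by (simp add: base_balanced_def)
  note [simp] = hmodD(3)[OF M(1)] hmodD(3,7)[OF M(2)] bilinear_on_act[OF b M]
  have "D 1 (\<lambda>a b. f (act M a m) (act N b n)) = D 1 (\<lambda>a b. f m (act N (a * b) n))"
  proof (rule D_one_B[where s = s])
    show "f (act M x m) (act N y n) = f m (act N (x * y) n)" if "x \<in> B" for x y
      using f mn that by (simp add: base_balanced_def hmodD(6)[OF M(2)])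
  qed (use mn in simp_all)
  also have "\<dots> = f m (act N (D 1 (\<lambda>a b. a * b)) n)"
    by (rule sumt_lin[symmetric, where g = "\<lambda>a. f m (act N a n)" and sA = sH and sB = s]) (use mn in simp)
  also have "\<dots> = f m n" using mn by (simp add: D_one_mult)
  finally show ?thesis .
qed

section \<open>The tensor product over the base and the maps out of it\<close>

abbreviation "tt \<equiv> tens_t H"

lemma bilinear_on_tens: "hmod M \<Longrightarrow> hmod N \<Longrightarrow> bilinear_on M N tscale (tens (msc M) (msc N))"
proof -
  assume M: "hmod M" "hmod N"
  note l = lin_tens_left[OF lin_id[OF hmodD(1)[OF M(1)]] hmodD(1)[OF M(2)]]
    lin_tens_right[OF lin_id[OF hmodD(1)[OF M(2)]] hmodD(1)[OF M(1)]]
  show ?thesis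
    unfolding bilinear_on_def by (simp add: linD(1,2)[OF l(1)] linD(1,2)[OF l(2)])
qed

lemma tt_eq:
  assumes M: "hmod M" "hmod N" and "m \<in> carr M" "n \<in> carr N"
  shows "tt M N m n = D 1 (\<lambda>a b. tens (msc M) (msc N) (act M a m) (act N b n))"
  unfolding tens_t_def
  by (intro sw_sumt[where s = tscale])
    (simp_all add: bilinear_on_act[OF bilinear_on_tens[OF M] M] assms hmodD(3)[OF M(1)] hmodD(3)[OF M(2)])

lemma base_balanced_tt:
  assumes M: "hmod M" "hmod N"
  shows "base_balanced M N tscale (tt M N)"
proof -
  note [simp] = tt_eq[OF M] hmodD(3-5,8,9)[OF M(1)] hmodD(3-5,8,9)[OF M(2)] bilinear_on_act[OF bilinear_on_tens[OF M] M]
    bilinear_onD[OF bilinear_on_tens[OF M]]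
  have b: "bil tscale (\<lambda>a b. tens (msc M) (msc N) (act M a m) (act N b n))" if "m \<in> carr M" "n \<in> carr N" for m n
    using that by simp
  have "tt M N (act M y m) n = tt M N m (act N y n)" if "y \<in> B" "m \<in> carr M" "n \<in> carr N" for y m n
  proof -
    have "tt M N (act M y m) n = D 1 (\<lambda>a b. tens (msc M) (msc N) (act M (a * y) m) (act N b n))"
      using that by (simp add: hmodD(6)[OF M(1)])
    also have "\<dots> = D 1 (\<lambda>a b. tens (msc M) (msc N) (act M a m) (act N (b * y) n))"
      by (rule trans[OF D_B_left(2)[OF b, symmetric] D_B_right(2)[OF b]]) (use that in simp_all)
    also have "\<dots> = tt M N m (act N y n)"
      using that by (simp add: hmodD(6)[OF M(2)])
    finally show ?thesis .
  qed
  then show ?thesis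
    unfolding base_balanced_def bilinear_on_def by (simp add: sumt_add tscale_sumt del: tt_eq[OF M]) (simp add: sumt_add tscale_sumt)
qed

lemma tt_bilinear: "hmod M \<Longrightarrow> hmod N \<Longrightarrow> bilinear_on M N tscale (tt M N)"
  using base_balanced_tt by (auto simp: base_balanced_def)

lemma tt_B: "hmod M \<Longrightarrow> hmod N \<Longrightarrow> y \<in> B \<Longrightarrow> m \<in> carr M \<Longrightarrow> n \<in> carr N \<Longrightarrow> tt M N (act M y m) n = tt M N m (act N y n)"
  using base_balanced_tt[of M N] by (auto simp: base_balanced_def)

lemma tt_zero: "hmod M \<Longrightarrow> hmod N \<Longrightarrow> tt M N 0 0 = 0"
  using bilinear_onD(2)[OF tt_bilinear, of M N 0 0 0] hmodD(10)[of M] hmodD(10)[of N] by simp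

abbreviation "tsp M N \<equiv> tensor_space (msc M) (msc N) (carr M) (carr N)"
abbreviation "lft M N \<equiv> lift_along (tens (msc M) (msc N)) (carr M) (carr N)"

lemma tt_tsp:
  assumes M: "hmod M" "hmod N" and mn: "m \<in> carr M" "n \<in> carr N"
  shows "tt M N m n \<in> tsp M N"
  unfolding tt_eq[OF assms] by (rule sumt_in_tensor_space) (simp add: tens_in_tensor_space hmodD(3)[OF M(1)] hmodD(3)[OF M(2)] mn)

lemma lft_tt:
  assumes f: "base_balanced M N s f" and M: "hmod M" "hmod N" and mn: "m \<in> carr M" "n \<in> carr N"
  shows "lft M N f (tt M N m n) = f m n"
proof -
  have b: "balanced (msc M) (msc N) (carr M) (carr N) f"
    using f M bilinear_on_balanced by (auto simp: base_balanced_def)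
  have "lft M N f (tt M N m n) = D 1 (\<lambda>p q. lft M N f (tens (msc M) (msc N) (act M p m) (act N q n)))"
    unfolding tt_eq[OF M mn]
    by (rule sumt_additive_on[where A = "tsp M N"])
      (simp_all add: tensor_space_add tensor_space_zero lift_along_add[OF b] tens_in_tensor_space
        hmodD(3)[OF M(1)] hmodD(3)[OF M(2)] mn)
  also have "\<dots> = f m n"
    using base_balanced_one[OF f M mn] by (simp add: lift_along_pure[OF b] hmodD(3)[OF M(1)] hmodD(3)[OF M(2)] mn)
  finally show ?thesis .
qed

lemma carr_t_span:
  assumes M: "hmod M" "hmod N"
  shows "carr_t H M N = module.span tscale {tt M N m n |m n. m \<in> carr M \<and> n \<in> carr N}" (is "_ = module.span _ ?X")
proof -
  interpret vector_space "tscale :: 'k \<Rightarrow> ('c, 'd, 'k) tensor \<Rightarrow> _" by simp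
  have b: "balanced (msc M) (msc N) (carr M) (carr N) (tt M N)"
    by (rule bilinear_on_balanced[OF M tt_bilinear[OF M]])
  show ?thesis
  proof (intro equalityI subsetI)
    fix x assume "x \<in> carr_t H M N"
    then obtain t where t: "t \<in> tsp M N" "x = lft M N (tt M N) t" by (auto simp: carr_t_def)
    from hmodD(1)[OF M(1)] hmodD(1)[OF M(2)] hmodD(2)[OF M(1)] t(1) have "lft M N (tt M N) t \<in> span ?X"
    proof (induction rule: tensor_space_induct)
      case (tens m n)
      then show ?case by (auto simp: lift_along_pure[OF b] intro: span_base)
    qed (simp_all add: lift_along_zero[OF b] lift_along_add[OF b] span_zero span_add)
    then show "x \<in> span ?X" using t by simp
  next
    fix x assume "x \<in> span ?X"
    then show "x \<in> carr_t H M N"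
    proof (induction rule: span_induct_alt)
      case base
      show ?case unfolding carr_t_def
        by (rule image_eqI[of _ _ 0]) (simp_all add: lift_along_zero[OF b] tensor_space_zero)
    next
      case (step c x y)
      then obtain m n t where x: "x = tt M N m n" "m \<in> carr M" "n \<in> carr N" and y: "y = lft M N (tt M N) t" "t \<in> tsp M N"
        by (auto simp: carr_t_def)
      have T: "tens (msc M) (msc N) (msc M c m) n \<in> tsp M N"
        using x hmodD(9)[OF M(1)] by (simp add: tens_in_tensor_space)
      have "tscale c x + y = lft M N (tt M N) (tens (msc M) (msc N) (msc M c m) n + t)"
        using x y hmodD(9)[OF M(1)] bilinear_onD(4)[OF tt_bilinear[OF M]]
        by (simp add: lift_along_add[OF b T] lift_along_pure[OF b])
      then show ?case unfolding carr_t_def using y T tensor_space_add by blast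
    qed
  qed
qed

lemma carr_t_subspace: "hmod M \<Longrightarrow> hmod N \<Longrightarrow> module.subspace tscale (carr_t H M N)"
  unfolding carr_t_span by (rule module.subspace_span) (simp add: module_iff_vector_space)

lemma tt_carr_t: "hmod M \<Longrightarrow> hmod N \<Longrightarrow> m \<in> carr M \<Longrightarrow> n \<in> carr N \<Longrightarrow> tt M N m n \<in> carr_t H M N"
  unfolding carr_t_span by (rule module.span_base) (auto simp: module_iff_vector_space)

lemma carr_t_add: "hmod M \<Longrightarrow> hmod N \<Longrightarrow> s \<in> carr_t H M N \<Longrightarrow> t \<in> carr_t H M N \<Longrightarrow> s + t \<in> carr_t H M N"
  using module.subspace_add[OF _ carr_t_subspace] by (simp add: module_iff_vector_space)

text \<open>Zero and scalar multiples of generators are generators again, so only sums remain as a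
  further case.\<close>

lemma carr_t_induct [consumes 3, case_names tens add]:
  assumes M: "hmod M" "hmod N" and t: "t \<in> carr_t H M N"
    and P: "\<And>m n. m \<in> carr M \<Longrightarrow> n \<in> carr N \<Longrightarrow> P (tt M N m n)"
    "\<And>s t. s \<in> carr_t H M N \<Longrightarrow> t \<in> carr_t H M N \<Longrightarrow> P s \<Longrightarrow> P t \<Longrightarrow> P (s + t)"
  shows "P t"
proof -
  interpret vector_space "tscale :: 'k \<Rightarrow> ('c, 'd, 'k) tensor \<Rightarrow> _" by simp
  have "P t \<and> t \<in> carr_t H M N"
    using t[unfolded carr_t_span[OF M]]
  proof (induction rule: span_induct_alt)
    case base
    have "tt M N 0 0 = 0" "0 \<in> carr M" "0 \<in> carr N" using tt_zero[OF M] hmodD(10)[OF M(1)] hmodD(10)[OF M(2)] by auto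
    then show ?case using P(1)[of 0 0] tt_carr_t[OF M, of 0 0] by simp
  next
    case (step c x y)
    then obtain m n where x: "x = tt M N m n" "m \<in> carr M" "n \<in> carr N" by auto
    then have "tscale c x = tt M N (msc M c m) n" "msc M c m \<in> carr M"
      using bilinear_onD(4)[OF tt_bilinear[OF M]] hmodD(9)[OF M(1)] by auto
    then show ?case using step x P tt_carr_t[OF M] carr_t_add[OF M] by auto
  qed
  then show ?thesis ..
qed

lemma carr_t_tsp:
  assumes M: "hmod M" "hmod N" and t: "t \<in> carr_t H M N"
  shows "t \<in> tsp M N"
  using M t by (induction rule: carr_t_induct) (simp_all add: tt_tsp[OF M] tensor_space_add)

text \<open>An expansion in terms of \<open>tt\<close> is a sum in the full tensor product, where
  \<open>lft\<close> is well defined and gives the same value by \<open>lft_tt\<close>. So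
  \<open>lift_t\<close> is the restriction of the ordinary induced map.\<close>

lemma lift_t_eq:
  assumes f: "base_balanced M N s f" and M: "hmod M" "hmod N" and t: "t \<in> carr_t H M N"
  shows "lift_t H M N f t = lft M N f t"
proof -
  have b: "balanced (msc M) (msc N) (carr M) (carr N) f"
    using f M bilinear_on_balanced by (auto simp: base_balanced_def)
  have *: "(\<Sum>i<n. f (a i) (b i)) = lft M N f (\<Sum>i<n. tt M N (a i) (b i))"
    if "\<forall>i<n. a i \<in> carr M \<and> b i \<in> carr N" for n :: nat and a b
  proof -
    have "k \<le> n \<Longrightarrow> (\<Sum>i<k. f (a i) (b i)) = lft M N f (\<Sum>i<k. tt M N (a i) (b i))" for k
    proof (induction k)
      case (Suc k)
      then have "(\<Sum>i<k. tt M N (a i) (b i)) \<in> tsp M N"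
        using that by (intro tensor_space_sum) (simp add: tt_tsp[OF M])
      then show ?case
        using Suc that by (simp add: lift_along_add[OF b] tt_tsp[OF M] lft_tt[OF f M])
    qed (simp add: lift_along_zero[OF b])
    then show ?thesis by simp
  qed
  have "\<exists>(n::nat) a b. (\<forall>i<n. a i \<in> carr M \<and> b i \<in> carr N) \<and> t = (\<Sum>i<n. tt M N (a i) (b i))"
    using M t
  proof (induction rule: carr_t_induct)
    case (tens m n)
    then show ?case by (intro exI[of _ 1] exI[of _ "\<lambda>_. m"] exI[of _ "\<lambda>_. n"]) simp
  next
    case (add s t)
    then obtain n a b n' a' b' where 1: "\<forall>i<n::nat. a i \<in> carr M \<and> b i \<in> carr N" "s = (\<Sum>i<n. tt M N (a i) (b i))"
      and 2: "\<forall>i<n'::nat. a' i \<in> carr M \<and> b' i \<in> carr N" "t = (\<Sum>i<n'. tt M N (a' i) (b' i))" by blast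
    show ?case
      by (rule exI[of _ "n + n'"], rule exI[of _ "\<lambda>i. if i < n then a i else a' (i - n)"],
          rule exI[of _ "\<lambda>i. if i < n then b i else b' (i - n)"])
        (use 1 2 in \<open>auto simp: sum_append[symmetric] intro!: sum.cong\<close>)
  qed
  then obtain n :: nat and a b where ab: "\<forall>i<n. a i \<in> carr M \<and> b i \<in> carr N" "t = (\<Sum>i<n. tt M N (a i) (b i))" by blast
  show ?thesis
    unfolding lift_t_def lift_along_def[of "tt M N"]
  proof (rule some_equality)
    show "\<exists>(n::nat) a b'. (\<forall>i<n. a i \<in> carr M \<and> b' i \<in> carr N) \<and> t = (\<Sum>i<n. tt M N (a i) (b' i)) \<and>
      lft M N f t = (\<Sum>i<n. f (a i) (b' i))"
      using ab *[OF ab(1)] by (intro exI[of _ n] exI[of _ a] exI[of _ b]) simp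
  next
    fix y
    assume "\<exists>(n::nat) a b'. (\<forall>i<n. a i \<in> carr M \<and> b' i \<in> carr N) \<and> t = (\<Sum>i<n. tt M N (a i) (b' i)) \<and>
      y = (\<Sum>i<n. f (a i) (b' i))"
    then show "y = lft M N f t" using * by blast
  qed
qed

lemma lift_t_tt:
  assumes f: "base_balanced M N s f" and M: "hmod M" "hmod N" and mn: "m \<in> carr M" "n \<in> carr N"
  shows "lift_t H M N f (tt M N m n) = f m n"
  using lift_t_eq[OF f M tt_carr_t[OF M mn]] lft_tt[OF assms] by simp

lemma lift_t_add:
  assumes f: "base_balanced M N s f" and M: "hmod M" "hmod N" and t: "t \<in> carr_t H M N" "u \<in> carr_t H M N"
  shows "lift_t H M N f (t + u) = lift_t H M N f t + lift_t H M N f u"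
proof -
  have b: "balanced (msc M) (msc N) (carr M) (carr N) f"
    using f M bilinear_on_balanced by (auto simp: base_balanced_def)
  show ?thesis
    using lift_t_eq[OF f M] t carr_t_add[OF M t] lift_along_add[OF b carr_t_tsp[OF M] carr_t_tsp[OF M]] by simp
qed

lemma lift_t_scale:
  assumes f: "base_balanced M N s f" and M: "hmod M" "hmod N" and t: "t \<in> carr_t H M N"
  shows "lift_t H M N f (tscale c t) = s c (lift_t H M N f t)"
proof -
  interpret vector_space s using f by (simp add: base_balanced_def bilinear_on_def)
  have sc: "tscale c t \<in> carr_t H M N" if "t \<in> carr_t H M N" for t
    using module.subspace_scale[OF _ carr_t_subspace[OF M] that] by (simp add: module_iff_vector_space)
  have f': "bilinear_on M N s f" using f by (simp add: base_balanced_def)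
  show ?thesis
    using M t
  proof (induction rule: carr_t_induct)
    case (tens m n)
    then have "tscale c (tt M N m n) = tt M N (msc M c m) n"
      using bilinear_onD(4)[OF tt_bilinear[OF M]] by simp
    then show ?case using tens hmodD(9)[OF M(1)] bilinear_onD(4)[OF f'] by (simp add: lift_t_tt[OF f M])
  next
    case (add t u)
    have "tscale c (t + u) = tscale c t + tscale c u"
      by (rule vector_space.vector_space_assms(1)) simp
    then show ?case using add by (simp add: lift_t_add[OF f M] sc scale_right_distrib)
  qed
qed

subsection \<open>The module \<open>M \<otimes>\<^sub>t N\<close>\<close>

lemma tensor_obj_simps [simp]:
  "carr (M \<boxtimes> N) = carr_t H M N" "msc (M \<boxtimes> N) = tscale"
  by (simp_all add: tensor_obj_def)

text \<open>The coproduct twisted by the cocycle, through which H acts on M \<otimes>_t N.\<close>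

definition twist where "twist h = G \<bullet> comult H h \<bullet> F"

lemma twist_HH [simp]: "twist h \<in> HH H"
  by (simp add: twist_def)

lemma twist_e: "twist h \<bullet> e = twist h"
  by (simp add: twist_def mult2_assoc F_e)

text \<open>The inner factor \<open>F \<bullet> G\<close> is \<Delta>(1), which the neighbouring
  coproducts absorb.\<close>

lemma twist_mult: "twist g \<bullet> twist h = twist (g * h)"
proof -
  have "twist g \<bullet> twist h = G \<bullet> comult H g \<bullet> (F \<bullet> G) \<bullet> comult H h \<bullet> F"
    by (simp add: twist_def mult2_assoc)
  also have "\<dots> = twist (g * 1 * h)"
    by (simp only: F_G twist_def comult_mult mult2_assoc comult_HH F_HH G_HH mult2_HH)
  finally show ?thesis by simp
qed

lemma twist_1: "twist 1 = e"
  by (simp add: twist_def G_e G_F)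

lemma comult_B: "y \<in> B \<Longrightarrow> comult H y = (y \<otimes> 1) \<bullet> e"
  by (rule HH_eqI) (simp_all add: sumt_left[where s = tscale] D_B_left(1)[where s = tscale])

text \<open>The crossing rule for the inverse carries \<open>y\<close> out to the left, after which
  the cocycle cancels. Consequently the base acts on M \<otimes>_t N through either factor, as if
  there were no twist.\<close>

lemma twist_B:
  assumes y: "y \<in> B"
  shows "twist y = (1 \<otimes> y) \<bullet> e"
proof -
  have "twist y = (G \<bullet> (y \<otimes> 1)) \<bullet> F"
    unfolding twist_def comult_B[OF y] by (simp add: mult2_assoc e_F)
  also have "\<dots> = (1 \<otimes> y) \<bullet> (G \<bullet> F)"
    using inverse_t[OF y] by (simp add: mult2_assoc)
  finally show ?thesis by (simp add: G_F)
qed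

lemma lin_twist: "lin sH tscale twist"
proof -
  have "twist (x + y) = twist x + twist y" for x y
    by (simp add: twist_def linD(1)[OF comult_linear] mult2_add_left mult2_add_right)
  moreover have "twist (sH c x) = tscale c (twist x)" for c x
    by (simp add: twist_def linD(2)[OF comult_linear] mult2_scale_left mult2_scale_right)
  ultimately show ?thesis
    by (simp add: Vector_Spaces.linear_iff)
qed

lemma lift_t_cong:
  assumes "\<And>m n. m \<in> carr M \<Longrightarrow> n \<in> carr N \<Longrightarrow> f m n = g m n"
  shows "lift_t H M N f t = lift_t H M N g t"
  unfolding lift_t_def using assms by (rule lift_along_cong)

definition tact where
  "tact M N T m n = sumt H T (\<lambda>a b. tt M N (act M a m) (act N b n))"

lemma tt_bil:
  assumes "hmod M" "hmod N" "m \<in> carr M" "n \<in> carr N"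
  shows "bil tscale (\<lambda>a b. tt M N (act M a m) (act N b n))"
  by (simp add: bilinear_on_act[OF tt_bilinear[OF assms(1,2)] assms(1,2)] assms
    hmodD(3)[OF assms(1)] hmodD(3)[OF assms(2)])

lemma act_tensor_eq:
  assumes M: "hmod M" "hmod N"
  shows "act (M \<boxtimes> N) h t = lift_t H M N (tact M N (twist h)) t"
proof -
  have "act (M \<boxtimes> N) h t = lift_t H M N (\<lambda>m n. sw H (\<lambda>a b. tt M N (act M a m) (act N b n)) (twist h)) t"
    by (simp add: tensor_obj_def twist_def)
  also have "\<dots> = lift_t H M N (tact M N (twist h)) t"
    unfolding tact_def by (rule lift_t_cong) (rule sw_sumt[OF twist_HH tt_bil[OF M]])
  finally show ?thesis .
qed

lemma tact_balanced:
  assumes M: "hmod M" "hmod N"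
  shows "base_balanced M N tscale (tact M N (twist h))"
proof -
  note t = bilinear_onD[OF tt_bilinear[OF M]]
  have "bilinear_on M N tscale (tact M N (twist h))"
    unfolding bilinear_on_def tact_def
    by (auto simp: t hmodD[OF M(1)] hmodD[OF M(2)] sumt_add tscale_sumt)
  moreover have "tact M N (twist h) (act M y m) n = tact M N (twist h) m (act N y n)"
    if "y \<in> B" "m \<in> carr M" "n \<in> carr N" for y m n
    using sumt_B_right[OF twist_HH twist_e tt_bil[OF M that(2,3)] that(1)] that
    by (simp add: tact_def hmodD(6)[OF M(1)] hmodD(6)[OF M(2)])
  ultimately show ?thesis by (simp add: base_balanced_def)
qed

lemma act_tt:
  assumes M: "hmod M" "hmod N" and mn: "m \<in> carr M" "n \<in> carr N"
  shows "act (M \<boxtimes> N) h (tt M N m n) = tact M N (twist h) m n"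
  by (simp add: act_tensor_eq[OF M] lift_t_tt[OF tact_balanced[OF M] M mn])

lemma act_tensor_add:
  assumes M: "hmod M" "hmod N" and t: "t \<in> carr_t H M N" "u \<in> carr_t H M N"
  shows "act (M \<boxtimes> N) h (t + u) = act (M \<boxtimes> N) h t + act (M \<boxtimes> N) h u"
  by (simp add: act_tensor_eq[OF M] lift_t_add[OF tact_balanced[OF M] M t])

lemma carr_t_sumt: "hmod M \<Longrightarrow> hmod N \<Longrightarrow> (\<And>p q. g p q \<in> carr_t H M N) \<Longrightarrow> sumt H t g \<in> carr_t H M N"
  using sumt_in_subspace[OF _ carr_t_subspace] by (metis vs_tscale)

lemma carr_t_zero: "hmod M \<Longrightarrow> hmod N \<Longrightarrow> 0 \<in> carr_t H M N"
  using tt_carr_t[of M N 0 0] tt_zero[of M N] hmodD(10)[of M] hmodD(10)[of N] by simp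

lemma tact_carr:
  assumes M: "hmod M" "hmod N" and mn: "m \<in> carr M" "n \<in> carr N"
  shows "tact M N T m n \<in> carr_t H M N"
  unfolding tact_def by (rule carr_t_sumt[OF M]) (simp add: tt_carr_t[OF M] hmodD(3)[OF M(1)] hmodD(3)[OF M(2)] mn)

lemma act_tensor_carr:
  assumes M: "hmod M" "hmod N" and t: "t \<in> carr_t H M N"
  shows "act (M \<boxtimes> N) h t \<in> carr_t H M N"
  using M t by (induction rule: carr_t_induct)
    (simp_all add: act_tt[OF M] tact_carr[OF M] act_tensor_add[OF M] carr_t_add[OF M])

lemma act_tact:
  assumes M: "hmod M" "hmod N" and T: "T \<in> HH H" and mn: "m \<in> carr M" "n \<in> carr N"
  shows "act (M \<boxtimes> N) h (tact M N T m n) = tact M N (twist h \<bullet> T) m n"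
proof -
  have "act (M \<boxtimes> N) h (tact M N T m n) = sumt H T (\<lambda>a b. act (M \<boxtimes> N) h (tt M N (act M a m) (act N b n)))"
    unfolding tact_def
    by (rule sumt_additive_on[where A = "carr_t H M N" and g = "act (M \<boxtimes> N) h"])
      (simp_all add: act_tensor_add[OF M] carr_t_add[OF M] carr_t_zero[OF M] tt_carr_t[OF M] hmodD(3)[OF M(1)] hmodD(3)[OF M(2)] mn)
  also have "\<dots> = sumt H (twist h) (\<lambda>c d. sumt H T (\<lambda>a b. tt M N (act M (c * a) m) (act N (d * b) n)))"
    by (simp add: act_tt[OF M] hmodD(3)[OF M(1)] hmodD(3)[OF M(2)] mn tact_def hmodD(6)[OF M(1)] hmodD(6)[OF M(2)])
      (rule sumt_swap)
  also have "\<dots> = tact M N (twist h \<bullet> T) m n"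
    unfolding tact_def by (rule sumt_mult2[OF twist_HH T tt_bil[OF M mn], symmetric])
  finally show ?thesis .
qed

lemma hmod_tensor [simp]:
  assumes M: "hmod M" "hmod N"
  shows "hmod (M \<boxtimes> N)"
proof -
  have l: "lin sH tscale (\<lambda>h. tact M N (twist h) m n)" if "m \<in> carr M" "n \<in> carr N" for m n
    unfolding tact_def using tt_bil[OF M that] by (intro lin_sumt_tensor[OF lin_twist]) simp_all
  interpret V: vector_space "tscale :: 'k \<Rightarrow> ('c, 'd, 'k) tensor \<Rightarrow> _" by simp
  have add: "act (M \<boxtimes> N) (g + h) t = act (M \<boxtimes> N) g t + act (M \<boxtimes> N) h t" if "t \<in> carr_t H M N" for g h t
    using M that by (induction rule: carr_t_induct)
      (simp_all add: act_tt[OF M] linD(1)[OF l] act_tensor_add[OF M])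
  have scale: "act (M \<boxtimes> N) (sH c h) t = tscale c (act (M \<boxtimes> N) h t)" if "t \<in> carr_t H M N" for c h t
    using M that by (induction rule: carr_t_induct)
      (simp_all add: act_tt[OF M] linD(2)[OF l] act_tensor_add[OF M] V.scale_right_distrib)
  have mult: "act (M \<boxtimes> N) (g * h) t = act (M \<boxtimes> N) g (act (M \<boxtimes> N) h t)" if "t \<in> carr_t H M N" for g h t
    using M that by (induction rule: carr_t_induct)
      (simp_all add: act_tt[OF M] act_tact[OF M] twist_mult act_tensor_add[OF M] act_tensor_carr[OF M])
  have one: "act (M \<boxtimes> N) 1 t = t" if "t \<in> carr_t H M N" for t
    using M that by (induction rule: carr_t_induct)
      (simp_all add: act_tt[OF M] act_tensor_add[OF M] twist_1 tact_def base_balanced_one[OF base_balanced_tt[OF M] M])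
  show ?thesis
    unfolding is_hmod_def
    by (simp add: carr_t_subspace[OF M] add scale mult one act_tensor_carr[OF M] act_tensor_add[OF M])
      (simp add: act_tensor_eq[OF M] lift_t_scale[OF tact_balanced[OF M] M])
qed

lemma act_B_tt:
  assumes M: "hmod M" "hmod N" and mn: "m \<in> carr M" "n \<in> carr N" and y: "y \<in> B"
  shows "act (M \<boxtimes> N) y (tt M N m n) = tt M N (act M y m) n" "act (M \<boxtimes> N) y (tt M N m n) = tt M N m (act N y n)"
proof -
  have b: "bil tscale (\<lambda>a b. tt M N (act M a m) (act N b n))" by (rule tt_bil[OF M mn])
  have yn: "act N y n \<in> carr N" using hmodD(3)[OF M(2) mn(2)] .
  have "act (M \<boxtimes> N) y (tt M N m n) = D 1 (\<lambda>a b. tt M N (act M a m) (act N (y * b) n))"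
    unfolding act_tt[OF M mn] tact_def twist_B[OF y] by (simp add: sumt_left[OF _ b])
  also have "\<dots> = D 1 (\<lambda>a b. tt M N (act M a m) (act N (b * y) n))"
    using D_B_right[OF b y] by simp
  also have "\<dots> = tt M N m (act N y n)"
    using base_balanced_one[OF base_balanced_tt[OF M] M mn(1) yn] by (simp add: hmodD(6)[OF M(2)] mn)
  finally show "act (M \<boxtimes> N) y (tt M N m n) = tt M N m (act N y n)" .
  then show "act (M \<boxtimes> N) y (tt M N m n) = tt M N (act M y m) n"
    using tt_B[OF M y mn] by simp
qed

subsection \<open>Maps linear over the base\<close>

text \<open>Linearity over the base is what a tensor product of maps requires in order to be well
  defined, and it can be checked on generators. Associators, braiding and their composites are
  treated at this level; \<open>is_hom\<close> is established for the structure maps of the Hopf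
  algebra.\<close>

definition bhom where
  "bhom M N f \<longleftrightarrow> (\<forall>m\<in>carr M. f m \<in> carr N) \<and> (\<forall>m\<in>carr M. \<forall>n\<in>carr M. f (m + n) = f m + f n) \<and>
    (\<forall>c. \<forall>m\<in>carr M. f (msc M c m) = msc N c (f m)) \<and> (\<forall>y\<in>B. \<forall>m\<in>carr M. f (act M y m) = act N y (f m))"

lemma bhomD:
  assumes "bhom M N f"
  shows "m \<in> carr M \<Longrightarrow> f m \<in> carr N" "m \<in> carr M \<Longrightarrow> n \<in> carr M \<Longrightarrow> f (m + n) = f m + f n"
    "m \<in> carr M \<Longrightarrow> f (msc M c m) = msc N c (f m)" "y \<in> B \<Longrightarrow> m \<in> carr M \<Longrightarrow> f (act M y m) = act N y (f m)"
  using assms by (simp_all add: bhom_def)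

lemma is_hom_bhom: "is_hom M N f \<Longrightarrow> bhom M N f"
  by (auto simp: is_hom_def bhom_def)

lemma bhom_id [simp]: "bhom M M id" "bhom M M (\<lambda>x. x)"
  by (simp_all add: bhom_def)

lemma bhom_comp: "bhom N P g \<Longrightarrow> bhom M N f \<Longrightarrow> bhom M P (\<lambda>x. g (f x))"
  by (simp add: bhom_def)

lemma bhom_comp': "bhom N P g \<Longrightarrow> bhom M N f \<Longrightarrow> bhom M P (g \<circ> f)"
  by (simp add: bhom_def)

lemma bhom_sumt:
  fixes f :: "'m::ab_group_add \<Rightarrow> 'n::ab_group_add"
  assumes f: "bhom M N f" and M: "hmod M" "\<And>p q. g p q \<in> carr M"
  shows "f (sumt H t g) = sumt H t (\<lambda>p q. f (g p q))"
  by (rule sumt_additive_on[where A = "carr M" and g = f]) (use M bhomD[OF f] hmodD[OF M(1)] in simp_all)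

lemma bhom_lift_t:
  assumes M: "hmod M" "hmod N" "hmod P" and f: "base_balanced M N (msc P) f"
    and carr: "\<And>m n. m \<in> carr M \<Longrightarrow> n \<in> carr N \<Longrightarrow> f m n \<in> carr P"
    and act: "\<And>y m n. y \<in> B \<Longrightarrow> m \<in> carr M \<Longrightarrow> n \<in> carr N \<Longrightarrow> f (act M y m) n = act P y (f m n)"
  shows "bhom (M \<boxtimes> N) P (lift_t H M N f)"
proof -
  note l = lift_t_tt[OF f M(1,2)] lift_t_add[OF f M(1,2)]
  have 1: "lift_t H M N f t \<in> carr P" if "t \<in> carr_t H M N" for t
    using M(1,2) that by (induction rule: carr_t_induct) (simp_all add: l carr hmodD(8)[OF M(3)])
  have 2: "lift_t H M N f (act (M \<boxtimes> N) y t) = act P y (lift_t H M N f t)" if y: "y \<in> B" and t: "t \<in> carr_t H M N" for y t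
    using M(1,2) t
    by (induction rule: carr_t_induct)
      (simp_all add: l act_B_tt(1)[OF M(1,2) _ _ y] act[OF y] hmodD(3)[OF M(1)] act_tensor_add[OF M(1,2)]
        act_tensor_carr[OF M(1,2)] hmodD(4)[OF M(3)] 1)
  show ?thesis
    unfolding bhom_def by (simp add: 1 2 l lift_t_scale[OF f M(1,2)])
qed

lemma bhom_ext:
  assumes M: "hmod M" "hmod N" and fg: "bhom (M \<boxtimes> N) P f" "bhom (M \<boxtimes> N) P g"
    and eq: "\<And>m n. m \<in> carr M \<Longrightarrow> n \<in> carr N \<Longrightarrow> f (tt M N m n) = g (tt M N m n)"
    and t: "t \<in> carr_t H M N"
  shows "f t = g t"
  using M t
proof (induction rule: carr_t_induct)
  case (tens m n)
  then show ?case by (rule eq)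
next
  case (add s t)
  then show ?case using bhomD(2)[OF fg(1)] bhomD(2)[OF fg(2)] by simp
qed

lemma is_hom_ext:
  assumes M: "hmod M" "hmod N" "hmod P" and f: "bhom (M \<boxtimes> N) P f"
    and act: "\<And>h m n. m \<in> carr M \<Longrightarrow> n \<in> carr N \<Longrightarrow> f (tact M N (twist h) m n) = act P h (f (tt M N m n))"
  shows "is_hom (M \<boxtimes> N) P f"
proof -
  have "f (act (M \<boxtimes> N) h t) = act P h (f t)" if t: "t \<in> carr_t H M N" for h t
    using M(1,2) t
  proof (induction rule: carr_t_induct)
    case (tens m n)
    then show ?case by (simp add: act_tt[OF M(1,2)] act)
  next
    case (add s t)
    then show ?case
      using bhomD(1,2)[OF f] by (simp add: act_tensor_add[OF M(1,2)] act_tensor_carr[OF M(1,2)] hmodD(4)[OF M(3)])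
  qed
  then show ?thesis using bhomD(1-3)[OF f] by (auto simp: is_hom_def)
qed

lemma map_t_balanced:
  assumes M: "hmod M" "hmod N" "hmod P" "hmod Q" and f: "bhom M P f" and g: "bhom N Q g"
  shows "base_balanced M N tscale (\<lambda>m n. tt P Q (f m) (g n))"
  unfolding base_balanced_def bilinear_on_def
  using bhomD[OF f] bhomD[OF g] bilinear_onD[OF tt_bilinear[OF M(3,4)]] tt_B[OF M(3,4)] by simp

lemma map_t_tt [simp]:
  assumes M: "hmod M" "hmod N" "hmod P" "hmod Q" and f: "bhom M P f" and g: "bhom N Q g"
    and mn: "m \<in> carr M" "n \<in> carr N"
  shows "map_t H M N P Q f g (tt M N m n) = tt P Q (f m) (g n)"
  unfolding map_t_def by (rule lift_t_tt[OF map_t_balanced[OF M f g] M(1,2) mn])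

lemma bhom_map_t [simp]:
  assumes M: "hmod M" "hmod N" "hmod P" "hmod Q" and f: "bhom M P f" and g: "bhom N Q g"
  shows "bhom (M \<boxtimes> N) (P \<boxtimes> Q) (map_t H M N P Q f g)"
  unfolding map_t_def
  by (rule bhom_lift_t) (use M map_t_balanced[OF M f g] in
    \<open>simp_all add: bhomD[OF f] bhomD[OF g] tt_carr_t act_B_tt(1)\<close>)

subsection \<open>Associativity and braiding\<close>

text \<open>A base element leaving one factor acts on the neighbouring tensor product as a whole,
  and by \<open>act_B_tt\<close> this action can be placed on the adjacent factor.\<close>

lemma tt_tt_balanced:
  assumes M: "hmod M" "hmod N" "hmod P"
  shows "p \<in> carr P \<Longrightarrow> base_balanced M N tscale (\<lambda>m n. tt M (N \<boxtimes> P) m (tt N P n p))"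
    "m \<in> carr M \<Longrightarrow> base_balanced N P tscale (\<lambda>n p. tt (M \<boxtimes> N) P (tt M N m n) p)"
proof -
  note hM = hmodD(3,8,9)[OF M(1)] hmodD(3,8,9)[OF M(2)] hmodD(3,8,9)[OF M(3)]
  note t = bilinear_onD[OF tt_bilinear[OF M(1,2)]] bilinear_onD[OF tt_bilinear[OF M(2,3)]]
    bilinear_onD[OF tt_bilinear[OF M(1) hmod_tensor[OF M(2,3)]]]
    bilinear_onD[OF tt_bilinear[OF hmod_tensor[OF M(1,2)] M(3)]]
  note c = tt_carr_t[OF M(1,2)] tt_carr_t[OF M(2,3)]
  show "base_balanced M N tscale (\<lambda>m n. tt M (N \<boxtimes> P) m (tt N P n p))" if p: "p \<in> carr P"
  proof -
    have "tt M (N \<boxtimes> P) (act M y m) (tt N P n p) = tt M (N \<boxtimes> P) m (tt N P (act N y n) p)"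
      if "y \<in> B" "m \<in> carr M" "n \<in> carr N" for y m n
      using that p M by (simp add: tt_B c act_B_tt(1))
    then show ?thesis
      unfolding base_balanced_def bilinear_on_def using p
      by (simp add: t[unfolded tensor_obj_simps] c hM)
  qed
  show "base_balanced N P tscale (\<lambda>n p. tt (M \<boxtimes> N) P (tt M N m n) p)" if m: "m \<in> carr M"
  proof -
    have "tt (M \<boxtimes> N) P (tt M N m (act N y n)) p = tt (M \<boxtimes> N) P (tt M N m n) (act P y p)"
      if "y \<in> B" "p \<in> carr P" "n \<in> carr N" for y p n
      using that m M tt_B[OF hmod_tensor[OF M(1,2)] M(3) that(1), of "tt M N m n" p] by (simp add: c act_B_tt(2))
    then show ?thesis
      unfolding base_balanced_def bilinear_on_def using m
      by (simp add: t[unfolded tensor_obj_simps] c hM)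
  qed
qed

definition assoc_fun where "assoc_fun M N P u p = lift_t H M N (\<lambda>m n. tt M (N \<boxtimes> P) m (tt N P n p)) u"
definition assoc_inv_fun where "assoc_inv_fun M N P m u = lift_t H N P (\<lambda>n p. tt (M \<boxtimes> N) P (tt M N m n) p) u"

context
  fixes M :: "('k, 'h, 'm::ab_group_add) hmod" and N :: "('k, 'h, 'n::ab_group_add) hmod"
    and P :: "('k, 'h, 'p::ab_group_add) hmod"
  assumes M: "hmod M" "hmod N" "hmod P"
begin

lemma assoc_fun_tt: "m \<in> carr M \<Longrightarrow> n \<in> carr N \<Longrightarrow> p \<in> carr P \<Longrightarrow>
    assoc_fun M N P (tt M N m n) p = tt M (N \<boxtimes> P) m (tt N P n p)"
  unfolding assoc_fun_def by (rule lift_t_tt[OF tt_tt_balanced(1)[OF M] M(1,2)])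

lemma assoc_inv_fun_tt: "m \<in> carr M \<Longrightarrow> n \<in> carr N \<Longrightarrow> p \<in> carr P \<Longrightarrow>
    assoc_inv_fun M N P m (tt N P n p) = tt (M \<boxtimes> N) P (tt M N m n) p"
  unfolding assoc_inv_fun_def by (rule lift_t_tt[OF tt_tt_balanced(2)[OF M] M(2,3)])

lemma assoc_fun_add: "u \<in> carr_t H M N \<Longrightarrow> v \<in> carr_t H M N \<Longrightarrow> p \<in> carr P \<Longrightarrow>
    assoc_fun M N P (u + v) p = assoc_fun M N P u p + assoc_fun M N P v p"
  unfolding assoc_fun_def by (rule lift_t_add[OF tt_tt_balanced(1)[OF M] M(1,2)])

lemma assoc_inv_fun_add: "u \<in> carr_t H N P \<Longrightarrow> v \<in> carr_t H N P \<Longrightarrow> m \<in> carr M \<Longrightarrow>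
    assoc_inv_fun M N P m (u + v) = assoc_inv_fun M N P m u + assoc_inv_fun M N P m v"
  unfolding assoc_inv_fun_def by (rule lift_t_add[OF tt_tt_balanced(2)[OF M] M(2,3)])

lemma assoc_fun_carr:
  assumes "u \<in> carr_t H M N" "p \<in> carr P"
  shows "assoc_fun M N P u p \<in> carr_t H M (N \<boxtimes> P)"
  using M(1,2) assms(1)
  by (induction rule: carr_t_induct)
    (use M assms(2) in \<open>simp_all add: assoc_fun_tt assoc_fun_add tt_carr_t carr_t_add\<close>)

lemma assoc_inv_fun_carr:
  assumes "u \<in> carr_t H N P" "m \<in> carr M"
  shows "assoc_inv_fun M N P m u \<in> carr_t H (M \<boxtimes> N) P"
  using M(2,3) assms(1)
  by (induction rule: carr_t_induct)
    (use M assms(2) in \<open>simp_all add: assoc_inv_fun_tt assoc_inv_fun_add tt_carr_t carr_t_add\<close>)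

text \<open>Linearity in the first argument comes with \<open>lift_t\<close>; linearity in
  \<open>p\<close> and balancedness are reduced to generators \<open>tt M N m n\<close> by
  induction.\<close>

lemma assoc_fun_balanced: "base_balanced (M \<boxtimes> N) P tscale (assoc_fun M N P)"
proof -
  note hM = hmodD(3,8,9)[OF M(1)] hmodD(3,8,9)[OF M(2)] hmodD(3,8,9)[OF M(3)]
  note t = bilinear_onD[OF tt_bilinear[OF M(2,3)]] bilinear_onD[OF tt_bilinear[OF M(1) hmod_tensor[OF M(2,3)]]]
  note t = t[unfolded tensor_obj_simps]
  interpret V: vector_space "tscale :: 'k \<Rightarrow> ('m, ('n, 'p, 'k) tensor, 'k) tensor \<Rightarrow> _" by simp
  have "assoc_fun M N P u (p + q) = assoc_fun M N P u p + assoc_fun M N P u q"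
    if "u \<in> carr_t H M N" "p \<in> carr P" "q \<in> carr P" for u p q
    using M(1,2) that(1) by (induction rule: carr_t_induct)
      (use that in \<open>simp_all add: assoc_fun_tt assoc_fun_add t hM tt_carr_t[OF M(2,3)] algebra_simps\<close>)
  moreover have "assoc_fun M N P u (msc P c p) = tscale c (assoc_fun M N P u p)"
    if "u \<in> carr_t H M N" "p \<in> carr P" for u p c
    using M(1,2) that(1) by (induction rule: carr_t_induct)
      (use that in \<open>simp_all add: assoc_fun_tt assoc_fun_add t hM tt_carr_t[OF M(2,3)] V.scale_right_distrib\<close>)
  moreover have "assoc_fun M N P (tscale c u) p = tscale c (assoc_fun M N P u p)"
    if "u \<in> carr_t H M N" "p \<in> carr P" for u p c
    unfolding assoc_fun_def by (rule lift_t_scale[OF tt_tt_balanced(1)[OF M that(2)] M(1,2) that(1)])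
  moreover have "assoc_fun M N P (act (M \<boxtimes> N) y u) p = assoc_fun M N P u (act P y p)"
    if "y \<in> B" "u \<in> carr_t H M N" "p \<in> carr P" for u p y
    using M(1,2) that(2) by (induction rule: carr_t_induct)
      (use that in \<open>simp_all add: assoc_fun_tt assoc_fun_add hM act_B_tt(2)[OF M(1,2)] tt_B[OF M(2,3)]
         act_tensor_add[OF M(1,2)] act_tensor_carr[OF M(1,2)]\<close>)
  ultimately show ?thesis
    unfolding base_balanced_def bilinear_on_def by (simp add: assoc_fun_add)
qed

lemma assoc_inv_fun_balanced: "base_balanced M (N \<boxtimes> P) tscale (assoc_inv_fun M N P)"
proof -
  note hM = hmodD(3,8,9)[OF M(1)] hmodD(3,8,9)[OF M(2)] hmodD(3,8,9)[OF M(3)]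
  note t = bilinear_onD[OF tt_bilinear[OF M(1,2)]] bilinear_onD[OF tt_bilinear[OF hmod_tensor[OF M(1,2)] M(3)]]
  note t = t[unfolded tensor_obj_simps]
  interpret V: vector_space "tscale :: 'k \<Rightarrow> (('m, 'n, 'k) tensor, 'p, 'k) tensor \<Rightarrow> _" by simp
  have "assoc_inv_fun M N P (m + m') u = assoc_inv_fun M N P m u + assoc_inv_fun M N P m' u"
    if "u \<in> carr_t H N P" "m \<in> carr M" "m' \<in> carr M" for u m m'
    using M(2,3) that(1) by (induction rule: carr_t_induct)
      (use that in \<open>simp_all add: assoc_inv_fun_tt assoc_inv_fun_add t hM tt_carr_t[OF M(1,2)] algebra_simps\<close>)
  moreover have "assoc_inv_fun M N P (msc M c m) u = tscale c (assoc_inv_fun M N P m u)"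
    if "u \<in> carr_t H N P" "m \<in> carr M" for u m c
    using M(2,3) that(1) by (induction rule: carr_t_induct)
      (use that in \<open>simp_all add: assoc_inv_fun_tt assoc_inv_fun_add t hM tt_carr_t[OF M(1,2)] V.scale_right_distrib\<close>)
  moreover have "assoc_inv_fun M N P m (tscale c u) = tscale c (assoc_inv_fun M N P m u)"
    if "u \<in> carr_t H N P" "m \<in> carr M" for u m c
    unfolding assoc_inv_fun_def by (rule lift_t_scale[OF tt_tt_balanced(2)[OF M that(2)] M(2,3) that(1)])
  moreover have "assoc_inv_fun M N P (act M y m) u = assoc_inv_fun M N P m (act (N \<boxtimes> P) y u)"
    if "y \<in> B" "u \<in> carr_t H N P" "m \<in> carr M" for u m y
    using M(2,3) that(2) by (induction rule: carr_t_induct)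
      (use that in \<open>simp_all add: assoc_inv_fun_tt assoc_inv_fun_add hM act_B_tt(1)[OF M(2,3)] tt_B[OF M(1,2)]
         act_tensor_add[OF M(2,3)] act_tensor_carr[OF M(2,3)]\<close>)
  ultimately show ?thesis
    unfolding base_balanced_def bilinear_on_def by (simp add: assoc_inv_fun_add)
qed

lemma assoc_eq: "assoc M N P = lift_t H (M \<boxtimes> N) P (assoc_fun M N P)"
  unfolding assoc_def assoc_fun_def[abs_def] ..

lemma assoc_inv_eq: "assoc_inv M N P = lift_t H M (N \<boxtimes> P) (assoc_inv_fun M N P)"
  unfolding assoc_inv_def assoc_inv_fun_def[abs_def] ..

lemma assoc_tt [simp]:
  assumes "m \<in> carr M" "n \<in> carr N" "p \<in> carr P"
  shows "assoc M N P (tt (M \<boxtimes> N) P (tt M N m n) p) = tt M (N \<boxtimes> P) m (tt N P n p)"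
  unfolding assoc_eq using assms M
  by (simp add: lift_t_tt[OF assoc_fun_balanced] tt_carr_t assoc_fun_tt)

lemma assoc_inv_tt [simp]:
  assumes "m \<in> carr M" "n \<in> carr N" "p \<in> carr P"
  shows "assoc_inv M N P (tt M (N \<boxtimes> P) m (tt N P n p)) = tt (M \<boxtimes> N) P (tt M N m n) p"
  unfolding assoc_inv_eq using assms M
  by (simp add: lift_t_tt[OF assoc_inv_fun_balanced] tt_carr_t assoc_inv_fun_tt)

lemma bhom_assoc [simp]: "bhom ((M \<boxtimes> N) \<boxtimes> P) (M \<boxtimes> N \<boxtimes> P) (assoc M N P)"
  unfolding assoc_eq
proof (rule bhom_lift_t)
  show "base_balanced (M \<boxtimes> N) P (msc (M \<boxtimes> N \<boxtimes> P)) (assoc_fun M N P)" by (simp add: assoc_fun_balanced)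
  show "assoc_fun M N P m n \<in> carr (M \<boxtimes> N \<boxtimes> P)" if "m \<in> carr (M \<boxtimes> N)" "n \<in> carr P" for m n
    using that by (simp add: assoc_fun_carr)
  show "assoc_fun M N P (act (M \<boxtimes> N) y u) p = act (M \<boxtimes> N \<boxtimes> P) y (assoc_fun M N P u p)"
    if "y \<in> B" "u \<in> carr (M \<boxtimes> N)" "p \<in> carr P" for y u p
    using M(1,2) that(2)[unfolded tensor_obj_simps] by (induction rule: carr_t_induct)
      (use that M in \<open>simp_all add: assoc_fun_tt assoc_fun_add act_B_tt(1) act_tensor_add act_tensor_carr
         hmodD(3) tt_carr_t assoc_fun_carr\<close>)
qed (use M in simp_all)

lemma bhom_assoc_inv [simp]: "bhom (M \<boxtimes> N \<boxtimes> P) ((M \<boxtimes> N) \<boxtimes> P) (assoc_inv M N P)"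
  unfolding assoc_inv_eq
proof (rule bhom_lift_t)
  show "base_balanced M (N \<boxtimes> P) (msc ((M \<boxtimes> N) \<boxtimes> P)) (assoc_inv_fun M N P)" by (simp add: assoc_inv_fun_balanced)
  show "assoc_inv_fun M N P m n \<in> carr ((M \<boxtimes> N) \<boxtimes> P)" if "m \<in> carr M" "n \<in> carr (N \<boxtimes> P)" for m n
    using that by (simp add: assoc_inv_fun_carr)
  show "assoc_inv_fun M N P (act M y m) u = act ((M \<boxtimes> N) \<boxtimes> P) y (assoc_inv_fun M N P m u)"
    if "y \<in> B" "m \<in> carr M" "u \<in> carr (N \<boxtimes> P)" for y u m
    using M(2,3) that(3)[unfolded tensor_obj_simps] by (induction rule: carr_t_induct)
      (use that M in \<open>simp_all add: assoc_inv_fun_tt assoc_inv_fun_add act_B_tt(1) act_tensor_add act_tensor_carr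
         hmodD(3) tt_carr_t assoc_inv_fun_carr\<close>)
qed (use M in simp_all)

end

context
  fixes M :: "('k, 'h, 'm::ab_group_add) hmod" and N :: "('k, 'h, 'n::ab_group_add) hmod"
  assumes M: "hmod M" "hmod N"
begin

definition braid_fun where
  "braid_fun m n = sumt H F (\<lambda>f f'. sumt H G (\<lambda>g g'. tt N M (act N (g * f') n) (act M (g' * f) m)))"

lemma braid_eq: "braid M N t = lift_t H M N braid_fun t"
proof -
  note b = bilinear_on_act[OF tt_bilinear[OF M(2,1)] M(2,1)] hmodD(3)[OF M(1)] hmodD(3)[OF M(2)]
  show ?thesis
    unfolding braid_def braid_fun_def by (rule lift_t_cong) (simp add: b)
qed

lemma braid_fun_B:
  assumes y: "y \<in> B" and mn: "m \<in> carr M" "n \<in> carr N"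
  shows "braid_fun (act M y m) n = braid_fun m (act N y n)" "braid_fun (act M y m) n = act (N \<boxtimes> M) y (braid_fun m n)"
proof -
  note b [simp] = bilinear_on_act[OF tt_bilinear[OF M(2,1)] M(2,1)] hmodD(3)[OF M(1)] hmodD(3)[OF M(2)]
  have 1: "bil tscale (\<lambda>f f'. sumt H G (\<lambda>g g'. tt N M (act N (g * f') n) (act M (g' * f) m)))"
    using mn by simp
  have 2: "bil tscale (\<lambda>g g'. tt N M (act N (g * f') n) (act M (g' * f) m))" for f f'
    using mn by simp
  show "braid_fun (act M y m) n = braid_fun m (act N y n)"
    using sumt_B_left(2)[OF central_F 1 y] mn
    by (simp add: braid_fun_def hmodD(6)[OF M(1), symmetric] hmodD(6)[OF M(2), symmetric] mult.assoc)
  have "act (N \<boxtimes> M) y (braid_fun m n) =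
     sumt H F (\<lambda>f f'. sumt H G (\<lambda>g g'. act (N \<boxtimes> M) y (tt N M (act N (g * f') n) (act M (g' * f) m))))"
    unfolding braid_fun_def
    by (subst sumt_additive_on[where A = "carr_t H N M" and g = "act (N \<boxtimes> M) y"],
       simp_all add: act_tensor_add[OF M(2,1)] carr_t_add[OF M(2,1)] carr_t_zero[OF M(2,1)] carr_t_sumt[OF M(2,1)] tt_carr_t[OF M(2,1)] mn,
       subst sumt_additive_on[where A = "carr_t H N M" and g = "act (N \<boxtimes> M) y"],
       simp_all add: act_tensor_add[OF M(2,1)] carr_t_add[OF M(2,1)] carr_t_zero[OF M(2,1)] tt_carr_t[OF M(2,1)] mn)
  also have "\<dots> = sumt H F (\<lambda>f f'. sumt H G (\<lambda>g g'. tt N M (act N (y * g * f') n) (act M (g' * f) m)))"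
    using mn by (simp add: act_B_tt(1)[OF M(2,1) _ _ y] hmodD(6)[OF M(2), symmetric] mult.assoc)
  \<comment> \<open>Passing through the inverse puts \<open>y\<close> between \<open>g\<close> and
    \<open>f'\<close>; the crossing rule for \<open>F\<close> then carries it to the right of
    \<open>f\<close>, next to \<open>m\<close>.\<close>
  also have "\<dots> = sumt H F (\<lambda>f f'. sumt H G (\<lambda>g g'. tt N M (act N (g * (y * f')) n) (act M (g' * f) m)))"
    using sumt_B_left(1)[OF central_G 2 y] sumt_B[OF central_G 2 y] by (simp add: mult.assoc)
  also have "\<dots> = sumt H F (\<lambda>f f'. sumt H G (\<lambda>g g'. tt N M (act N (g * f') n) (act M (g' * (f * y)) m)))"
    using sumt_B[OF central_F 1 y] by simp
  also have "\<dots> = braid_fun (act M y m) n"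
    using mn by (simp add: braid_fun_def hmodD(6)[OF M(1), symmetric] mult.assoc)
  finally show "braid_fun (act M y m) n = act (N \<boxtimes> M) y (braid_fun m n)" ..
qed

lemma braid_fun_balanced: "base_balanced M N tscale braid_fun"
  unfolding base_balanced_def bilinear_on_def
  by (simp add: braid_fun_B(1))
    (auto simp: braid_fun_def bilinear_onD[OF tt_bilinear[OF M(2,1)]] hmodD(3-5)[OF M(1)] hmodD(3-5)[OF M(2)] sumt_add tscale_sumt)

lemma braid_tt:
  assumes "m \<in> carr M" "n \<in> carr N"
  shows "braid M N (tt M N m n) = sumt H F (\<lambda>f f'. sumt H G (\<lambda>g g'. tt N M (act N (g * f') n) (act M (g' * f) m)))"
  using assms M by (simp add: braid_eq lift_t_tt[OF braid_fun_balanced] braid_fun_def)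

lemma bhom_braid [simp]: "bhom (M \<boxtimes> N) (N \<boxtimes> M) (braid M N)"
proof -
  have "braid_fun m n \<in> carr_t H N M" if "m \<in> carr M" "n \<in> carr N" for m n
    unfolding braid_fun_def using that M
    by (intro carr_t_sumt[OF M(2,1)] tt_carr_t[OF M(2,1)] hmodD(3))
  then have "bhom (M \<boxtimes> N) (N \<boxtimes> M) (lift_t H M N braid_fun)"
    by (intro bhom_lift_t) (use M in \<open>simp_all add: braid_fun_balanced braid_fun_B(2)\<close>)
  moreover have "braid M N = lift_t H M N braid_fun" by (rule ext) (rule braid_eq)
  ultimately show ?thesis by simp
qed

end

section \<open>The centraliser as a Hopf algebra\<close>

abbreviation "A \<equiv> C_obj H"
abbreviation "I \<equiv> unit_obj H"
abbreviation "A2 \<equiv> A \<boxtimes> A"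

lemma A_simps [simp]: "carr A = C" "msc A = sH" "act A = ad"
  by (simp_all add: C_obj_def)

lemma I_simps [simp]: "carr I = B" "msc I = sH" "act I = (\<lambda>h z. et (h * z))"
  by (simp_all add: unit_obj_def)

lemma hmod_A [simp]: "hmod A"
  unfolding is_hmod_def
  by (simp add: ad_mult linD(1,2)[OF lin_ad(1)[OF lin_id[OF vs_H]]] linD(1,2)[OF lin_ad(2)[OF lin_id[OF vs_H]]])

lemma hmod_I [simp]: "hmod I"
proof -
  note l = linD(1,2)[OF lin_et[OF lin_id[OF vs_H]]]
  show ?thesis
    unfolding is_hmod_def
    by (simp add: l distrib_left distrib_right smult_mult_left[symmetric] smult_mult_right[symmetric] et_mult_et mult.assoc)
qed

lemma bhom_ext3:
  assumes M: "hmod M" "hmod N" "hmod P" "hmod Q" and fg: "bhom ((M \<boxtimes> N) \<boxtimes> P) Q f" "bhom ((M \<boxtimes> N) \<boxtimes> P) Q g"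
    and eq: "\<And>m n p. m \<in> carr M \<Longrightarrow> n \<in> carr N \<Longrightarrow> p \<in> carr P \<Longrightarrow>
      f (tt (M \<boxtimes> N) P (tt M N m n) p) = g (tt (M \<boxtimes> N) P (tt M N m n) p)"
    and t: "t \<in> carr ((M \<boxtimes> N) \<boxtimes> P)"
  shows "f t = g t"
proof (rule bhom_ext[OF hmod_tensor[OF M(1,2)] M(3) fg])
  fix u p assume p: "p \<in> carr P" and "u \<in> carr (M \<boxtimes> N)"
  then have "u \<in> carr_t H M N" by simp
  with M(1,2) show "f (tt (M \<boxtimes> N) P u p) = g (tt (M \<boxtimes> N) P u p)"
  proof (induction rule: carr_t_induct)
    case (tens m n)
    then show ?case using eq p by simp
  next
    case (add s t)
    note T = hmod_tensor[OF M(1,2)]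
    have "tt (M \<boxtimes> N) P (s + t) p = tt (M \<boxtimes> N) P s p + tt (M \<boxtimes> N) P t p"
      by (rule bilinear_onD(2)[OF tt_bilinear[OF T M(3)]]) (use add p in simp_all)
    moreover have "tt (M \<boxtimes> N) P s p \<in> carr ((M \<boxtimes> N) \<boxtimes> P)" "tt (M \<boxtimes> N) P t p \<in> carr ((M \<boxtimes> N) \<boxtimes> P)"
      using tt_carr_t[OF T M(3)] add p by simp_all
    ultimately show ?case
      using add bhomD(2)[OF fg(1)] bhomD(2)[OF fg(2)] by simp
  qed
qed (use t in simp)

text \<open>Moving a base element across exchanges its order with \<open>z\<close>, which is
  harmless since the base is commutative.\<close>

lemma lunit_balanced: "hmod M \<Longrightarrow> base_balanced I M (msc M) (act M)"
  by (auto simp: base_balanced_def bilinear_on_def is_hmod_def B_comm) (metis B_comm)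

lemma lunit_tt: "hmod M \<Longrightarrow> z \<in> B \<Longrightarrow> m \<in> carr M \<Longrightarrow> lunit H M (tt I M z m) = act M z m"
  unfolding lunit_def by (rule lift_t_tt[OF lunit_balanced]) simp_all

lemma bhom_lunit [simp]: "hmod M \<Longrightarrow> bhom (I \<boxtimes> M) M (lunit H M)"
  unfolding lunit_def
  by (rule bhom_lift_t) (simp_all add: lunit_balanced hmodD(3,6))

lemma runit_balanced: "hmod M \<Longrightarrow> base_balanced M I (msc M) (\<lambda>m z. act M z m)"
  by (auto simp: base_balanced_def bilinear_on_def is_hmod_def B_comm) (metis B_comm)

text \<open>The inverse antipode in the right unit constraint acts as the identity, because S is its
  own inverse and fixes the base.\<close>

lemma runit_eq: "runit H M t = lift_t H M I (\<lambda>m z. act M z m) t"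
  unfolding runit_def by (rule lift_t_cong) simp

lemma runit_tt: "hmod M \<Longrightarrow> z \<in> B \<Longrightarrow> m \<in> carr M \<Longrightarrow> runit H M (tt M I m z) = act M z m"
  unfolding runit_eq by (rule lift_t_tt[OF runit_balanced]) simp_all

lemma bhom_runit [simp]:
  assumes M: "hmod M"
  shows "bhom (M \<boxtimes> I) M (runit H M)"
proof -
  have "bhom (M \<boxtimes> I) M (lift_t H M I (\<lambda>m z. act M z m))"
  proof (rule bhom_lift_t)
    fix y m z assume "y \<in> B" "m \<in> carr M" "z \<in> carr I"
    then show "act M z (act M y m) = act M y (act M z m)"
      using B_comm[of y z] by (simp add: hmodD(6)[OF M, symmetric])
  qed (simp_all add: M runit_balanced hmodD(3))
  moreover have "runit H M = lift_t H M I (\<lambda>m z. act M z m)" by (rule ext) (rule runit_eq)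
  ultimately show ?thesis by simp
qed

subsection \<open>The algebra\<close>

lemma prod_F_eq: "prod_F H F a b = sumt H F (\<lambda>f f'. ad f a * ad f' b)"
  unfolding prod_F_def by simp

lemma C_sumt: "(\<And>p q. g p q \<in> C) \<Longrightarrow> sumt H t g \<in> C"
  using carr_sumt[OF hmod_A] by simp

lemma prod_F_C [simp]: "prod_F H F a b \<in> C"
  unfolding prod_F_eq by (rule C_sumt) simp

lemma prod_F_B:
  assumes y: "y \<in> B"
  shows "prod_F H F (ad y a) b = prod_F H F a (ad y b)" "prod_F H F (ad y a) b = ad y (prod_F H F a b)"
proof -
  have b: "bil sH (\<lambda>f f'. ad f a * ad f' b)" by simp
  show "prod_F H F (ad y a) b = prod_F H F a (ad y b)"
    unfolding prod_F_eq ad_mult[symmetric] by (rule sumt_B_left(2)[OF central_F b y])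
  have "prod_F H F (ad y a) b = sumt H F (\<lambda>f f'. ad (y * f) a * ad f' b)"
    unfolding prod_F_eq ad_mult[symmetric]
    using sumt_B_left(1)[OF central_F b y] sumt_B[OF central_F b y] by simp
  also have "\<dots> = y * prod_F H F a b"
    unfolding prod_F_eq by (simp add: ad_B_mult(1) y sumt_mult_left mult.assoc)
  also have "\<dots> = ad y (prod_F H F a b)"
    by (simp add: ad_B y)
  finally show "prod_F H F (ad y a) b = ad y (prod_F H F a b)" .
qed

lemma lin_prod_F [simp]:
  "lin s sH g \<Longrightarrow> lin s sH (\<lambda>x. prod_F H F (g x) b)" "lin s sH g \<Longrightarrow> lin s sH (\<lambda>x. prod_F H F a (g x))"
  unfolding prod_F_eq by simp_all

lemma prod_F_balanced: "base_balanced A A sH (prod_F H F)"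
  unfolding base_balanced_def bilinear_on_def
  using linD(1,2)[OF lin_prod_F(1)[OF lin_id[OF vs_H]]] linD(1,2)[OF lin_prod_F(2)[OF lin_id[OF vs_H]]]
  by (simp add: prod_F_B(1))

abbreviation "\<mu> \<equiv> mult_F H F"

lemma mult_F_tt [simp]: "a \<in> C \<Longrightarrow> b \<in> C \<Longrightarrow> \<mu> (tt A A a b) = prod_F H F a b"
  unfolding mult_F_def by (rule lift_t_tt[OF prod_F_balanced]) simp_all

lemma bhom_mult_F [simp]: "bhom A2 A \<mu>"
  unfolding mult_F_def by (rule bhom_lift_t) (simp_all add: prod_F_balanced prod_F_B(2))

text \<open>This intertwining of the twisted and the original coproduct makes the product H-linear;
  \<open>twist_G\<close> does the same for the comultiplication.\<close>

lemma F_twist: "F \<bullet> twist h = comult H h \<bullet> F"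
proof -
  have "F \<bullet> twist h = (F \<bullet> G) \<bullet> comult H h \<bullet> F"
    by (simp add: twist_def mult2_assoc)
  also have "\<dots> = comult H (1 * h) \<bullet> F"
    by (simp only: F_G comult_mult)
  finally show ?thesis by simp
qed

lemma twist_G: "twist h \<bullet> G = G \<bullet> comult H h"
proof -
  have "twist h \<bullet> G = G \<bullet> (comult H h \<bullet> (F \<bullet> G))"
    by (simp add: twist_def mult2_assoc)
  also have "\<dots> = G \<bullet> comult H (h * 1)"
    by (simp only: F_G comult_mult)
  finally show ?thesis by simp
qed

lemma is_hom_mult_F: "is_hom A2 A \<mu>"
proof (rule is_hom_ext)
  fix h a b assume ab: "a \<in> carr A" "b \<in> carr A"
  have b: "bil sH (\<lambda>f f'. ad f a * ad f' b)" by simp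
  have "\<mu> (tact A A (twist h) a b) = sumt H (twist h) (\<lambda>p q. \<mu> (tt A A (ad p a) (ad q b)))"
    unfolding tact_def A_simps by (rule bhom_sumt[OF bhom_mult_F]) (simp_all add: tt_carr_t)
  also have "\<dots> = sumt H (twist h) (\<lambda>p q. sumt H F (\<lambda>f f'. ad (f * p) a * ad (f' * q) b))"
    by (simp add: prod_F_eq ad_mult)
  also have "\<dots> = sumt H (F \<bullet> twist h) (\<lambda>f f'. ad f a * ad f' b)"
    by (subst sumt_mult2[OF _ _ b]) (simp_all, rule sumt_swap)
  also have "\<dots> = sumt H F (\<lambda>f f'. D h (\<lambda>p q. ad p (ad f a) * ad q (ad f' b)))"
    unfolding F_twist by (subst sumt_mult2[OF _ _ b]) (simp_all add: ad_mult, rule sumt_swap)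
  also have "\<dots> = ad h (prod_F H F a b)"
    by (simp add: ad_prod prod_F_eq ad_sumt)
  finally show "\<mu> (tact A A (twist h) a b) = act A h (\<mu> (tt A A a b))"
    using ab by simp
qed simp_all

lemma is_hom_unit: "is_hom I A (\<lambda>x. x)"
  by (auto simp: is_hom_def ad_et)

lemma bhom_unit [simp]: "bhom I A (\<lambda>x. x)"
  by (rule is_hom_bhom[OF is_hom_unit])

text \<open>\<open>ad_prod\<close> spreads the action of the outer cocycle over the inner product,
  whereupon the two bracketings are the two sides of the cocycle identity.\<close>

lemma prod_F_assoc: "prod_F H F (prod_F H F a b) c = prod_F H F a (prod_F H F b c)"
proof -
  have t: "tri sH (\<lambda>x y z. ad x a * ad y b * ad z c)" by simp
  have "prod_F H F (prod_F H F a b) c =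
      sumt H F (\<lambda>f f'. sumt H F (\<lambda>g g'. D f (\<lambda>p q. ad (p * g) a * ad (q * g') b) * ad f' c))"
    by (simp add: prod_F_eq ad_sumt sumt_mult_right ad_prod[symmetric] ad_mult)
  also have "\<dots> = sumt H F (\<lambda>f f'. D f (\<lambda>p q. sumt H F (\<lambda>g g'. ad (p * g) a * ad (q * g') b * ad f' c)))"
    unfolding sumt_mult_right by (intro arg_cong[where f = "sumt H F"] ext sumt_swap)
  also have "\<dots> = sumt H F (\<lambda>f f'. D f' (\<lambda>p q. sumt H F (\<lambda>g g'. ad f a * ad (p * g) b * ad (q * g') c)))"
    by (rule cocycle_D[OF t])
  also have "\<dots> = sumt H F (\<lambda>f f'. sumt H F (\<lambda>g g'. ad f a * D f' (\<lambda>p q. ad (p * g) b * ad (q * g') c)))"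
    unfolding sumt_mult_left mult.assoc by (intro arg_cong[where f = "sumt H F"] ext sumt_swap)
  also have "\<dots> = prod_F H F a (prod_F H F b c)"
    by (simp add: prod_F_eq ad_sumt sumt_mult_left ad_prod[symmetric] ad_mult)
  finally show ?thesis .
qed

text \<open>The base element passes through \<open>T\<close> and factors out; what remains is the
  action of et(T_1) T_2, which is 1 by the normalisation. With \<open>F\<close> this yields the unit
  laws, with the inverse the counit laws.\<close>

lemma central_ad_norm:
  assumes T: "central T" and n: "sumt H T (\<lambda>a b. sH (\<epsilon> a) b) = 1" "sumt H T (\<lambda>a b. sH (\<epsilon> b) a) = 1"
    and z: "z \<in> B" and a: "a \<in> C"
  shows "sumt H T (\<lambda>f f'. et (f * z) * ad f' a) = z * a" "sumt H T (\<lambda>f f'. et (f' * z) * ad f a) = z * a"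
proof -
  have b: "bil sH (\<lambda>f f'. et f * ad f' a)" "bil sH (\<lambda>f f'. et f' * ad f a)" by simp_all
  have "sumt H T (\<lambda>f f'. et (f * z) * ad f' a) = sumt H T (\<lambda>f f'. et (z * f) * ad f' a)"
    using sumt_B_left(1)[OF T b(1) z] sumt_B[OF T b(1) z] by simp
  also have "\<dots> = z * ad (sumt H T (\<lambda>f f'. et f * f')) a"
    by (simp add: et_mult_B z ad_sumt sumt_mult_left mult.assoc ad_B_mult(1))
  finally show "sumt H T (\<lambda>f f'. et (f * z) * ad f' a) = z * a"
    by (simp add: central_et[OF T] n a)
  have "sumt H T (\<lambda>f f'. et (f' * z) * ad f a) = sumt H T (\<lambda>f f'. et (z * f') * ad f a)"
    using sumt_B_left(2)[OF T b(2) z] sumt_B[OF T b(2) z] by simp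
  also have "\<dots> = z * ad (sumt H T (\<lambda>f f'. et f' * f)) a"
    by (simp add: et_mult_B z ad_sumt sumt_mult_left mult.assoc ad_B_mult(1))
  finally show "sumt H T (\<lambda>f f'. et (f' * z) * ad f a) = z * a"
    by (simp add: central_et[OF T] n a)
qed

lemma prod_F_unit:
  assumes z: "z \<in> B" and a: "a \<in> C"
  shows "prod_F H F z a = z * a" "prod_F H F a z = z * a"
  using central_ad_norm[OF central_F F_norm_left F_norm_right z a]
  by (simp_all add: prod_F_eq ad_et z C_comm[OF ad_in_C])

lemma algebra_in_A: "algebra_in A \<mu> (\<lambda>x. x)"
  unfolding algebra_in_def
proof (intro conjI ballI)
  have 1: "bhom (A2 \<boxtimes> A) A (\<lambda>t. \<mu> (map_t H A2 A A A \<mu> id t))"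
    by (rule bhom_comp[OF bhom_mult_F bhom_map_t]) simp_all
  have 2: "bhom (A2 \<boxtimes> A) A (\<lambda>t. \<mu> (map_t H A A2 A A id \<mu> (assoc A A A t)))"
    by (rule bhom_comp[OF bhom_mult_F], rule bhom_comp[OF bhom_map_t bhom_assoc]) simp_all
  show "\<mu> (map_t H A2 A A A \<mu> id t) = \<mu> (map_t H A A2 A A id \<mu> (assoc A A A t))"
    if "t \<in> carr (A2 \<boxtimes> A)" for t
    by (rule bhom_ext3[OF _ _ _ _ 1 2 _ that]) (simp_all add: prod_F_assoc tt_carr_t)
  have 3: "bhom (I \<boxtimes> A) A (\<lambda>t. \<mu> (map_t H I A A A (\<lambda>x. x) id t))"
    by (rule bhom_comp[OF bhom_mult_F bhom_map_t]) simp_all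
  show "\<mu> (map_t H I A A A (\<lambda>x. x) id t) = lunit H A t" if "t \<in> carr (I \<boxtimes> A)" for t
    by (rule bhom_ext[OF _ _ 3 bhom_lunit]) (use that in \<open>simp_all add: prod_F_unit lunit_tt ad_B\<close>)
  have 4: "bhom (A \<boxtimes> I) A (\<lambda>t. \<mu> (map_t H A I A A id (\<lambda>x. x) t))"
    by (rule bhom_comp[OF bhom_mult_F bhom_map_t]) simp_all
  show "\<mu> (map_t H A I A A id (\<lambda>x. x) t) = runit H A t" if "t \<in> carr (A \<boxtimes> I)" for t
    by (rule bhom_ext[OF _ _ 4 bhom_runit]) (use that in \<open>simp_all add: prod_F_unit runit_tt ad_B\<close>)
qed (simp_all add: is_hom_mult_F is_hom_unit)

subsection \<open>The coalgebra\<close>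

abbreviation "\<delta> \<equiv> comult_F H G"
abbreviation "t2 \<equiv> tt A A"

lemma lin_t2 [simp]:
  "lin s sH g \<Longrightarrow> lin s tscale (\<lambda>x. t2 (ad (g x) u) (ad h v))"
  "lin s sH g \<Longrightarrow> lin s tscale (\<lambda>x. t2 (ad h u) (ad (g x) v))"
  "lin s sH g \<Longrightarrow> lin s tscale (\<lambda>x. t2 (ad h (g x)) (ad k v))"
  "lin s sH g \<Longrightarrow> lin s tscale (\<lambda>x. t2 (ad h u) (ad k (g x)))"
  by (rule bilinear_on_lin[OF tt_bilinear[of A A]]; simp)+

lemma comult_F_eq: "\<delta> a = D a (\<lambda>u v. sumt H G (\<lambda>g g'. t2 (ad g u) (ad g' v)))"
  unfolding comult_F_def by simp

lemma t2_carr [simp]: "a \<in> C \<Longrightarrow> b \<in> C \<Longrightarrow> t2 a b \<in> carr_t H A A"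
  using tt_carr_t[of A A] by simp

lemma comult_F_carr [simp]: "\<delta> a \<in> carr_t H A A"
  unfolding comult_F_eq by (intro carr_t_sumt) simp_all

lemma lin_comult_F: "lin sH tscale \<delta>"
proof -
  have "lin sH tscale (\<lambda>a. \<delta> a)" unfolding comult_F_eq by simp
  then show ?thesis by simp
qed

lemma is_hom_comult_F: "is_hom A A2 \<delta>"
proof -
  have "\<delta> (ad h a) = act A2 h (\<delta> a)" for h a
  proof -
    have b: "bil tscale (\<lambda>x y. t2 (ad x u) (ad y v))" for u v by simp
    have s: "act A2 h (sumt H t g) = sumt H t (\<lambda>p q. act A2 h (g p q))"
      if "\<And>p q. g p q \<in> carr_t H A A" for t g
      by (rule sumt_additive_on[where A = "carr_t H A A" and g = "act A2 h"])
        (use that in \<open>simp_all add: act_tensor_add carr_t_add carr_t_zero\<close>)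
    have "\<delta> (ad h a) = D h (\<lambda>p q. D a (\<lambda>u v. sumt H G (\<lambda>g g'. t2 (ad (g * p) u) (ad (g' * q) v))))"
      unfolding comult_F_eq by (subst D_ad[where s = tscale]) (simp_all add: ad_mult)
    also have "\<dots> = D a (\<lambda>u v. D h (\<lambda>p q. sumt H G (\<lambda>g g'. t2 (ad (g * p) u) (ad (g' * q) v))))"
      by (rule sumt_swap)
    also have "\<dots> = D a (\<lambda>u v. sumt H (G \<bullet> comult H h) (\<lambda>g g'. t2 (ad g u) (ad g' v)))"
      by (subst sumt_mult2[OF _ _ b]) (simp_all, intro arg_cong[where f = "D a"] ext sumt_swap)
    also have "\<dots> = D a (\<lambda>u v. sumt H G (\<lambda>g g'. sumt H (twist h) (\<lambda>x y. t2 (ad (x * g) u) (ad (y * g') v))))"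
      unfolding twist_G[symmetric]
      by (subst sumt_mult2[OF _ _ b]) (simp_all, intro arg_cong[where f = "D a"] ext sumt_swap)
    also have "\<dots> = D a (\<lambda>u v. sumt H G (\<lambda>g g'. act A2 h (t2 (ad g u) (ad g' v))))"
      using act_tt[of A A] by (simp add: tact_def ad_mult)
    also have "\<dots> = act A2 h (\<delta> a)"
      unfolding comult_F_eq by (simp add: s carr_t_sumt)
    finally show ?thesis .
  qed
  then show ?thesis
    by (auto simp: is_hom_def linD(1,2)[OF lin_comult_F])
qed

lemma bhom_comult_F [simp]: "bhom A A2 \<delta>"
  by (rule is_hom_bhom[OF is_hom_comult_F])

lemma is_hom_et: "is_hom A I et"
  by (auto simp: is_hom_def et_ad et_mult_et linD(1,2)[OF lin_et[OF lin_id[OF vs_H]]])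

lemma bhom_et [simp]: "bhom A I et"
  by (rule is_hom_bhom[OF is_hom_et])

lemma bhom_comult_F_sumt:
  fixes P :: "('k, 'h, 'p::ab_group_add) hmod"
  assumes L: "bhom A2 P L"
  shows "L (\<delta> a) = D a (\<lambda>u v. sumt H G (\<lambda>g g'. L (t2 (ad g u) (ad g' v))))"
  unfolding comult_F_eq by (simp add: bhom_sumt[OF L] carr_t_sumt)

lemma comult_F_ad_expand:
  "\<delta> (ad h a) = D h (\<lambda>p q. D a (\<lambda>u v. sumt H G (\<lambda>g g'. t2 (ad (g * p) u) (ad (g' * q) v))))"
  unfolding comult_F_eq by (subst D_ad[where s = tscale]) (simp_all add: ad_mult)

lemma tt_A_sumt:
  assumes M: "hmod M"
  shows "(\<And>p q. k p q \<in> carr M) \<Longrightarrow> a \<in> C \<Longrightarrow> tt A M a (sumt H t k) = sumt H t (\<lambda>p q. tt A M a (k p q))"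
    "(\<And>p q. k p q \<in> carr M) \<Longrightarrow> a \<in> C \<Longrightarrow> tt M A (sumt H t k) a = sumt H t (\<lambda>p q. tt M A (k p q) a)"
  using bilinear_on_sumt(2)[OF tt_bilinear[OF hmod_A M] hmod_A M] bilinear_on_sumt(1)[OF tt_bilinear[OF M hmod_A] M hmod_A]
  by simp_all

text \<open>Both sides are a word in the inverse cocycle acting on an iterated coproduct of
  \<open>a\<close>. The word is changed by \<open>inverse_cocycle_D\<close>, the coproduct by
  coassociativity.\<close>

lemma comult_F_coassoc:
  "assoc A A A (map_t H A A A2 A \<delta> id (\<delta> a)) = map_t H A A A A2 id \<delta> (\<delta> a)"
proof -
  let ?t3 = "\<lambda>x y z u v w. tt A A2 (ad x u) (t2 (ad y v) (ad z w))"
  have l1 [simp]: "lin sH tscale (\<lambda>x. ?t3 x y z u v w)" "lin sH tscale (\<lambda>u. ?t3 x y z u v w)" for x y z u v w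
    by (rule bilinear_on_lin(1)[OF tt_bilinear[of A A2]]; simp)+
  have l2 [simp]: "lin sH tscale (\<lambda>x. ?t3 y x z u v w)" "lin sH tscale (\<lambda>x. ?t3 y z x u v w)"
     "lin sH tscale (\<lambda>v. ?t3 x y z u v w)" "lin sH tscale (\<lambda>w. ?t3 x y z u v w)" for x y z u v w
    by (rule bilinear_on_lin(2)[OF tt_bilinear[of A A2]]; simp)+
  have t: "tri tscale (\<lambda>x y z. ?t3 x y z u v w)" for u v w by simp
  have a: "bhom A2 (A \<boxtimes> A2) (\<lambda>t. assoc A A A (map_t H A A A2 A \<delta> id t))"
    by (rule bhom_comp[OF bhom_assoc bhom_map_t]) simp_all
  have as: "assoc A A A (sumt H t g) = sumt H t (\<lambda>p q. assoc A A A (g p q))"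
    if "\<And>p q. g p q \<in> carr_t H A2 A" for t g
    by (rule bhom_sumt[OF bhom_assoc]) (use that in simp_all)
  have c: "tt A2 A (t2 x y) z \<in> carr_t H A2 A" if "x \<in> C" "y \<in> C" "z \<in> C" for x y z
    by (rule tt_carr_t) (use that in simp_all)
  have "assoc A A A (map_t H A A A2 A \<delta> id (\<delta> a)) =
    D a (\<lambda>u v. sumt H G (\<lambda>g g'. assoc A A A (tt A2 A (\<delta> (ad g u)) (ad g' v))))"
    by (simp add: bhom_comult_F_sumt[OF a])
  also have "\<dots> = D a (\<lambda>u v. sumt H G (\<lambda>g g'. D g (\<lambda>p q. D u (\<lambda>u1 u2. sumt H G (\<lambda>r r'.
      ?t3 (r * p) (r' * q) g' u1 u2 v)))))"
    unfolding comult_F_ad_expand by (simp add: tt_A_sumt carr_t_sumt as c)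
  also have "\<dots> = D a (\<lambda>u v. D u (\<lambda>u1 u2. sumt H G (\<lambda>g g'. D g (\<lambda>p q. sumt H G (\<lambda>r r'.
      ?t3 (r * p) (r' * q) g' u1 u2 v)))))"
    by (subst (1 2) sumt_swap) simp
  also have "\<dots> = D a (\<lambda>u v. D u (\<lambda>u1 u2. sumt H G (\<lambda>g g'. D g' (\<lambda>p q. sumt H G (\<lambda>r r'.
      ?t3 g (r * p) (r' * q) u1 u2 v)))))"
    unfolding inverse_cocycle_D[OF t] ..
  also have "\<dots> = D a (\<lambda>u v. D v (\<lambda>v1 v2. sumt H G (\<lambda>g g'. D g' (\<lambda>p q. sumt H G (\<lambda>r r'.
      ?t3 g (r * p) (r' * q) u v1 v2)))))"
    by (rule D_coassoc[where s = tscale]) simp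
  also have "\<dots> = D a (\<lambda>u v. sumt H G (\<lambda>g g'. D g' (\<lambda>p q. D v (\<lambda>v1 v2. sumt H G (\<lambda>r r'.
      ?t3 g (r * p) (r' * q) u v1 v2)))))"
    by (subst (1 2) sumt_swap) simp
  also have "\<dots> = D a (\<lambda>u v. sumt H G (\<lambda>g g'. tt A A2 (ad g u) (\<delta> (ad g' v))))"
    unfolding comult_F_ad_expand by (simp add: tt_A_sumt carr_t_sumt)
  also have "\<dots> = map_t H A A A A2 id \<delta> (\<delta> a)"
    by (simp add: bhom_comult_F_sumt[OF bhom_map_t])
  finally show ?thesis .
qed

lemma coalgebra_in_A: "coalgebra_in A \<delta> et"
  unfolding coalgebra_in_def
proof (intro conjI ballI)
  fix a assume "a \<in> carr A"
  then have a: "a \<in> C" by simp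
  show "assoc A A A (map_t H A A A2 A \<delta> id (\<delta> a)) = map_t H A A A A2 id \<delta> (\<delta> a)"
    by (rule comult_F_coassoc)
  have 1: "bhom A2 A (\<lambda>t. lunit H A (map_t H A A I A et id t))"
    by (rule bhom_comp[OF bhom_lunit bhom_map_t]) simp_all
  have "lunit H A (map_t H A A I A et id (\<delta> a)) = D a (\<lambda>u v. sumt H G (\<lambda>g g'. et (ad g u) * ad g' v))"
    by (simp add: bhom_comult_F_sumt[OF 1] lunit_tt ad_B)
  also have "\<dots> = D a (\<lambda>u v. et u * v)"
  \<comment> \<open>The pointwise identity holds for legs in C, which \<open>D_C_cong\<close> grants
    although the chosen legs of \<Delta>(a) are arbitrary.\<close>
  proof (rule D_C_cong[OF a, where s = sH])
    show "sumt H G (\<lambda>g g'. et (ad g u) * ad g' v) = et u * v" if "u \<in> C" "v \<in> C" for u v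
      using central_ad_norm(1)[OF central_G G_norm_left G_norm_right et_in that(2), of u]
      by (simp add: et_ad that et_mult_et)
  qed simp_all
  finally show "lunit H A (map_t H A A I A et id (\<delta> a)) = a"
    by (simp add: D_et_id)
  have 2: "bhom A2 A (\<lambda>t. runit H A (map_t H A A A I id et t))"
    by (rule bhom_comp[OF bhom_runit bhom_map_t]) simp_all
  have "runit H A (map_t H A A A I id et (\<delta> a)) = D a (\<lambda>u v. sumt H G (\<lambda>g g'. et (ad g' v) * ad g u))"
    by (simp add: bhom_comult_F_sumt[OF 2] runit_tt ad_B)
  also have "\<dots> = D a (\<lambda>u v. et v * u)"
  proof (rule D_C_cong[OF a, where s = sH])
    show "sumt H G (\<lambda>g g'. et (ad g' v) * ad g u) = et v * u" if "u \<in> C" "v \<in> C" for u v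
      using central_ad_norm(2)[OF central_G G_norm_left G_norm_right et_in that(1), of v]
      by (simp add: et_ad that et_mult_et)
  qed simp_all
  also have "\<dots> = D a (\<lambda>u v. et u * v)"
    by (rule D_comm[where s = sH]) simp
  finally show "runit H A (map_t H A A A I id et (\<delta> a)) = a"
    by (simp add: D_et_id)
qed (simp_all add: is_hom_comult_F is_hom_et)

subsection \<open>The bialgebra and the antipode\<close>

lemma et_prod_F:
  assumes a: "a \<in> C" and b: "b \<in> C"
  shows "et (prod_F H F a b) = et a * et b"
proof -
  \<comment> \<open>As \<open>x\<close> centralises the base, et(x y) = et(x et(y)) = et(et(y) x),
    and \<open>et\<close> is linear over the base.\<close>
  have m: "et (x * y) = et y * et x" if "x \<in> C" for x y
    using et_mult_et[of x y] et_mult_B[of "et y" x] C_comm[OF that, of "et y"] by simp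
  have bb: "bil sH (\<lambda>f f'. et f' * et (f * et a))" "bil sH (\<lambda>f f'. et f' * et f)" by simp_all
  have "et (prod_F H F a b) = sumt H F (\<lambda>f f'. et (f' * et b) * et (f * et a))"
    by (simp add: prod_F_eq sumt_push m et_ad a b et_mult_et)
  also have "\<dots> = sumt H F (\<lambda>f f'. et (et b * f') * et (f * et a))"
    using sumt_B_left(2)[OF central_F bb(1), of "et b"] sumt_B[OF central_F bb(1), of "et b"] by simp
  also have "\<dots> = et b * sumt H F (\<lambda>f f'. et f' * et (f * et a))"
    by (simp add: et_mult_B sumt_mult_left mult.assoc)
  also have "\<dots> = et b * sumt H F (\<lambda>f f'. et f' * et (et a * f))"
    using sumt_B_left(1)[OF central_F bb(2), of "et a"] sumt_B[OF central_F bb(2), of "et a"] by simp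
  also have "\<dots> = et b * sumt H F (\<lambda>f f'. et a * et (et f * f'))"
  proof -
    have "et f' * et (et a * f) = et a * et (et f * f')" for f f'
      by (simp add: et_mult_B B_comm[of "et f'"] mult.assoc)
    then show ?thesis by simp
  qed
  also have "\<dots> = et b * (et a * et (sumt H F (\<lambda>f f'. et f * f')))"
    by (simp add: sumt_push sumt_mult_left)
  also have "\<dots> = et a * et b"
    by (simp add: central_et F_norm_left B_comm)
  finally show ?thesis .
qed

text \<open>The inverse cocycle absorbs \<Delta>(1). Its legs act on 1 as base elements, which can
  be gathered on one factor, where their product reduces to the normalisation.\<close>

lemma comult_F_1: "\<delta> 1 = t2 1 1"
proof -
  have ad1: "ad u 1 = u" if "u \<in> B" for u using ad_B[OF that, of 1] by simp
  have b: "bil tscale (\<lambda>x y. t2 (ad x 1) (ad y 1))" by simp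
  have "\<delta> 1 = D 1 (\<lambda>u v. sumt H G (\<lambda>g g'. t2 (ad (g * u) 1) (ad (g' * v) 1)))"
    unfolding comult_F_eq by (rule D_one_B[where s = tscale]) (simp_all add: ad_mult ad1)
  also have "\<dots> = sumt H G (\<lambda>g g'. t2 (ad g 1) (ad g' 1))"
    by (subst sumt_swap) (rule sumt_e(2)[OF central_G b])
  also have "\<dots> = sumt H G (\<lambda>g g'. t2 1 (ad (et g * et g') 1))"
    using tt_B[of A A "et _" 1 "et _"] by (simp add: ad_et ad1 ad_mult ad_B)
  also have "\<dots> = t2 1 (ad (sumt H G (\<lambda>g g'. et g * et g')) 1)"
    using tt_A_sumt(1)[OF hmod_A, of "\<lambda>g g'. ad (et g * et g') 1" 1] by (simp add: ad_sumt)
  also have "sumt H G (\<lambda>g g'. et g * et g') = et (sumt H G (\<lambda>g g'. et g * g'))"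
    by (simp add: sumt_push et_mult_B)
  finally show ?thesis
    by (simp add: central_et G_norm_left)
qed

text \<open>H-linearity of \<open>\<delta>\<close> reduces this to the unit; of the two base
  elements acting there, one is put on each factor.\<close>

lemma comult_F_unit:
  assumes z: "z \<in> B" and w: "w \<in> B"
  shows "\<delta> (z * w) = t2 z w"
proof -
  have "\<delta> (z * w) = \<delta> (ad (z * w) 1)" using z w by (simp add: ad_B)
  also have "\<dots> = act A2 (z * w) (t2 1 1)"
    using is_hom_comult_F by (simp add: is_hom_def comult_F_1[symmetric])
  also have "\<dots> = act A2 w (act A2 z (t2 1 1))"
    using hmodD(6)[OF hmod_tensor[OF hmod_A hmod_A], of "t2 1 1" w z] B_comm[OF z w] by simp
  also have "\<dots> = t2 z w"
    using act_B_tt(1)[of A A 1 1 z] act_B_tt(2)[of A A z 1 w] z w by (simp add: ad_B)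
  finally show ?thesis .
qed

lemma middle_braid_tt:
  assumes "a \<in> C" "b \<in> C" "c \<in> C" "d \<in> C"
  shows "middle_braid A (tt A2 A2 (t2 a b) (t2 c d)) =
    sumt H F (\<lambda>f f'. sumt H G (\<lambda>g g'. tt A2 A2 (t2 a (ad (g * f') c)) (t2 (ad (g' * f) b) d)))"
proof -
  let ?inner = "assoc A A A \<circ> map_t H A2 A A2 A (braid A A) id \<circ> assoc_inv A A A"
  have i: "bhom (A \<boxtimes> A2) (A \<boxtimes> A2) ?inner"
    by (rule bhom_comp'[OF bhom_comp'[OF bhom_assoc bhom_map_t] bhom_assoc_inv]) simp_all
  have c3: "tt A A2 x (t2 y z) \<in> carr_t H A A2" "tt A2 A (t2 y z) x \<in> carr_t H A2 A"
    if "x \<in> C" "y \<in> C" "z \<in> C" for x y z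
    using tt_carr_t[of A A2 x "t2 y z"] tt_carr_t[of A2 A "t2 y z" x] that by simp_all
  have c4: "tt A (A \<boxtimes> A2) w (tt A A2 x (t2 y z)) \<in> carr_t H A (A \<boxtimes> A2)"
    if "w \<in> C" "x \<in> C" "y \<in> C" "z \<in> C" for w x y z
    using tt_carr_t[of A "A \<boxtimes> A2" w "tt A A2 x (t2 y z)"] that c3 by simp
  have s: "assoc A A A (sumt H t k) = sumt H t (\<lambda>p q. assoc A A A (k p q))"
    if "\<And>p q. k p q \<in> carr_t H A2 A" for t k
    by (rule bhom_sumt[OF bhom_assoc]) (use that in simp_all)
  have s': "assoc_inv A A A2 (sumt H t k) = sumt H t (\<lambda>p q. assoc_inv A A A2 (k p q))"
    if "\<And>p q. k p q \<in> carr_t H A (A \<boxtimes> A2)" for t k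
    by (rule bhom_sumt[OF bhom_assoc_inv]) (use that in simp_all)
  have in_eq: "?inner (tt A A2 b (t2 c d)) =
    sumt H F (\<lambda>f f'. sumt H G (\<lambda>g g'. tt A A2 (ad (g * f') c) (t2 (ad (g' * f) b) d)))"
    using assms by (simp add: braid_tt tt_A_sumt carr_t_sumt s c3)
  have "middle_braid A (tt A2 A2 (t2 a b) (t2 c d)) =
    assoc_inv A A A2 (tt A (A \<boxtimes> A2) a (?inner (tt A A2 b (t2 c d))))"
    \<comment> \<open>The composite on the last three factors has to stay folded, since its
      linearity over the base is known for it as a whole.\<close>
    using assms i c3 unfolding middle_braid_def by (simp del: o_apply add: o_apply[of "_ \<circ> _" "assoc A A A2"] o_apply[of "assoc_inv A A A2"])
  also have "\<dots> = sumt H F (\<lambda>f f'. sumt H G (\<lambda>g g'. tt A2 A2 (t2 a (ad (g * f') c)) (t2 (ad (g' * f) b) d)))"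
    unfolding in_eq using assms by (simp add: tt_A_sumt carr_t_sumt s' c3 c4)
  finally show ?thesis .
qed

lemma bhom_middle_braid: "bhom (A2 \<boxtimes> A2) (A2 \<boxtimes> A2) (middle_braid A)"
proof -
  let ?inner = "assoc A A A \<circ> map_t H A2 A A2 A (braid A A) id \<circ> assoc_inv A A A"
  have i: "bhom (A \<boxtimes> A2) (A \<boxtimes> A2) ?inner"
    by (rule bhom_comp'[OF bhom_comp'[OF bhom_assoc bhom_map_t] bhom_assoc_inv]) simp_all
  show ?thesis
    unfolding middle_braid_def
    by (rule bhom_comp'[OF bhom_comp'[OF bhom_assoc_inv bhom_map_t] bhom_assoc]) (use i in simp_all)
qed

text \<open>Naming the element \<open>x\<close> whose coproduct is moved outwards orients the swap,
  so that it can serve as a rewrite rule.\<close>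

lemma sumt_out:
  "sumt H s (\<lambda>a b. D x (f a b)) = D x (\<lambda>c d. sumt H s (\<lambda>a b. f a b c d))"
  by (rule sumt_swap)

text \<open>Both sides are words in \<open>F\<close> and its inverse acting on the legs of
  \<Delta>(a) and \<Delta>(b), and the words agree by \<open>middle_braid_D\<close>.\<close>

lemma comult_F_prod_F:
  assumes a: "a \<in> C" and b: "b \<in> C"
  shows "\<delta> (prod_F H F a b) = map_t H A2 A2 A A \<mu> \<mu>
    (middle_braid A (tt A2 A2 (\<delta> a) (\<delta> b)))"
proof -
  \<comment> \<open>Here \<open>u\<close>, \<open>v\<close> are to be the legs of \<open>a\<close>
    and \<open>w\<close>, \<open>x\<close> those of \<open>b\<close>. Slots one and three of the
    word thus belong to \<open>a\<close>, two and four to \<open>b\<close>, and the braiding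
    concerns the second and third.\<close>
  define \<Psi> where "\<Psi> u v w x p q r s = t2 (ad p u * ad q w) (ad r v * ad s x)" for u v w x p q r s
  have l: "lin sH tscale (\<lambda>z. t2 (f z) y)" "lin sH tscale (\<lambda>z. t2 y (f z))"
    if "lin sH sH f" "\<And>z. f z \<in> C" "y \<in> C" for f y
    using bilinear_on_lin[OF tt_bilinear[OF hmod_A hmod_A], of sH f y] that by simp_all
  have [simp]: "lin sH tscale (\<Psi> u v w x p q r)" "lin sH tscale (\<lambda>s. \<Psi> u v w x p q s r)"
    "lin sH tscale (\<lambda>s. \<Psi> u v w x p s q r)" "lin sH tscale (\<lambda>s. \<Psi> u v w x s p q r)"
    "lin sH tscale (\<lambda>s. \<Psi> u v w s x p q r)" "lin sH tscale (\<lambda>s. \<Psi> u v s w x p q r)"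
    "lin sH tscale (\<lambda>s. \<Psi> u s v w x p q r)" "lin sH tscale (\<lambda>s. \<Psi> s u v w x p q r)" for u v w x p q r
    unfolding \<Psi>_def by (rule l; simp)+
  have Q: "quad tscale (\<lambda>p q r s. D a (\<lambda>u v. D b (\<lambda>w x. \<Psi> u v w x p q r s)))" by simp
  have t2_sumt: "t2 (sumt H t k) y = sumt H t (\<lambda>p q. t2 (k p q) y)" "t2 y (sumt H t k) = sumt H t (\<lambda>p q. t2 y (k p q))"
    if "\<And>p q. k p q \<in> C" "y \<in> C" for t k y
    using tt_A_sumt[OF hmod_A, of k y t] that by simp_all
  have "\<delta> (prod_F H F a b) = sumt H F (\<lambda>f f'. D (ad f a * ad f' b) (\<lambda>m n. sumt H G (\<lambda>c d. t2 (ad c m) (ad d n))))"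
    unfolding comult_F_eq prod_F_eq by (rule D_sumt[where s = tscale]) simp
  also have "\<dots> = sumt H F (\<lambda>f f'. D (ad f a) (\<lambda>m n. D (ad f' b) (\<lambda>m' n'. sumt H G (\<lambda>c d. t2 (ad c (m * m')) (ad d (n * n'))))))"
    by (subst D_mult[where s = tscale]) simp_all
  also have "\<dots> = sumt H F (\<lambda>f f'. D f (\<lambda>p q. D a (\<lambda>u v. D f' (\<lambda>r t. D b (\<lambda>w x.
      sumt H G (\<lambda>c d. t2 (ad c (ad p u * ad r w)) (ad d (ad q v * ad t x))))))))"
    by (subst D_ad[where s = tscale], simp, subst D_ad[where s = tscale], simp, rule refl)
  also have "\<dots> = sumt H F (\<lambda>f f'. D f (\<lambda>p q. D a (\<lambda>u v. D f' (\<lambda>r t. D b (\<lambda>w x.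
      sumt H G (\<lambda>c d. D c (\<lambda>c1 c2. D d (\<lambda>d1 d2. \<Psi> u v w x (c1 * p) (c2 * r) (d1 * q) (d2 * t)))))))))"
  proof -
    have "t2 (ad c (ad p u * ad r w)) (ad d (ad q v * ad t x)) =
      D c (\<lambda>c1 c2. D d (\<lambda>d1 d2. \<Psi> u v w x (c1 * p) (c2 * r) (d1 * q) (d2 * t)))" for c d p q r t u v w x
      by (simp add: ad_prod[symmetric] t2_sumt C_sumt \<Psi>_def ad_mult, rule sumt_swap)
    then show ?thesis by simp
  qed
  \<comment> \<open>The coproducts of \<open>a\<close> and \<open>b\<close> move inside, so that a
    map multilinear in the four slots of the word is left.\<close>
  also have "\<dots> = sumt H F (\<lambda>f f'. D f (\<lambda>p q. D f' (\<lambda>r t.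
      sumt H G (\<lambda>c d. D c (\<lambda>c1 c2. D d (\<lambda>d1 d2. D a (\<lambda>u v. D b (\<lambda>w x. \<Psi> u v w x (c1 * p) (c2 * r) (d1 * q) (d2 * t)))))))))"
    by (simp only: sumt_out[where x = b], simp only: sumt_out[where x = a])
  also have "\<dots> = sumt H G (\<lambda>i j. sumt H G (\<lambda>g h. sumt H F (\<lambda>c d. sumt H G (\<lambda>r t. sumt H F (\<lambda>m n. sumt H F (\<lambda>k l.
      D a (\<lambda>u v. D b (\<lambda>w x. \<Psi> u v w x (k * g) (l * (r * (d * i))) (m * (t * (c * h))) (n * j)))))))))"
    by (rule middle_braid_D[OF Q])
  also have "\<dots> = D a (\<lambda>u v. D b (\<lambda>w x. sumt H G (\<lambda>i j. sumt H G (\<lambda>g h. sumt H F (\<lambda>c d. sumt H G (\<lambda>r t.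
      sumt H F (\<lambda>m n. sumt H F (\<lambda>k l. \<Psi> u v w x (k * g) (l * (r * (d * i))) (m * (t * (c * h))) (n * j)))))))))"
    by (simp only: sumt_out[where x = b], simp only: sumt_out[where x = a])
  \<comment> \<open>The last two copies of \<open>F\<close> are the two products, \<open>c\<close>,
    \<open>d\<close> with \<open>r\<close>, \<open>t\<close> form the braiding, and the first two
    copies of the inverse belong to the coproducts of \<open>b\<close> and \<open>a\<close>.\<close>
  also have "\<dots> = D a (\<lambda>u v. D b (\<lambda>w x. sumt H G (\<lambda>i j. sumt H G (\<lambda>g h. sumt H F (\<lambda>c d. sumt H G (\<lambda>r t.
      t2 (prod_F H F (ad g u) (ad (r * d) (ad i w))) (prod_F H F (ad (t * c) (ad h v)) (ad j x))))))))"
  proof -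
    have "t2 (prod_F H F (ad g u) (ad (r * d) (ad i w))) (prod_F H F (ad (t * c) (ad h v)) (ad j x)) =
      sumt H F (\<lambda>m n. sumt H F (\<lambda>k l. \<Psi> u v w x (k * g) (l * (r * (d * i))) (m * (t * (c * h))) (n * j)))"
      for g u r d i w t c h v j x
      unfolding prod_F_eq
      by (simp add: t2_sumt C_sumt \<Psi>_def ad_mult)
    then show ?thesis by simp
  qed
  also have "\<dots> = map_t H A2 A2 A A \<mu> \<mu>
    (middle_braid A (tt A2 A2 (\<delta> a) (\<delta> b)))" (is "_ = ?L (tt _ _ (\<delta> a) (\<delta> b))")
  proof -
    have L: "bhom (A2 \<boxtimes> A2) A2 (\<lambda>t. ?L t)"
      by (rule bhom_comp[OF bhom_map_t bhom_middle_braid]) simp_all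
    have T: "hmod A2" "hmod (A2 \<boxtimes> A2)" by simp_all
    note S = bilinear_on_sumt[OF tt_bilinear[OF T(1) T(1)] T(1) T(1), unfolded tensor_obj_simps]
    note c = tt_carr_t[OF T(1) T(1), unfolded tensor_obj_simps]
    have mm: "map_t H A2 A2 A A \<mu> \<mu> (sumt H t k) = sumt H t (\<lambda>p q. map_t H A2 A2 A A \<mu> \<mu> (k p q))"
      if "\<And>p q. k p q \<in> carr_t H A2 A2" for t k
      by (rule bhom_sumt[OF bhom_map_t]) (use that in simp_all)
    have 1: "?L (tt A2 A2 (t2 x y) (t2 z w)) = sumt H F (\<lambda>c d. sumt H G (\<lambda>r t.
      t2 (prod_F H F x (ad (r * d) z)) (prod_F H F (ad (t * c) y) w)))"
      if "x \<in> C" "y \<in> C" "z \<in> C" "w \<in> C" for x y z w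
      using that by (simp add: middle_braid_tt mm carr_t_sumt c)
    have "?L (tt A2 A2 (\<delta> a) (\<delta> b)) =
      D b (\<lambda>w x. sumt H G (\<lambda>i j. D a (\<lambda>u v. sumt H G (\<lambda>g h.
        ?L (tt A2 A2 (t2 (ad g u) (ad h v)) (t2 (ad i w) (ad j x)))))))"
    proof -
      have "?L (sumt H t k) = sumt H t (\<lambda>p q. ?L (k p q))" if "\<And>p q. k p q \<in> carr_t H A2 A2" for t k
        by (rule bhom_sumt[OF L]) (use that in simp_all)
      then show ?thesis
        unfolding comult_F_eq by (simp add: S carr_t_sumt c)
    qed
    also have "\<dots> = D a (\<lambda>u v. D b (\<lambda>w x. sumt H G (\<lambda>i j. sumt H G (\<lambda>g h.
        ?L (tt A2 A2 (t2 (ad g u) (ad h v)) (t2 (ad i w) (ad j x)))))))"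
      by (simp only: sumt_out[where x = a])
    finally show ?thesis
      by (simp add: 1)
  qed
  finally show ?thesis .
qed

lemma bialgebra_in_A: "bialgebra_in A \<mu> (\<lambda>x. x) \<delta> et"
  unfolding bialgebra_in_def
proof (intro conjI ballI)
  show "algebra_in A \<mu> (\<lambda>x. x)" by (rule algebra_in_A)
  show "coalgebra_in A \<delta> et" by (rule coalgebra_in_A)
  have 1: "bhom A2 A2 (\<lambda>t. \<delta> (\<mu> t))"
    by (rule bhom_comp[OF bhom_comult_F bhom_mult_F])
  have 2: "bhom A2 A2 (\<lambda>t. map_t H A2 A2 A A \<mu> \<mu>
      (middle_braid A (map_t H A A A2 A2 \<delta> \<delta> t)))"
    by (rule bhom_comp[OF bhom_map_t], simp_all, rule bhom_comp[OF bhom_middle_braid bhom_map_t]) simp_all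
  show "\<delta> (\<mu> t) = map_t H A2 A2 A A \<mu> \<mu>
      (middle_braid A (map_t H A A A2 A2 \<delta> \<delta> t))" if "t \<in> carr A2" for t
    by (rule bhom_ext[OF _ _ 1 2]) (use that in \<open>simp_all add: comult_F_prod_F\<close>)
  have 3: "bhom A2 I (\<lambda>t. et (\<mu> t))"
    by (rule bhom_comp[OF bhom_et bhom_mult_F])
  have 4: "bhom A2 I (\<lambda>t. lunit H I (map_t H A A I I et et t))"
    by (rule bhom_comp[OF bhom_lunit bhom_map_t]) simp_all
  show "et (\<mu> t) = lunit H I (map_t H A A I I et et t)" if "t \<in> carr A2" for t
    by (rule bhom_ext[OF _ _ 3 4]) (use that in \<open>simp_all add: et_prod_F lunit_tt\<close>)
  have 5: "bhom (I \<boxtimes> I) A2 (\<lambda>t. \<delta> (lunit H I t))"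
    by (rule bhom_comp[OF bhom_comult_F], rule bhom_comp[OF bhom_unit bhom_lunit]) simp
  show "\<delta> (lunit H I t) = map_t H I I A A (\<lambda>x. x) (\<lambda>x. x) t" if "t \<in> carr (I \<boxtimes> I)" for t
    by (rule bhom_ext[OF _ _ 5 bhom_map_t]) (use that in \<open>simp_all add: lunit_tt comult_F_unit\<close>)
qed

lemma is_hom_S: "is_hom A A S"
  by (auto simp: is_hom_def S_ad linD(1,2)[OF antipode_linear])

text \<open>The cocycle of the product meets the inverse from the coproduct; the resulting
  \<Delta>(1) acts trivially on products in C, and the ordinary convolution in H remains.\<close>

lemma prod_F_comult_F:
  assumes a: "a \<in> C" and k: "\<And>u. u \<in> C \<Longrightarrow> k u \<in> C" "\<And>u. u \<in> C \<Longrightarrow> k' u \<in> C" "lin sH sH k" "lin sH sH k'"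
    and ad: "\<And>h u. k (ad h u) = ad h (k u)" "\<And>h u. k' (ad h u) = ad h (k' u)"
    and L: "bhom A A k" "bhom A A k'"
  shows "\<mu> (map_t H A A A A k k' (\<delta> a)) = D a (\<lambda>u v. k u * k' v)"
proof -
  note [simp] = lin_compose[OF k(3)] lin_compose[OF k(4)]
  have M: "bhom A2 A (\<lambda>t. \<mu> (map_t H A A A A k k' t))"
    by (rule bhom_comp[OF bhom_mult_F bhom_map_t]) (simp_all add: L)
  have "\<mu> (map_t H A A A A k k' (\<delta> a)) = D a (\<lambda>u v. sumt H G (\<lambda>g g'. prod_F H F (ad g (k u)) (ad g' (k' v))))"
    by (simp add: bhom_comult_F_sumt[OF M] L k ad)
  also have "\<dots> = D a (\<lambda>u v. sumt H F (\<lambda>f f'. sumt H G (\<lambda>g g'. ad (f * g) (k u) * ad (f' * g') (k' v))))"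
    unfolding prod_F_eq ad_mult by (intro arg_cong[where f = "D a"] ext sumt_swap)
  also have "\<dots> = D a (\<lambda>u v. D 1 (\<lambda>p q. ad p (k u) * ad q (k' v)))"
    by (subst sumt_F_G[where s = sH]) simp_all
  also have "\<dots> = D a (\<lambda>u v. k u * k' v)"
    by (rule D_C_cong[OF a, where s = sH]) (simp_all add: ad_prod k)
  finally show ?thesis .
qed

lemma hopf_algebra_in_A: "hopf_algebra_in A \<mu> (\<lambda>x. x) \<delta> et S"
  unfolding hopf_algebra_in_def
proof (intro conjI ballI)
  show "bialgebra_in A \<mu> (\<lambda>x. x) \<delta> et" by (rule bialgebra_in_A)
  show "is_hom A A S" by (rule is_hom_S)
  note S = is_hom_bhom[OF is_hom_S] antipode_linear
  fix a assume "a \<in> carr A"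
  then have a: "a \<in> C" by simp
  \<comment> \<open>This convolution gives \<open>es a\<close>, which coincides with
    \<open>et a\<close> on the centraliser.\<close>
  show "\<mu> (map_t H A A A A S id (\<delta> a)) = et a"
    by (subst prod_F_comult_F) (simp_all add: a S S_ad D_S_id es_C id_def)
  show "\<mu> (map_t H A A A A id S (\<delta> a)) = et a"
    by (subst prod_F_comult_F) (simp_all add: a S S_ad D_id_S id_def)
qed

end

text \<open>The first conjunct ties \<open>mult_F\<close>, defined through a choice of expansion, to
  the product formula on generators. The normalisation of \<open>F\<close> is what makes 1 a unit of
  the twisted product.\<close>

theorem theorem3p3:
  fixes H :: "('k::field, 'h::{ring,monoid_mult}) qgroupoid"
    and F G :: "('h, 'h, 'k) tensor"
  assumes "quantum_groupoid H"
    and "cocommutative H"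
    and "weak_invertible_unit_2_cocycle H F G"
    and "sw H (\<lambda>f f'. smult H (counit H f) f') F = 1"
  shows "(\<forall>a\<in>C_H H. \<forall>b\<in>C_H H. mult_F H F (tens_t H (C_obj H) (C_obj H) a b) = prod_F H F a b) \<and>
    twisted_modules.hopf_algebra_in H F G (C_obj H)
      (mult_F H F) (\<lambda>x. x) (comult_F H G) (eps_t H) (antipode H)"
proof -
  interpret twisting_cocycle H F G
    using assms by (simp add: twisting_cocycle_def twisting_cocycle_axioms_def
        cocommutative_quantum_groupoid_def cocommutative_quantum_groupoid_axioms_def)
  show ?thesis using mult_F_tt hopf_algebra_in_A by blast
qed

end
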